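(* Let $\mathcal{C}$ be a 2-Calabi-Yau category with cluster-tilting object, $f$ a tropical frieze on $\mathcal{C}$, $T=T_1\oplus\ldots\oplus T_n$ a basic cluster-tilting object of $\mathcal{C}$ ($T_i$ indecomposable), $1\leq k\leq n$, and $T'=\mu_k(T)=T'_k\oplus\bigoplus_{i\neq k}T_i$ the mutation of $T$ at $T_k$. Suppose that the quivers $Q$ and $Q'$ of the endomorphism algebras $\mathrm{End}_{\mathcal{C}}(T)$ and $\mathrm{End}_{\mathcal{C}}(T')$ do not have loops nor 2-cycles. Then $$g(T')=\begin{cases}\phi_+(g(T)) & \text{if } g_k(T)\geq 0,\\ \phi_-(g(T)) & \text{if } g_k(T)\leq 0.\end{cases}$$
   Context: Work over an algebraically closed field. A "2-Calabi-Yau category with cluster-tilting object" is a linear triangulated category $\mathcal{C}$ over this field with suspension functor $\Sigma$ in which all idempotents split, such that: (a) all spaces $\mathcal{C}(X,Y)$ are finite-dimensional (so $\mathcal{C}$ is Krull-Schmidt); (b) there are bifunctorial isomorphisms $D\mathcal{C}(X,Y)\simeq \mathcal{C}(Y,\Sigma^2X)$, where $D$ is duality over the ground field; (c) $\mathcal{C}$ admits a cluster-tilting object $T$, i.e. $\mathcal{C}(T,\Sigma T)=0$, the indecomposable direct summands of $T$ are pairwise non-isomorphic ($T$ is basic), and every object $X$ with $\mathcal{C}(T,\Sigma X)=0$ belongs to $\mathrm{add}\,T$. Write $\mathrm{Ext}^1_{\mathcal{C}}(X,Y)=\mathcal{C}(X,\Sigma Y)$. A tropical frieze on $\mathcal{C}$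 is a map $f: obj(\mathcal{C})\to\mathbb{Z}$ such that: (d1) $f(X)=f(Y)$ if $X\simeq Y$; (d2) $f(X\oplus Y)=f(X)+f(Y)$ for all $X,Y$; (d3) for all objects $L,M$ with $\dim \mathrm{Ext}^1_{\mathcal{C}}(L,M)=1$, one has $f(L)+f(M)=\max\{f(E),f(E')\}$, where $E$ and $E'$ are the middle terms of the non-split triangles $L\to E\to M\to\Sigma L$ and $M\to E'\to L\to\Sigma M$. The quiver $Q$ of $\mathrm{End}_{\mathcal{C}}(T)$ has vertices $1,\ldots,n$ and arrows $i\to j$ corresponding to a basis of irreducible morphisms $T_i\to T_j$ in $\mathrm{add}\,T$. Let $b_{ij}$ be the number of arrows $i\to j$ minus the number of arrows $j\to i$ in $Q$, and $[b]_+=\max\{b,0\}$. Define $g_i(T)=\sum_r[b_{ri}]_+f(T_r)-\sum_s[b_{is}]_+f(T_s)$ and $g(T)=\sum_{i=1}^n g_i(T)[T_i]$ in the split Grothendieck group $K_0(\mathrm{add}\,T)$; $g(T')\in K_0(\mathrm{add}\,T')$ is defined in the same way from $T'$ and $Q'$. Mutation: $T'_k$ is the unique (up to isomorphism) indecomposable object not isomorphic to $T_k$ such that $T'=T'_k\oplus\bigoplus_{i\neq k}T_i$ is cluster-tilting. Then $\mathrm{Ext}^1_{\mathcal{C}}(T'_k,T_k)$ is one-dimensional and the non-split triangles are $T'_k\to E\to T_k\to\Sigma T'_k$ and $T_k\to E'\to T'_k\to\Sigma T_k$ with $E=\bigoplus_r T_r^{[b_{rk}]_+}$ and $E'=\bigoplus_s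 T_s^{[b_{ks}]_+}$. The linear maps $\phi_+,\phi_-:K_0(\mathrm{add}\,T)\to K_0(\mathrm{add}\,T')$ are defined by $\phi_\pm([T_i])=[T_i]$ for $i\neq k$, $\phi_+([T_k])=[E]-[T'_k]=-[T'_k]+\sum_r[b_{rk}]_+[T_r]$ and $\phi_-([T_k])=[E']-[T'_k]=-[T'_k]+\sum_s[b_{ks}]_+[T_s]$. *)

theory Defs
  imports
    "HOL-Computational_Algebra.Computational_Algebra"
    "HOL-Algebra.Free_Abelian_Groups"
    "HOL-Algebra.Generated_Groups"
begin

section \<open>Linear triangulated categories\<close>

text \<open>
  The objects are the elements of the type \<open>'o\<close>, the ground field is the type \<open>'k\<close>, and all
  Hom-spaces are linear subspaces of one ambient \<open>'k\<close>-vector space \<open>'m\<close> (with scalar multiplication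
  \<open>scl\<close>). This is no restriction: for any linear category one may take for \<open>'m\<close> the direct sum of all
  its Hom-spaces, with the composition (and the suspension) extended bilinearly (linearly), so
  composition and suspension of morphisms need no object arguments. Nothing is required of these
  operations outside the Hom-spaces.
  As usual \<open>g \<cdot> f\<close> is ``first \<open>f\<close>, then \<open>g\<close>''; \<open>tri C X Y Z u v w\<close> says that
  \<open>X \<rightarrow> Y \<rightarrow> Z \<rightarrow> \<Sigma> X\<close> (with morphisms \<open>u\<close>, \<open>v\<close>, \<open>w\<close>) is a distinguished triangle.
\<close>

record ('o, 'm, 'k) tricat =
  Hom :: "'o \<Rightarrow> 'o \<Rightarrow> 'm set"
  idm :: "'o \<Rightarrow> 'm"
  cmp :: "'m \<Rightarrow> 'm \<Rightarrow> 'm" (infixl \<open>\<cdot>\<index>\<close> 70)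
  scl :: "'k \<Rightarrow> 'm \<Rightarrow> 'm"
  susp :: "'o \<Rightarrow> 'o"
  suspm :: "'m \<Rightarrow> 'm"
  tri :: "'o \<Rightarrow> 'o \<Rightarrow> 'o \<Rightarrow> 'm \<Rightarrow> 'm \<Rightarrow> 'm \<Rightarrow> bool"

definition hdim :: "('o, 'm::ab_group_add, 'k::field) tricat \<Rightarrow> 'm set \<Rightarrow> nat" where
  "hdim C V = vector_space.dim (scl C) V"

definition is_inverse :: "('o, 'm, 'k) tricat \<Rightarrow> 'o \<Rightarrow> 'o \<Rightarrow> 'm \<Rightarrow> 'm \<Rightarrow> bool" where
  "is_inverse C X Y a b \<longleftrightarrow>
     a \<in> Hom C X Y \<and> b \<in> Hom C Y X \<and> b \<cdot>\<^bsub>C\<^esub> a = idm C X \<and> a \<cdot>\<^bsub>C\<^esub> b = idm C Y"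

definition is_iso :: "('o, 'm, 'k) tricat \<Rightarrow> 'o \<Rightarrow> 'o \<Rightarrow> 'm \<Rightarrow> bool" where
  "is_iso C X Y a \<longleftrightarrow> (\<exists>b. is_inverse C X Y a b)"

definition isomorphic :: "('o, 'm, 'k) tricat \<Rightarrow> 'o \<Rightarrow> 'o \<Rightarrow> bool" where
  "isomorphic C X Y \<longleftrightarrow> (\<exists>a. is_iso C X Y a)"

definition zero_object :: "('o, 'm::ab_group_add, 'k) tricat \<Rightarrow> 'o \<Rightarrow> bool" where
  "zero_object C Z \<longleftrightarrow> (\<forall>X. Hom C X Z = {0} \<and> Hom C Z X = {0})"

definition is_biproduct ::
  "('o, 'm::ab_group_add, 'k) tricat \<Rightarrow> 'o \<Rightarrow> 'o \<Rightarrow> 'o \<Rightarrow> bool" where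
  "is_biproduct C X Y P \<longleftrightarrow> (\<exists>i j p q.
     i \<in> Hom C X P \<and> j \<in> Hom C Y P \<and> p \<in> Hom C P X \<and> q \<in> Hom C P Y \<and>
     p \<cdot>\<^bsub>C\<^esub> i = idm C X \<and> q \<cdot>\<^bsub>C\<^esub> j = idm C Y \<and> p \<cdot>\<^bsub>C\<^esub> j = 0 \<and> q \<cdot>\<^bsub>C\<^esub> i = 0 \<and>
     i \<cdot>\<^bsub>C\<^esub> p + j \<cdot>\<^bsub>C\<^esub> q = idm C P)"

text \<open>\<open>is_dsum C I A P\<close>: \<open>P\<close> is a direct sum of the family \<open>A\<close> over the finite index set \<open>I\<close>.\<close>

definition is_dsum ::
  "('o, 'm::ab_group_add, 'k) tricat \<Rightarrow> nat set \<Rightarrow> (nat \<Rightarrow> 'o) \<Rightarrow> 'o \<Rightarrow> bool" where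
  "is_dsum C I A P \<longleftrightarrow> finite I \<and> (\<exists>\<iota> \<pi>.
     (\<forall>i\<in>I. \<iota> i \<in> Hom C (A i) P \<and> \<pi> i \<in> Hom C P (A i)) \<and>
     (\<forall>i\<in>I. \<forall>j\<in>I. \<pi> i \<cdot>\<^bsub>C\<^esub> \<iota> j = (if i = j then idm C (A i) else 0)) \<and>
     (\<Sum>i\<in>I. \<iota> i \<cdot>\<^bsub>C\<^esub> \<pi> i) = idm C P)"

definition indecomposable :: "('o, 'm::ab_group_add, 'k) tricat \<Rightarrow> 'o \<Rightarrow> bool" where
  "indecomposable C X \<longleftrightarrow>
     \<not> zero_object C X \<and> (\<forall>A B. is_biproduct C A B X \<longrightarrow> zero_object C A \<or> zero_object C B)"

locale linear_category = vector_space "scl C"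
  for C :: "('o, 'm::ab_group_add, 'k::field) tricat" (structure) +
  assumes Hom_subspace: "subspace (Hom C X Y)"
    and idm_in_Hom: "idm C X \<in> Hom C X X"
    and cmp_in_Hom: "\<lbrakk>f \<in> Hom C X Y; g \<in> Hom C Y Z\<rbrakk> \<Longrightarrow> g \<cdot> f \<in> Hom C X Z"
    and cmp_assoc: "\<lbrakk>f \<in> Hom C X Y; g \<in> Hom C Y Z; h \<in> Hom C Z W\<rbrakk> \<Longrightarrow> h \<cdot> (g \<cdot> f) = (h \<cdot> g) \<cdot> f"
    and cmp_idm_right: "f \<in> Hom C X Y \<Longrightarrow> f \<cdot> idm C X = f"
    and cmp_idm_left: "f \<in> Hom C X Y \<Longrightarrow> idm C Y \<cdot> f = f"
    and cmp_add_right: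
      "\<lbrakk>f \<in> Hom C X Y; f' \<in> Hom C X Y; g \<in> Hom C Y Z\<rbrakk> \<Longrightarrow> g \<cdot> (f + f') = g \<cdot> f + g \<cdot> f'"
    and cmp_add_left:
      "\<lbrakk>f \<in> Hom C X Y; g \<in> Hom C Y Z; g' \<in> Hom C Y Z\<rbrakk> \<Longrightarrow> (g + g') \<cdot> f = g \<cdot> f + g' \<cdot> f"
    and cmp_scl_right: "\<lbrakk>f \<in> Hom C X Y; g \<in> Hom C Y Z\<rbrakk> \<Longrightarrow> g \<cdot> scl C c f = scl C c (g \<cdot> f)"
    and cmp_scl_left: "\<lbrakk>f \<in> Hom C X Y; g \<in> Hom C Y Z\<rbrakk> \<Longrightarrow> scl C c g \<cdot> f = scl C c (g \<cdot> f)"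

text \<open>
  The suspension is only required to be a linear auto-equivalence (fully faithful and essentially
  surjective), not an automorphism.
\<close>

locale triangulated_category = linear_category C
  for C :: "('o, 'm::ab_group_add, 'k::field) tricat" (structure) +
  assumes zero_object_exists: "\<exists>Z. zero_object C Z"
    and biproduct_exists: "\<exists>P. is_biproduct C X Y P"
    and suspm_idm: "suspm C (idm C X) = idm C (susp C X)"
    and suspm_cmp:
      "\<lbrakk>f \<in> Hom C X Y; g \<in> Hom C Y Z\<rbrakk> \<Longrightarrow> suspm C (g \<cdot> f) = suspm C g \<cdot> suspm C f"
    and suspm_add:
      "\<lbrakk>f \<in> Hom C X Y; g \<in> Hom C X Y\<rbrakk> \<Longrightarrow> suspm C (f + g) = suspm C f + suspm C g"
    and suspm_scl: "f \<in> Hom C X Y \<Longrightarrow> suspm C (scl C c f) = scl C c (suspm C f)"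
    and suspm_fully_faithful:
      "bij_betw (suspm C) (Hom C X Y) (Hom C (susp C X) (susp C Y))"
    and susp_ess_surj: "\<exists>X. isomorphic C (susp C X) Y"
    and tri_Hom:
      "tri C X Y Z u v w \<Longrightarrow> u \<in> Hom C X Y \<and> v \<in> Hom C Y Z \<and> w \<in> Hom C Z (susp C X)"
    and tri_iso:
      "\<lbrakk>tri C X Y Z u v w;
        u' \<in> Hom C X' Y'; v' \<in> Hom C Y' Z'; w' \<in> Hom C Z' (susp C X');
        is_iso C X X' a; is_iso C Y Y' b; is_iso C Z Z' h;
        b \<cdot> u = u' \<cdot> a; h \<cdot> v = v' \<cdot> b; suspm C a \<cdot> w = w' \<cdot> h\<rbrakk>
       \<Longrightarrow> tri C X' Y' Z' u' v' w'"
    and tri_idm: "zero_object C Z \<Longrightarrow> tri C X X Z (idm C X) 0 0"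
    and tri_exists: "u \<in> Hom C X Y \<Longrightarrow> \<exists>Z v w. tri C X Y Z u v w"
    and tri_rotate:
      "\<lbrakk>u \<in> Hom C X Y; v \<in> Hom C Y Z; w \<in> Hom C Z (susp C X)\<rbrakk>
       \<Longrightarrow> tri C X Y Z u v w \<longleftrightarrow> tri C Y Z (susp C X) v w (- suspm C u)"
    and tri_morphism:
      "\<lbrakk>tri C X Y Z u v w; tri C X' Y' Z' u' v' w';
        a \<in> Hom C X X'; b \<in> Hom C Y Y'; b \<cdot> u = u' \<cdot> a\<rbrakk>
       \<Longrightarrow> \<exists>c \<in> Hom C Z Z'. c \<cdot> v = v' \<cdot> b \<and> suspm C a \<cdot> w = w' \<cdot> c"
    and tri_octahedral:
      "\<lbrakk>tri C X Y Z' u i i'; tri C Y Z X' v j j'; tri C X Z Y' (v \<cdot> u) k k'\<rbrakk>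
       \<Longrightarrow> \<exists>f g. tri C Z' Y' X' f g (suspm C i \<cdot> j') \<and>
             f \<cdot> i = k \<cdot> v \<and> k' \<cdot> f = i' \<and> g \<cdot> k = j \<and> j' \<cdot> g = suspm C u \<cdot> k'"


section \<open>2-Calabi-Yau categories with cluster-tilting object\<close>

text \<open>
  \<open>dualHom C X Y\<close> is the dual space of \<open>Hom C X Y\<close>; to have a unique representative, a
  functional is taken to be zero outside the Hom-space.
\<close>

definition dualHom :: "('o, 'm::ab_group_add, 'k::field) tricat \<Rightarrow> 'o \<Rightarrow> 'o \<Rightarrow> ('m \<Rightarrow> 'k) set" where
  "dualHom C X Y = {\<xi>.
     (\<forall>f\<in>Hom C X Y. \<forall>g\<in>Hom C X Y. \<xi> (f + g) = \<xi> f + \<xi> g) \<and>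
     (\<forall>c. \<forall>f\<in>Hom C X Y. \<xi> (scl C c f) = c * \<xi> f) \<and>
     (\<forall>f. f \<notin> Hom C X Y \<longrightarrow> \<xi> f = 0)}"

text \<open>
  \<open>\<Phi> X Y\<close> is an isomorphism from the dual of \<open>Hom C X Y\<close> to \<open>Hom C Y (\<Sigma> (\<Sigma> X))\<close>; the last two
  conditions are naturality in \<open>X\<close> and in \<open>Y\<close>.
\<close>

definition two_Calabi_Yau :: "('o, 'm::ab_group_add, 'k::field) tricat \<Rightarrow> bool" where
  "two_Calabi_Yau C \<longleftrightarrow> (\<exists>\<Phi> :: 'o \<Rightarrow> 'o \<Rightarrow> ('m \<Rightarrow> 'k) \<Rightarrow> 'm.
     (\<forall>X Y. bij_betw (\<Phi> X Y) (dualHom C X Y) (Hom C Y (susp C (susp C X)))) \<and>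
     (\<forall>X Y. \<forall>\<xi>\<in>dualHom C X Y. \<forall>\<eta>\<in>dualHom C X Y.
        \<Phi> X Y (\<lambda>f. \<xi> f + \<eta> f) = \<Phi> X Y \<xi> + \<Phi> X Y \<eta>) \<and>
     (\<forall>X Y c. \<forall>\<xi>\<in>dualHom C X Y. \<Phi> X Y (\<lambda>f. c * \<xi> f) = scl C c (\<Phi> X Y \<xi>)) \<and>
     (\<forall>X X' Y. \<forall>a\<in>Hom C X X'. \<forall>\<xi>\<in>dualHom C X Y.
        \<Phi> X' Y (\<lambda>f. if f \<in> Hom C X' Y then \<xi> (f \<cdot>\<^bsub>C\<^esub> a) else 0)
          = suspm C (suspm C a) \<cdot>\<^bsub>C\<^esub> \<Phi> X Y \<xi>) \<and>
     (\<forall>X Y Y'. \<forall>b\<in>Hom C Y' Y. \<forall>\<xi>\<in>dualHom C X Y.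
        \<Phi> X Y' (\<lambda>f. if f \<in> Hom C X Y' then \<xi> (b \<cdot>\<^bsub>C\<^esub> f) else 0) = \<Phi> X Y \<xi> \<cdot>\<^bsub>C\<^esub> b))"

definition Ext1 :: "('o, 'm, 'k) tricat \<Rightarrow> 'o \<Rightarrow> 'o \<Rightarrow> 'm set" where
  "Ext1 C X Y = Hom C X (susp C Y)"

definition add_closure :: "('o, 'm::ab_group_add, 'k) tricat \<Rightarrow> 'o \<Rightarrow> 'o set" where
  "add_closure C T = {X. \<exists>m P Y. is_dsum C {..<m} (\<lambda>_. T) P \<and> is_biproduct C X Y P}"

definition basic_object :: "('o, 'm::ab_group_add, 'k) tricat \<Rightarrow> 'o \<Rightarrow> bool" where
  "basic_object C T \<longleftrightarrow> (\<forall>m Y. is_dsum C {..<m} Y T \<and> (\<forall>i<m. indecomposable C (Y i)) \<longrightarrow>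
     (\<forall>i<m. \<forall>j<m. i \<noteq> j \<longrightarrow> \<not> isomorphic C (Y i) (Y j)))"

definition cluster_tilting :: "('o, 'm::ab_group_add, 'k) tricat \<Rightarrow> 'o \<Rightarrow> bool" where
  "cluster_tilting C T \<longleftrightarrow>
     Ext1 C T T = {0} \<and> basic_object C T \<and> (\<forall>X. Ext1 C T X = {0} \<longrightarrow> X \<in> add_closure C T)"

locale two_CY_category_with_cto = triangulated_category C
  for C :: "('o, 'm::ab_group_add, 'k::alg_closed_field) tricat" (structure) +
  assumes idempotents_split: "\<lbrakk>e \<in> Hom C X X; e \<cdot> e = e\<rbrakk> \<Longrightarrow>
      \<exists>Y. \<exists>r\<in>Hom C X Y. \<exists>s\<in>Hom C Y X. r \<cdot> s = idm C Y \<and> s \<cdot> r = e"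
    and Hom_finite_dim: "\<exists>B. finite B \<and> Hom C X Y = span B"
    and two_Calabi_Yau: "two_Calabi_Yau C"
    and cluster_tilting_exists: "\<exists>T. cluster_tilting C T"


section \<open>Tropical friezes\<close>

text \<open>A triangle is split iff its third morphism vanishes.\<close>

definition nonsplit_tri ::
  "('o, 'm::ab_group_add, 'k) tricat \<Rightarrow> 'o \<Rightarrow> 'o \<Rightarrow> 'o \<Rightarrow> bool" where
  "nonsplit_tri C L E M \<longleftrightarrow> (\<exists>u v w. tri C L E M u v w \<and> w \<noteq> 0)"

definition tropical_frieze ::
  "('o, 'm::ab_group_add, 'k::field) tricat \<Rightarrow> ('o \<Rightarrow> int) \<Rightarrow> bool" where
  "tropical_frieze C f \<longleftrightarrow>
     (\<forall>X Y. isomorphic C X Y \<longrightarrow> f X = f Y) \<and>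
     (\<forall>X Y P. is_biproduct C X Y P \<longrightarrow> f P = f X + f Y) \<and>
     (\<forall>L M E E'. hdim C (Ext1 C L M) = 1 \<and> nonsplit_tri C L E M \<and> nonsplit_tri C M E' L
        \<longrightarrow> f L + f M = max (f E) (f E'))"


section \<open>The quiver of the endomorphism algebra\<close>

definition rad :: "('o, 'm::ab_group_add, 'k) tricat \<Rightarrow> 'o \<Rightarrow> 'o \<Rightarrow> 'm set" where
  "rad C X Y = {f \<in> Hom C X Y. \<forall>g\<in>Hom C Y X. is_iso C X X (idm C X - g \<cdot>\<^bsub>C\<^esub> f)}"

text \<open>
  Since \<open>add T\<close> is a full subcategory, its radical is the restriction of the radical of the whole
  category; the square of the radical, however, only involves factorizations through \<open>add T\<close>.
\<close>

definition rad2_add ::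
  "('o, 'm::ab_group_add, 'k::field) tricat \<Rightarrow> 'o \<Rightarrow> 'o \<Rightarrow> 'o \<Rightarrow> 'm set" where
  "rad2_add C T X Y = module.span (scl C)
     {g \<cdot>\<^bsub>C\<^esub> f | Z f g. Z \<in> add_closure C T \<and> f \<in> rad C X Z \<and> g \<in> rad C Z Y}"

text \<open>
  The number of arrows \<open>i \<rightarrow> j\<close> is the dimension of the space \<open>rad / rad\<^sup>2\<close> of irreducible
  morphisms from \<open>T\<^sub>i\<close> to \<open>T\<^sub>j\<close> in \<open>add T\<close>.
\<close>

definition arrows ::
  "('o, 'm::ab_group_add, 'k::field) tricat \<Rightarrow> 'o \<Rightarrow> (nat \<Rightarrow> 'o) \<Rightarrow> nat \<Rightarrow> nat \<Rightarrow> nat" where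
  "arrows C T Ts i j = hdim C (rad C (Ts i) (Ts j)) - hdim C (rad2_add C T (Ts i) (Ts j))"

definition no_loops ::
  "('o, 'm::ab_group_add, 'k::field) tricat \<Rightarrow> nat \<Rightarrow> 'o \<Rightarrow> (nat \<Rightarrow> 'o) \<Rightarrow> bool" where
  "no_loops C n T Ts \<longleftrightarrow> (\<forall>i\<in>{1..n}. arrows C T Ts i i = 0)"

definition no_2cycles ::
  "('o, 'm::ab_group_add, 'k::field) tricat \<Rightarrow> nat \<Rightarrow> 'o \<Rightarrow> (nat \<Rightarrow> 'o) \<Rightarrow> bool" where
  "no_2cycles C n T Ts \<longleftrightarrow> (\<forall>i\<in>{1..n}. \<forall>j\<in>{1..n}. i \<noteq> j \<longrightarrow>
     \<not> (arrows C T Ts i j > 0 \<and> arrows C T Ts j i > 0))"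

definition bmat ::
  "('o, 'm::ab_group_add, 'k::field) tricat \<Rightarrow> 'o \<Rightarrow> (nat \<Rightarrow> 'o) \<Rightarrow> nat \<Rightarrow> nat \<Rightarrow> int" where
  "bmat C T Ts i j = int (arrows C T Ts i j) - int (arrows C T Ts j i)"

definition pos_part :: "int \<Rightarrow> int" (\<open>[_]\<^sub>+\<close>) where
  "[b]\<^sub>+ = max b 0"


section \<open>The split Grothendieck group and the vectors \<open>g(T)\<close>\<close>

text \<open>
  \<open>K0 C T\<close> is the split Grothendieck group of \<open>add T\<close>: the free abelian group on the objects of
  \<open>add T\<close>, modulo \<open>[X] = [Y]\<close> for \<open>X\<close>, \<open>Y\<close> isomorphic and \<open>[P] = [X] + [Y]\<close> for \<open>P\<close> a direct sum
  of \<open>X\<close> and \<open>Y\<close>. It is a group record of HOL-Algebra, hence written multiplicatively.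
\<close>

definition K0_relations :: "('o, 'm::ab_group_add, 'k) tricat \<Rightarrow> 'o \<Rightarrow> ('o \<Rightarrow>\<^sub>0 int) set" where
  "K0_relations C T = generate (free_Abelian_group (add_closure C T))
     ({frag_of X - frag_of Y | X Y.
         X \<in> add_closure C T \<and> Y \<in> add_closure C T \<and> isomorphic C X Y} \<union>
      {frag_of P - frag_of X - frag_of Y | X Y P.
         X \<in> add_closure C T \<and> Y \<in> add_closure C T \<and> P \<in> add_closure C T \<and>
         is_biproduct C X Y P})"

definition K0 :: "('o, 'm::ab_group_add, 'k) tricat \<Rightarrow> 'o \<Rightarrow> ('o \<Rightarrow>\<^sub>0 int) set monoid" where
  "K0 C T = free_Abelian_group (add_closure C T) Mod K0_relations C T"

definition K0_class ::
  "('o, 'm::ab_group_add, 'k) tricat \<Rightarrow> 'o \<Rightarrow> 'o \<Rightarrow> ('o \<Rightarrow>\<^sub>0 int) set" where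
  "K0_class C T X = K0_relations C T #>\<^bsub>free_Abelian_group (add_closure C T)\<^esub> frag_of X"

text \<open>\<open>K0_comb C T Ts I a\<close> is the linear combination \<open>\<Sum>\<^sub>i a\<^sub>i [T\<^sub>i]\<close> over \<open>i \<in> I\<close>.\<close>

definition K0_comb ::
  "('o, 'm::ab_group_add, 'k) tricat \<Rightarrow> 'o \<Rightarrow> (nat \<Rightarrow> 'o) \<Rightarrow> nat set \<Rightarrow> (nat \<Rightarrow> int)
     \<Rightarrow> ('o \<Rightarrow>\<^sub>0 int) set" where
  "K0_comb C T Ts I a =
     finprod (K0 C T) (\<lambda>i. K0_class C T (Ts i) [^]\<^bsub>K0 C T\<^esub> a i) I"

definition gcoeff ::
  "('o, 'm::ab_group_add, 'k::field) tricat \<Rightarrow> ('o \<Rightarrow> int) \<Rightarrow> nat \<Rightarrow> 'o \<Rightarrow> (nat \<Rightarrow> 'o) \<Rightarrow> nat \<Rightarrow> int"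
  where
  "gcoeff C f n T Ts i =
     (\<Sum>r=1..n. [bmat C T Ts r i]\<^sub>+ * f (Ts r)) - (\<Sum>s=1..n. [bmat C T Ts i s]\<^sub>+ * f (Ts s))"

definition gvec ::
  "('o, 'm::ab_group_add, 'k::field) tricat \<Rightarrow> ('o \<Rightarrow> int) \<Rightarrow> nat \<Rightarrow> 'o \<Rightarrow> (nat \<Rightarrow> 'o)
     \<Rightarrow> ('o \<Rightarrow>\<^sub>0 int) set" where
  "gvec C f n T Ts = K0_comb C T Ts {1..n} (gcoeff C f n T Ts)"

text \<open>
  The linear map \<open>K\<^sub>0(add T) \<rightarrow> K\<^sub>0(add T')\<close> with prescribed values \<open>v i\<close> on the basis elements
  \<open>[T\<^sub>i]\<close>, \<open>1 \<le> i \<le> n\<close>.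
\<close>

definition K0_linear_map ::
  "('o, 'm::ab_group_add, 'k) tricat \<Rightarrow> nat \<Rightarrow> 'o \<Rightarrow> (nat \<Rightarrow> 'o) \<Rightarrow> 'o \<Rightarrow> (nat \<Rightarrow> ('o \<Rightarrow>\<^sub>0 int) set)
     \<Rightarrow> ('o \<Rightarrow>\<^sub>0 int) set \<Rightarrow> ('o \<Rightarrow>\<^sub>0 int) set" where
  "K0_linear_map C n T Ts T' v = (THE \<phi>.
     \<phi> \<in> hom (K0 C T) (K0 C T') \<and> \<phi> \<in> extensional (carrier (K0 C T)) \<and>
     (\<forall>i\<in>{1..n}. \<phi> (K0_class C T (Ts i)) = v i))"

text \<open>
  In both definitions the summand for the index \<open>k\<close> is left out of the sum because \<open>b\<^sub>k\<^sub>k = 0\<close>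
  (and \<open>T\<^sub>k\<close> need not be in \<open>add T'\<close>).
\<close>

definition phi_plus ::
  "('o, 'm::ab_group_add, 'k::field) tricat \<Rightarrow> nat \<Rightarrow> nat \<Rightarrow> 'o \<Rightarrow> (nat \<Rightarrow> 'o) \<Rightarrow> 'o \<Rightarrow> 'o
     \<Rightarrow> ('o \<Rightarrow>\<^sub>0 int) set \<Rightarrow> ('o \<Rightarrow>\<^sub>0 int) set" where
  "phi_plus C n k T Ts T' Tk' = K0_linear_map C n T Ts T' (\<lambda>i.
     if i = k
     then inv\<^bsub>K0 C T'\<^esub> (K0_class C T' Tk') \<otimes>\<^bsub>K0 C T'\<^esub>
            K0_comb C T' Ts ({1..n} - {k}) (\<lambda>r. [bmat C T Ts r k]\<^sub>+)
     else K0_class C T' (Ts i))"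

definition phi_minus ::
  "('o, 'm::ab_group_add, 'k::field) tricat \<Rightarrow> nat \<Rightarrow> nat \<Rightarrow> 'o \<Rightarrow> (nat \<Rightarrow> 'o) \<Rightarrow> 'o \<Rightarrow> 'o
     \<Rightarrow> ('o \<Rightarrow>\<^sub>0 int) set \<Rightarrow> ('o \<Rightarrow>\<^sub>0 int) set" where
  "phi_minus C n k T Ts T' Tk' = K0_linear_map C n T Ts T' (\<lambda>i.
     if i = k
     then inv\<^bsub>K0 C T'\<^esub> (K0_class C T' Tk') \<otimes>\<^bsub>K0 C T'\<^esub>
            K0_comb C T' Ts ({1..n} - {k}) (\<lambda>s. [bmat C T Ts k s]\<^sub>+)
     else K0_class C T' (Ts i))"

end

theory Submission
  imports Defs
begin

text \<open>
  For a tropical frieze \<open>f\<close> and a cluster-tilting object \<open>T\<close> without loops and 2-cycles, the two exchange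
  triangles of \<open>T\<close> at \<open>i\<close> have middle terms \<open>E\<close>, \<open>E'\<close> in which \<open>T\<^sub>r\<close> occurs as often as there are arrows
  \<open>r \<rightarrow> i\<close> and \<open>i \<rightarrow> r\<close>; thus \<open>g\<^sub>i(T) = f E - f E'\<close>, and \<open>f(T\<^sub>k) + f(T\<^sub>k') = max (f E) (f E')\<close> for \<open>i = k\<close>.
  Together with the Fomin-Zelevinsky rule for the exchange matrix of \<open>T'\<close> this gives the claim coefficient
  by coefficient.

  The matrix rule is obtained without minimal approximations. If \<open>X \<rightarrow> E \<rightarrow> T\<^sub>j\<close> and \<open>T\<^sub>j \<rightarrow> E' \<rightarrow> X\<close> are
  triangles with \<open>E\<close>, \<open>E'\<close> in the additive closure of the other summands and \<open>Ext\<^sup>1(T\<^sub>i, X) = 0\<close> for \<open>i \<noteq> j\<close>,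
  then the multiplicities of \<open>T\<^sub>r\<close> in \<open>E\<close> and \<open>E'\<close> exceed the numbers of arrows by the same amount, the
  multiplicity of \<open>T\<^sub>r\<close> in \<open>X\<close>. Hence \<open>b\<^sub>r\<^sub>j\<close> is the difference of the two multiplicities for any such pair of
  triangles, and when there is no arrow \<open>k \<rightarrow> j\<close> such a pair for \<open>T'\<close> is produced from one for \<open>T\<close> by the
  octahedral axiom. The case of arrows \<open>k \<rightarrow> j\<close> follows by exchanging the roles of \<open>T\<close> and \<open>T'\<close>.
\<close>

section \<open>Linear algebra\<close>

text \<open>The octahedral axiom does not preserve minimality: in the mutated triangles the two
  middle terms may share summands, which correspond to the 2-cycles cancelled in quiver mutation.
  Hence only a difference that is blind to common summands is tracked. Multiplicities are dimensions
  of Hom modulo radical; they are additive on direct sums, and over an algebraically closed field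
  they count summands, so unique decomposition is never invoked. If there is no arrow
  \<open>k \<rightarrow> j\<close>, the approximation of \<open>Ts j\<close> can avoid
  \<open>Ts k\<close>, and its middle term is common to \<open>T\<close> and \<open>T'\<close>. At
  \<open>k\<close> itself the same two triangles serve \<open>T\<close> and \<open>T'\<close> in
  opposite order, so all arrows at \<open>k\<close> are reversed and exchanging \<open>T\<close> and
  \<open>T'\<close> exchanges the two cases; without 2-cycles every \<open>j\<close> falls into one
  of them. The frieze relation then decides which correction survives: with \<open>e\<close> and
  \<open>e'\<close> the values of \<open>f\<close> at the middle terms, subtracting
  \<open>e'\<close> or \<open>e\<close> from \<open>max e e'\<close> leaves zero or the absolute
  value of the \<open>k\<close>-th coefficient.\<close>

context vector_space
begin

text \<open>The ambient space may have infinite dimension, so finiteness always enters through a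
  finite spanning set \<open>S\<close>.\<close>

lemma finite_span_basis_exists:
  assumes "B \<subseteq> V" "independent B" "V \<subseteq> span S" "finite S"
  obtains B' where "B \<subseteq> B'" "B' \<subseteq> V" "independent B'" "V \<subseteq> span B'" "finite B'" "card B' = dim V"
proof -
  obtain B' where B': "B \<subseteq> B'" "B' \<subseteq> V" "independent B'" "V \<subseteq> span B'"
    using maximal_independent_subset_extend[OF assms(1,2)] by metis
  have "finite B'"
    using independent_span_bound[OF assms(4) B'(3)] B'(2) assms(3) by blast
  moreover have "card B' = dim V" using basis_card_eq_dim B' by blast
  ultimately show ?thesis using that B' by blast
qed

lemma fin_dim_mono:
  assumes "A \<subseteq> V" "V \<subseteq> span S" "finite S"
  shows "dim A \<le> dim V"
proof -
  obtain B where B: "B \<subseteq> A" "independent B" "A \<subseteq> span B" "card B = dim A"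
    using finite_span_basis_exists[of "{}" A S] assms independent_empty by (metis empty_subsetI order_trans)
  obtain B' where B': "B \<subseteq> B'" "finite B'" "card B' = dim V"
    using finite_span_basis_exists[of B V S] B assms by (metis order_trans)
  show ?thesis using B B' card_mono by metis
qed

lemma fin_dim_eq_imp_eq:
  assumes "A \<subseteq> V" "subspace A" "V \<subseteq> span S" "finite S" "dim V \<le> dim A"
  shows "A = V"
proof -
  obtain B where B: "B \<subseteq> A" "independent B" "A \<subseteq> span B" "card B = dim A"
    using finite_span_basis_exists[of "{}" A S] assms independent_empty by (metis empty_subsetI order_trans)
  obtain B' where B': "B \<subseteq> B'" "finite B'" "card B' = dim V" "V \<subseteq> span B'"
    using finite_span_basis_exists[of B V S] B assms by (metis order_trans)
  have "B = B'" using B B' assms(5) card_seteq by metis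
  then show ?thesis using B B' assms span_minimal by blast
qed

text \<open>\<open>\<phi>\<close> induces an isomorphism of \<open>V\<close> modulo
  \<open>{v \<in> V. \<phi> v \<in> W'}\<close> with \<open>W\<close> modulo \<open>W'\<close>; the
  additive form avoids subtraction of naturals. Linearity is demanded on \<open>V\<close> only,
  because composition is unconstrained outside the Hom-spaces.\<close>

lemma dim_quotient_iso:
  assumes subV: "subspace V" and finV: "V \<subseteq> span S" "finite S"
    and subW: "subspace W" and finW: "W \<subseteq> span R" "finite R"
    and subW': "subspace W'" "W' \<subseteq> W"
    and add: "\<And>x y. x \<in> V \<Longrightarrow> y \<in> V \<Longrightarrow> \<phi> (x + y) = \<phi> x + \<phi> y"
    and scl: "\<And>c x. x \<in> V \<Longrightarrow> \<phi> (scale c x) = scale c (\<phi> x)"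
    and im: "\<And>x. x \<in> V \<Longrightarrow> \<phi> x \<in> W"
    and surj: "\<And>w. w \<in> W \<Longrightarrow> \<exists>v\<in>V. w - \<phi> v \<in> W'"
  shows "dim V + dim W' = dim {v \<in> V. \<phi> v \<in> W'} + dim W"
proof -
  let ?A = "{v \<in> V. \<phi> v \<in> W'}"
  have phi0: "\<phi> 0 = 0" using scl[of 0 0] subspace_0[OF subV] by simp
  have subA: "subspace ?A"
    using subspace_0[OF subV] subspace_0[OF subW'(1)] subspace_add[OF subV] subspace_add[OF subW'(1)]
      subspace_scale[OF subV] subspace_scale[OF subW'(1)]
    by (intro subspaceI) (simp_all add: phi0 add scl)
  have "?A \<subseteq> span S" using finV by blast
  then obtain B where "{} \<subseteq> B" and B: "B \<subseteq> ?A" "independent B" "?A \<subseteq> span B" "finite B" "card B = dim ?A"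
    by (rule finite_span_basis_exists[OF empty_subsetI independent_empty _ finV(2)])
  have BV: "B \<subseteq> V" using B(1) by blast
  obtain BB where BB: "B \<subseteq> BB" "BB \<subseteq> V" "independent BB" "V \<subseteq> span BB" "finite BB" "card BB = dim V"
    by (rule finite_span_basis_exists[OF BV B(2) finV])
  have "W' \<subseteq> span R" using subW' finW by blast
  then obtain B' where "{} \<subseteq> B'" and B': "B' \<subseteq> W'" "independent B'" "W' \<subseteq> span B'" "finite B'" "card B' = dim W'"
    by (rule finite_span_basis_exists[OF empty_subsetI independent_empty _ finW(2)])
  have image_span: "\<exists>x\<in>span C0. w = \<phi> x" if "w \<in> span (\<phi> ` C0)" "C0 \<subseteq> V" for w C0
  proof -
    have C0V: "span C0 \<subseteq> V" using that subV span_minimal by blast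
    have "subspace (\<phi> ` span C0)"
    proof (rule subspaceI)
      show "0 \<in> \<phi> ` span C0" using phi0 span_zero by (metis image_eqI)
    next
      fix x y assume "x \<in> \<phi> ` span C0" "y \<in> \<phi> ` span C0"
      then show "x + y \<in> \<phi> ` span C0" using add C0V span_add
        by clarify (metis image_eqI subsetD)
    next
      fix c x assume "x \<in> \<phi> ` span C0"
      then show "scale c x \<in> \<phi> ` span C0" using scl C0V span_scale
        by clarify (metis image_eqI subsetD)
    qed
    moreover have "\<phi> ` C0 \<subseteq> \<phi> ` span C0" using span_superset by blast
    ultimately show ?thesis using that span_minimal by blast
  qed
  \<comment> \<open>Independence is proved while adding one vector at a time: a relation for
    \<open>\<phi> c\<close> would put \<open>c\<close>, up to an element of \<open>span C0\<close>,
    into \<open>span B\<close>.\<close>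
  have key: "independent (\<phi> ` C0 \<union> B') \<and> card (\<phi> ` C0 \<union> B') = card C0 + card B'"
    if "finite C0" "C0 \<subseteq> BB - B" for C0
    using that
  proof (induction C0)
    case empty
    then show ?case using B' by simp
  next
    case (insert c C0)
    have nin: "\<phi> c \<notin> span (\<phi> ` C0 \<union> B')"
    proof
      assume "\<phi> c \<in> span (\<phi> ` C0 \<union> B')"
      then obtain x y where xy: "\<phi> c = x + y" "x \<in> span (\<phi> ` C0)" "y \<in> span B'"
        by (auto simp: span_Un)
      have C0V: "C0 \<subseteq> V" using insert BB by blast
      obtain z where z: "z \<in> span C0" "x = \<phi> z" using image_span[OF xy(2) C0V] by blast
      have zV: "z \<in> V" using z C0V subV span_minimal by blast
      have cV: "c \<in> V" using insert BB by blast
      have "\<phi> (c + scale (-1) z) = \<phi> c - \<phi> z"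
        using add[OF cV subspace_scale[OF subV zV, of "-1"]] scl[OF zV, of "-1"] by simp
      then have "\<phi> (c - z) \<in> W'"
        using xy z span_minimal[OF B'(1) subW'(1)] by auto
      then have "c - z \<in> ?A" using cV zV subspace_diff[OF subV] by blast
      then have "c - z \<in> span B" using B by blast
      then have "c - z + z \<in> span (B \<union> C0)"
        using z span_mono[of B "B \<union> C0"] span_mono[of C0 "B \<union> C0"] span_add by blast
      then have "c \<in> span (B \<union> C0)" by simp
      moreover have "B \<union> C0 \<subseteq> BB - {c}" using insert BB by blast
      ultimately have "c \<in> span (BB - {c})" using span_mono by blast
      then show False using BB(3) insert.prems dependent_def by blast
    qed
    then have nin': "\<phi> c \<notin> \<phi> ` C0 \<union> B'" using span_base by meson
    have IH: "independent (\<phi> ` C0 \<union> B')" "card (\<phi> ` C0 \<union> B') = card C0 + card B'"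
      using insert by auto
    have eq: "\<phi> ` insert c C0 \<union> B' = insert (\<phi> c) (\<phi> ` C0 \<union> B')" by simp
    have fin: "finite (\<phi> ` C0 \<union> B')" using insert.hyps B'(4) by simp
    show ?case unfolding eq
      using independent_insertI[OF nin IH(1)] card_insert_disjoint[OF fin nin'] IH(2) insert.hyps by simp
  qed
  have fin: "finite (BB - B)" using BB by simp
  have card1: "card (BB - B) + card B = card BB" using BB B
    by (metis card_Diff_subset card_mono le_add_diff_inverse2)
  let ?D = "\<phi> ` (BB - B) \<union> B'"
  have D: "independent ?D" "card ?D = card (BB - B) + card B'" using key[OF fin] by auto
  have DW: "?D \<subseteq> W" using im BB B' subW' by blast
  have "W \<subseteq> span ?D"
  proof
    fix w assume "w \<in> W"
    then obtain v where v: "v \<in> V" "w - \<phi> v \<in> W'" using surj by blast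
    have "BB = (BB - B) \<union> B" using BB by blast
    then have "v \<in> span ((BB - B) \<union> B)" using BB v by auto
    then obtain x y where xy: "v = x + y" "x \<in> span (BB - B)" "y \<in> span B" unfolding span_Un by blast
    have yA: "y \<in> ?A" using span_minimal[OF B(1) subA] xy by blast
    have xV: "x \<in> V" using span_minimal[OF _ subV, of "BB - B"] BB xy by blast
    have "\<phi> x \<in> span (\<phi> ` (BB - B))"
    proof -
      let ?P = "{x \<in> V. \<phi> x \<in> span (\<phi> ` (BB - B))}"
      have "subspace ?P"
        using subspace_0[OF subV] subspace_add[OF subV] subspace_scale[OF subV]
        by (intro subspaceI) (simp_all add: phi0 add scl span_zero span_add span_scale)
      moreover have "BB - B \<subseteq> ?P"
      proof
        fix b assume b: "b \<in> BB - B"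
        then have "b \<in> V" using BB(2) by blast
        then show "b \<in> ?P" using span_base[of "\<phi> b" "\<phi> ` (BB - B)"] b by simp
      qed
      ultimately have "span (BB - B) \<subseteq> ?P" by (rule span_minimal[rotated])
      then show ?thesis using xy(2) by blast
    qed
    moreover have "w - \<phi> x \<in> W'"
    proof -
      have eq: "w - \<phi> x = (w - \<phi> v) + \<phi> y" using add[of x y] xy xV yA by simp
      have "(w - \<phi> v) + \<phi> y \<in> W'" using v(2) yA by (intro subspace_add[OF subW'(1)]) auto
      then show ?thesis by (simp only: eq)
    qed
    then have "w - \<phi> x \<in> span B'" using B' by blast
    ultimately have "\<phi> x + (w - \<phi> x) \<in> span ?D"
      using span_mono[of "\<phi> ` (BB - B)" ?D] span_mono[of B' ?D] by (intro span_add) auto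
    then show "w \<in> span ?D" by simp
  qed
  then have "card ?D = dim W" using basis_card_eq_dim[OF DW _ D(1)] by simp
  then show ?thesis using D(2) card1 BB B B' by linarith
qed

text \<open>Meant for the radical inside the endomorphisms of an indecomposable object, with
  \<open>x\<close> the identity.\<close>

lemma dim_insert_hyperplane:
  assumes "subspace V" "V \<subseteq> span S" "finite S" "subspace A" "A \<subseteq> V" "x \<in> V" "x \<notin> A"
    and "\<And>v. v \<in> V \<Longrightarrow> \<exists>c. v - scale c x \<in> A"
  shows "dim V = dim A + 1"
proof -
  have "A \<subseteq> span S" using assms by blast
  then obtain B where "{} \<subseteq> B" and B: "B \<subseteq> A" "independent B" "A \<subseteq> span B" "finite B" "card B = dim A"
    by (rule finite_span_basis_exists[OF empty_subsetI independent_empty _ assms(3)])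
  have sp: "span B = A" using B(3) span_minimal[OF B(1) assms(4)] by (rule subset_antisym[rotated])
  have ind: "independent (insert x B)" using sp assms(7) by (intro independent_insertI B(2)) simp
  have "V \<subseteq> span (insert x B)"
  proof
    fix v assume "v \<in> V"
    then obtain c where "v - scale c x \<in> A" using assms(8) by meson
    then have "v - scale c x \<in> span B" using sp by simp
    then show "v \<in> span (insert x B)" using span_breakdown_eq by metis
  qed
  moreover have "insert x B \<subseteq> V" using assms(5,6) B(1) by simp
  ultimately have "card (insert x B) = dim V" using basis_card_eq_dim ind by metis
  moreover have "x \<notin> B" using B assms by blast
  ultimately show ?thesis using B by simp
qed

end


section \<open>Linear categories and their radical\<close>

text \<open>Only the linear structure is reversed; suspension and triangles stay as they are.
  Duality is therefore applied to radicals, direct sums, multiplicities and arrows, never to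
  triangles.\<close>

definition opcat :: "('o, 'm, 'k) tricat \<Rightarrow> ('o, 'm, 'k) tricat" where
  "opcat C = C\<lparr>Hom := (\<lambda>X Y. Hom C Y X), cmp := (\<lambda>g f. cmp C f g)\<rparr>"

lemma opcat_simps [simp]:
  "Hom (opcat C) X Y = Hom C Y X" "cmp (opcat C) g f = cmp C f g"
  "idm (opcat C) = idm C" "scl (opcat C) = scl C"
  "hdim (opcat C) = hdim C"
  by (auto simp: opcat_def hdim_def fun_eq_iff)

lemma opcat_opcat [simp]: "opcat (opcat C) = C"
  by (simp add: opcat_def)

context linear_category
begin

lemma hdim_dim: "hdim C = dim"
  by (simp add: hdim_def fun_eq_iff)

lemma zero_in_Hom [simp, intro]: "0 \<in> Hom C X Y"
  using Hom_subspace subspace_0 by blast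

lemma Hom_add [intro]: "\<lbrakk>f \<in> Hom C X Y; g \<in> Hom C X Y\<rbrakk> \<Longrightarrow> f + g \<in> Hom C X Y"
  using Hom_subspace subspace_add by blast

lemma Hom_diff [intro]: "\<lbrakk>f \<in> Hom C X Y; g \<in> Hom C X Y\<rbrakk> \<Longrightarrow> f - g \<in> Hom C X Y"
  using Hom_subspace subspace_diff by blast

lemma Hom_neg [intro]: "f \<in> Hom C X Y \<Longrightarrow> - f \<in> Hom C X Y"
  using Hom_subspace subspace_neg by blast

lemma Hom_scl [intro]: "f \<in> Hom C X Y \<Longrightarrow> scl C c f \<in> Hom C X Y"
  using Hom_subspace subspace_scale by blast

lemma Hom_sum [intro]: "(\<And>i. i \<in> I \<Longrightarrow> f i \<in> Hom C X Y) \<Longrightarrow> sum f I \<in> Hom C X Y"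
  using Hom_subspace subspace_sum by blast

declare idm_in_Hom [simp, intro]

lemma cmp_zero_right [simp]: "g \<in> Hom C Y Z \<Longrightarrow> g \<cdot> 0 = 0"
  using cmp_add_right[of 0 _ Y 0 g Z] by simp

lemma cmp_zero_left [simp]: "f \<in> Hom C X Y \<Longrightarrow> 0 \<cdot> f = 0"
  using cmp_add_left[of f X Y 0 _ 0] by simp

lemma cmp_neg_right: "\<lbrakk>f \<in> Hom C X Y; g \<in> Hom C Y Z\<rbrakk> \<Longrightarrow> g \<cdot> (- f) = - (g \<cdot> f)"
  using cmp_add_right[of f X Y "- f" g Z] by (simp add: Hom_neg add_eq_0_iff)

lemma cmp_neg_left: "\<lbrakk>f \<in> Hom C X Y; g \<in> Hom C Y Z\<rbrakk> \<Longrightarrow> (- g) \<cdot> f = - (g \<cdot> f)"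
  using cmp_add_left[of f X Y g Z "- g"] by (simp add: Hom_neg add_eq_0_iff)

lemma cmp_diff_right:
  "\<lbrakk>f \<in> Hom C X Y; f' \<in> Hom C X Y; g \<in> Hom C Y Z\<rbrakk> \<Longrightarrow> g \<cdot> (f - f') = g \<cdot> f - g \<cdot> f'"
  using cmp_add_right[of f X Y "- f'" g Z] cmp_neg_right[of f' X Y g Z] Hom_neg by simp

lemma cmp_diff_left:
  "\<lbrakk>f \<in> Hom C X Y; g \<in> Hom C Y Z; g' \<in> Hom C Y Z\<rbrakk> \<Longrightarrow> (g - g') \<cdot> f = g \<cdot> f - g' \<cdot> f"
  using cmp_add_left[of f X Y g Z "- g'"] cmp_neg_left[of f X Y g' Z] Hom_neg by simp

lemma cmp_sum_right:
  assumes "\<And>i. i \<in> I \<Longrightarrow> f i \<in> Hom C X Y" "g \<in> Hom C Y Z"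
  shows "g \<cdot> sum f I = (\<Sum>i\<in>I. g \<cdot> f i)"
  using assms(1)
proof (induction I rule: infinite_finite_induct)
  case (insert i I)
  then have "g \<cdot> (f i + sum f I) = g \<cdot> f i + g \<cdot> sum f I"
    using assms(2) by (intro cmp_add_right[of _ X Y]) (auto intro: Hom_sum)
  then show ?case using insert by simp
qed (use assms(2) in auto)

lemma cmp_sum_left:
  assumes "\<And>i. i \<in> I \<Longrightarrow> g i \<in> Hom C Y Z" "f \<in> Hom C X Y"
  shows "sum g I \<cdot> f = (\<Sum>i\<in>I. g i \<cdot> f)"
  using assms(1)
proof (induction I rule: infinite_finite_induct)
  case (insert i I)
  then have "(g i + sum g I) \<cdot> f = g i \<cdot> f + sum g I \<cdot> f"
    using assms(2) by (intro cmp_add_left[of _ X Y]) (auto intro: Hom_sum)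
  then show ?case using insert by simp
qed (use assms(2) in auto)

lemma op_linear_category: "linear_category (opcat C)"
proof -
  have "vector_space (scl (opcat C))" by (simp add: vector_space_axioms)
  then show ?thesis
    by (intro linear_category.intro linear_category_axioms.intro)
      (simp_all add: Hom_subspace idm_in_Hom cmp_in_Hom cmp_assoc cmp_idm_left
        cmp_idm_right cmp_add_right cmp_add_left cmp_scl_right cmp_scl_left)
qed

lemma is_isoI: "\<lbrakk>a \<in> Hom C X Y; b \<in> Hom C Y X; b \<cdot> a = idm C X; a \<cdot> b = idm C Y\<rbrakk> \<Longrightarrow> is_iso C X Y a"
  unfolding is_iso_def is_inverse_def by blast

lemma is_isoE:
  assumes "is_iso C X Y a"
  obtains b where "a \<in> Hom C X Y" "b \<in> Hom C Y X" "b \<cdot> a = idm C X" "a \<cdot> b = idm C Y"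
  using assms unfolding is_iso_def is_inverse_def by blast

lemma is_iso_op: "is_iso (opcat C) X Y a = is_iso C Y X a"
  unfolding is_iso_def is_inverse_def by auto

lemma is_iso_idm: "is_iso C X X (idm C X)"
  by (rule is_isoI) (auto simp: cmp_idm_left[OF idm_in_Hom])

lemma cmp_assoc4:
  assumes f: "f \<in> Hom C X Y" and g: "g \<in> Hom C Y Z" and h: "h \<in> Hom C Z W" and k: "k \<in> Hom C W V"
  shows "(k \<cdot> h) \<cdot> (g \<cdot> f) = k \<cdot> ((h \<cdot> g) \<cdot> f)"
proof -
  have "(k \<cdot> h) \<cdot> (g \<cdot> f) = k \<cdot> (h \<cdot> (g \<cdot> f))"
    by (rule cmp_assoc[OF cmp_in_Hom[OF f g] h k, symmetric])
  then show ?thesis by (simp only: cmp_assoc[OF f g h])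
qed

lemma is_iso_cmp:
  assumes "is_iso C X Y a" "is_iso C Y Z b"
  shows "is_iso C X Z (b \<cdot> a)"
proof -
  obtain a' where a: "a \<in> Hom C X Y" "a' \<in> Hom C Y X" "a' \<cdot> a = idm C X" "a \<cdot> a' = idm C Y"
    using assms(1) is_isoE by blast
  obtain b' where b: "b \<in> Hom C Y Z" "b' \<in> Hom C Z Y" "b' \<cdot> b = idm C Y" "b \<cdot> b' = idm C Z"
    using assms(2) is_isoE by blast
  have "(a' \<cdot> b') \<cdot> (b \<cdot> a) = idm C X"
    using cmp_assoc4[OF a(1) b(1) b(2) a(2)] a b cmp_idm_left[OF a(1)] by simp
  moreover have "(b \<cdot> a) \<cdot> (a' \<cdot> b') = idm C Z"
    using cmp_assoc4[OF b(2) a(2) a(1) b(1)] a b cmp_idm_left[OF b(2)] by simp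
  ultimately show ?thesis
    by (rule is_isoI[OF cmp_in_Hom[OF a(1) b(1)] cmp_in_Hom[OF b(2) a(2)]])
qed

lemma isomorphic_sym: "isomorphic C X Y \<Longrightarrow> isomorphic C Y X"
  unfolding isomorphic_def is_iso_def is_inverse_def by blast

lemma isomorphic_refl: "isomorphic C X X"
  using is_iso_idm unfolding isomorphic_def by blast

lemma zero_objectI: "idm C X = 0 \<Longrightarrow> zero_object C X"
proof -
  assume 0: "idm C X = 0"
  have "f = 0" if "f \<in> Hom C Y X" for Y f
    using cmp_idm_left[OF that] cmp_zero_left[OF that] 0 by simp
  moreover have "f = 0" if "f \<in> Hom C X Y" for Y f
    using cmp_idm_right[OF that] cmp_zero_right[OF that] 0 by simp
  ultimately show ?thesis unfolding zero_object_def by auto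
qed

lemma zero_object_idm: "zero_object C X \<Longrightarrow> idm C X = 0"
  unfolding zero_object_def using idm_in_Hom by blast

text \<open>Jacobson's lemma: \<open>1 - f g\<close> has the inverse \<open>1 + f a g\<close> if \<open>a\<close> is inverse to \<open>1 - g f\<close>.\<close>

lemma is_iso_one_minus_swap:
  assumes f: "f \<in> Hom C X Y" and g: "g \<in> Hom C Y X"
    and iso: "is_iso C X X (idm C X - g \<cdot> f)"
  shows "is_iso C Y Y (idm C Y - f \<cdot> g)"
proof -
  obtain a where a: "a \<in> Hom C X X" "a \<cdot> (idm C X - g \<cdot> f) = idm C X" "(idm C X - g \<cdot> f) \<cdot> a = idm C X"
    using iso is_isoE by metis
  have gf: "g \<cdot> f \<in> Hom C X X" and fg: "f \<cdot> g \<in> Hom C Y Y" using f g cmp_in_Hom by auto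
  have ag: "a \<cdot> g \<in> Hom C Y X" using a g cmp_in_Hom by auto
  have fag: "f \<cdot> (a \<cdot> g) \<in> Hom C Y Y" using f ag cmp_in_Hom by auto
  have a1: "a - a \<cdot> (g \<cdot> f) = idm C X"
    using a(2) cmp_diff_right[OF idm_in_Hom gf a(1)] cmp_idm_right[OF a(1)] by simp
  have a2: "a - (g \<cdot> f) \<cdot> a = idm C X"
    using a(3) cmp_diff_left[OF a(1) idm_in_Hom gf] cmp_idm_left[OF a(1)] by simp
  have e1: "(f \<cdot> (a \<cdot> g)) \<cdot> (f \<cdot> g) = f \<cdot> ((a \<cdot> (g \<cdot> f)) \<cdot> g)"
    unfolding cmp_assoc[OF f g a(1)] by (rule cmp_assoc4[OF g f ag f])
  have e2: "(f \<cdot> g) \<cdot> (f \<cdot> (a \<cdot> g)) = f \<cdot> (((g \<cdot> f) \<cdot> a) \<cdot> g)"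
    unfolding cmp_assoc[OF g a(1) gf, symmetric] by (rule cmp_assoc4[OF ag f g f])
  have "a \<cdot> (g \<cdot> f) = a - idm C X" unfolding a1[symmetric] by simp
  then have "(a \<cdot> (g \<cdot> f)) \<cdot> g = (a - idm C X) \<cdot> g" by (simp only:)
  also have "\<dots> = a \<cdot> g - g" using cmp_diff_left[OF g a(1) idm_in_Hom] cmp_idm_left[OF g] by simp
  finally have e1': "(f \<cdot> (a \<cdot> g)) \<cdot> (f \<cdot> g) = f \<cdot> (a \<cdot> g) - f \<cdot> g"
    using e1 cmp_diff_right[OF ag g f] by simp
  have "(g \<cdot> f) \<cdot> a = a - idm C X" unfolding a2[symmetric] by simp
  then have "((g \<cdot> f) \<cdot> a) \<cdot> g = (a - idm C X) \<cdot> g" by (simp only:)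
  also have "\<dots> = a \<cdot> g - g" using cmp_diff_left[OF g a(1) idm_in_Hom] cmp_idm_left[OF g] by simp
  finally have e2': "(f \<cdot> g) \<cdot> (f \<cdot> (a \<cdot> g)) = f \<cdot> (a \<cdot> g) - f \<cdot> g"
    using e2 cmp_diff_right[OF ag g f] by simp
  let ?b = "idm C Y + f \<cdot> (a \<cdot> g)" and ?u = "idm C Y - f \<cdot> g"
  have u: "?u \<in> Hom C Y Y" and b: "?b \<in> Hom C Y Y" using fg fag by auto
  have "?b \<cdot> ?u = ?u + (f \<cdot> (a \<cdot> g) - (f \<cdot> (a \<cdot> g)) \<cdot> (f \<cdot> g))"
    using cmp_add_left[OF u idm_in_Hom fag] cmp_idm_left[OF u] cmp_diff_right[OF idm_in_Hom fg fag]
      cmp_idm_right[OF fag] by simp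
  moreover have "?u \<cdot> ?b = ?u + (f \<cdot> (a \<cdot> g) - (f \<cdot> g) \<cdot> (f \<cdot> (a \<cdot> g)))"
    using cmp_add_right[OF idm_in_Hom fag u] cmp_idm_right[OF u] cmp_diff_left[OF fag idm_in_Hom fg]
      cmp_idm_left[OF fag] by simp
  ultimately show ?thesis using u b e1' e2' by (intro is_isoI[where b = ?b]) auto
qed

section \<open>The radical as a two-sided ideal\<close>

lemma radI: "\<lbrakk>f \<in> Hom C X Y; \<And>g. g \<in> Hom C Y X \<Longrightarrow> is_iso C X X (idm C X - g \<cdot> f)\<rbrakk> \<Longrightarrow> f \<in> rad C X Y"
  unfolding rad_def by blast

lemma rad_Hom: "f \<in> rad C X Y \<Longrightarrow> f \<in> Hom C X Y"
  unfolding rad_def by blast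

lemma rad_iso: "\<lbrakk>f \<in> rad C X Y; g \<in> Hom C Y X\<rbrakk> \<Longrightarrow> is_iso C X X (idm C X - g \<cdot> f)"
  unfolding rad_def by blast

lemma rad_iso': "\<lbrakk>f \<in> rad C X Y; g \<in> Hom C Y X\<rbrakk> \<Longrightarrow> is_iso C Y Y (idm C Y - f \<cdot> g)"
  using rad_iso rad_Hom is_iso_one_minus_swap by blast

text \<open>Left-right symmetry of the radical is Jacobson's lemma; it halves the work for every
  later statement about radical maps.\<close>

lemma rad_op: "rad (opcat C) X Y = rad C Y X"
proof (rule equalityI; rule subsetI)
  fix f assume f: "f \<in> rad C Y X"
  have "is_iso C X X (idm C X - f \<cdot> g)" if "g \<in> Hom C X Y" for g using rad_iso'[OF f that] .
  then show "f \<in> rad (opcat C) X Y"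
    using rad_Hom[OF f] by (simp add: rad_def[of "opcat C"] is_iso_op)
next
  fix f assume "f \<in> rad (opcat C) X Y"
  then have f: "f \<in> Hom C Y X" and iso: "\<And>g. g \<in> Hom C X Y \<Longrightarrow> is_iso C X X (idm C X - f \<cdot> g)"
    by (simp_all add: rad_def[of "opcat C"] is_iso_op)
  show "f \<in> rad C Y X"
    using f is_iso_one_minus_swap[OF _ f iso] by (intro radI)
qed

lemma rad_cmp_left:
  assumes "f \<in> rad C X Y" "h \<in> Hom C Y Z"
  shows "h \<cdot> f \<in> rad C X Z"
proof (rule radI)
  show "h \<cdot> f \<in> Hom C X Z" using assms rad_Hom cmp_in_Hom by blast
  fix g assume g: "g \<in> Hom C Z X"
  have "g \<cdot> (h \<cdot> f) = (g \<cdot> h) \<cdot> f" by (rule cmp_assoc[OF rad_Hom[OF assms(1)] assms(2) g])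
  then show "is_iso C X X (idm C X - g \<cdot> (h \<cdot> f))"
    using rad_iso[OF assms(1) cmp_in_Hom[OF assms(2) g]] by simp
qed

lemma rad_cmp_right:
  assumes "f \<in> rad C Y Z" "h \<in> Hom C X Y"
  shows "f \<cdot> h \<in> rad C X Z"
  using linear_category.rad_cmp_left[OF op_linear_category, of f Z Y h X] assms
  by (simp add: linear_category.rad_op linear_category_axioms)

lemma rad_idm_zero_object: "idm C X \<in> rad C X X \<Longrightarrow> zero_object C X"
proof -
  assume "idm C X \<in> rad C X X"
  then have "is_iso C X X 0"
    using rad_iso[of "idm C X" X X "idm C X"] cmp_idm_left[OF idm_in_Hom, of X] by simp
  then obtain b where "b \<in> Hom C X X" "b \<cdot> 0 = idm C X" by (rule is_isoE)
  then show ?thesis by (intro zero_objectI) simp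
qed

text \<open>With \<open>a\<close> inverse to \<open>?u = idm C X - g \<cdot> f\<close>, the map to
  be inverted is the product \<open>?u \<cdot> (idm C X - a \<cdot> (g \<cdot> f'))\<close>.\<close>

lemma rad_add:
  assumes f: "f \<in> rad C X Y" and f': "f' \<in> rad C X Y"
  shows "f + f' \<in> rad C X Y"
proof (rule radI)
  show "f + f' \<in> Hom C X Y" using assms rad_Hom by blast
  fix g assume g: "g \<in> Hom C Y X"
  have gf: "g \<cdot> f \<in> Hom C X X" "g \<cdot> f' \<in> Hom C X X"
    using cmp_in_Hom[OF rad_Hom[OF f] g] cmp_in_Hom[OF rad_Hom[OF f'] g] by auto
  have iso1: "is_iso C X X (idm C X - g \<cdot> f)" using rad_iso f g by blast
  then obtain a where a: "a \<in> Hom C X X" "(idm C X - g \<cdot> f) \<cdot> a = idm C X"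
    using is_isoE by metis
  let ?u = "idm C X - g \<cdot> f"
  have u: "?u \<in> Hom C X X" using gf by blast
  have agf: "a \<cdot> (g \<cdot> f') \<in> Hom C X X" using a gf cmp_in_Hom by blast
  have "is_iso C X X (idm C X - (a \<cdot> g) \<cdot> f')" using rad_iso[OF f'] a g cmp_in_Hom by blast
  moreover have "(a \<cdot> g) \<cdot> f' = a \<cdot> (g \<cdot> f')" using cmp_assoc[OF rad_Hom[OF f'] g a(1)] by simp
  ultimately have iso2: "is_iso C X X (idm C X - a \<cdot> (g \<cdot> f'))" by simp
  have "?u \<cdot> (idm C X - a \<cdot> (g \<cdot> f')) = ?u - (?u \<cdot> a) \<cdot> (g \<cdot> f')"
    using cmp_diff_right[OF idm_in_Hom agf u] cmp_idm_right[OF u] cmp_assoc[OF gf(2) a(1) u] by simp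
  also have "\<dots> = ?u - g \<cdot> f'" using a cmp_idm_left[OF gf(2)] by simp
  also have "\<dots> = idm C X - g \<cdot> (f + f')"
    using cmp_add_right[OF rad_Hom[OF f] rad_Hom[OF f'] g] by simp
  finally show "is_iso C X X (idm C X - g \<cdot> (f + f'))" using is_iso_cmp[OF iso2 iso1] by simp
qed

lemma rad_scl: assumes "f \<in> rad C X Y" shows "scl C c f \<in> rad C X Y"
proof -
  have "scl C c f = f \<cdot> scl C c (idm C X)"
    using cmp_scl_right[OF idm_in_Hom rad_Hom[OF assms]] cmp_idm_right[OF rad_Hom[OF assms]] by simp
  then show ?thesis using rad_cmp_right[OF assms] by (metis Hom_scl idm_in_Hom)
qed

lemma rad_zero [simp]: "0 \<in> rad C X Y"
  by (rule radI) (auto simp: is_iso_idm)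

lemma rad_subspace: "subspace (rad C X Y)"
  by (rule subspaceI) (auto simp: rad_add rad_scl)

lemma is_biproductE:
  assumes "is_biproduct C X Y P"
  obtains i j p q where "i \<in> Hom C X P" "j \<in> Hom C Y P" "p \<in> Hom C P X" "q \<in> Hom C P Y"
    "p \<cdot> i = idm C X" "q \<cdot> j = idm C Y" "p \<cdot> j = 0" "q \<cdot> i = 0" "i \<cdot> p + j \<cdot> q = idm C P"
  using assms unfolding is_biproduct_def by blast

lemma is_biproduct_opI: "is_biproduct C X Y P \<Longrightarrow> is_biproduct (opcat C) X Y P"
  unfolding is_biproduct_def opcat_simps
  by (elim exE, rule_tac x=p in exI, rule_tac x=q in exI, rule_tac x=i in exI, rule_tac x=j in exI) simp

lemma is_biproduct_op: "is_biproduct (opcat C) X Y P = is_biproduct C X Y P"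
  using is_biproduct_opI linear_category.is_biproduct_opI[OF op_linear_category] by fastforce

lemma zero_object_op: "zero_object (opcat C) X = zero_object C X"
  unfolding zero_object_def by auto

lemma indecomposable_op: "indecomposable (opcat C) X = indecomposable C X"
  unfolding indecomposable_def by (simp add: is_biproduct_op zero_object_op)

lemma is_biproduct_sym: "is_biproduct C X Y P \<Longrightarrow> is_biproduct C Y X P"
  unfolding is_biproduct_def by (metis add.commute)

text \<open>Makes invariance under isomorphism a special case of additivity on biproducts.\<close>

lemma is_biproduct_iso_zero:
  assumes "isomorphic C X P" "zero_object C Z"
  shows "is_biproduct C X Z P"
proof -
  obtain a b where ab: "a \<in> Hom C X P" "b \<in> Hom C P X" "b \<cdot> a = idm C X" "a \<cdot> b = idm C P"
    using assms(1) is_isoE unfolding isomorphic_def by metis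
  show ?thesis unfolding is_biproduct_def
    using ab zero_object_idm[OF assms(2)]
    by (intro exI[of _ a] exI[of _ 0] exI[of _ b] exI[of _ 0])
      (simp add: cmp_zero_left[OF zero_in_Hom] cmp_zero_left[OF ab(1)] cmp_zero_right[OF ab(2)])
qed

end


section \<open>Endomorphisms of indecomposable objects\<close>

text \<open>Horner evaluation of \<open>p\<close> at \<open>b\<close> in the endomorphism algebra of
  \<open>Y\<close>, whose unit depends on the object \<open>Y\<close>.\<close>

definition (in linear_category) pev :: "'o \<Rightarrow> 'm \<Rightarrow> 'k poly \<Rightarrow> 'm" where
  "pev Y b p = fold_coeffs (\<lambda>c y. scl C c (idm C Y) + b \<cdot> y) p 0"

context linear_category
begin

lemma pev_0 [simp]: "pev Y b 0 = 0"
  by (simp add: pev_def)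

lemma pev_pCons: "b \<in> Hom C Y Y \<Longrightarrow> pev Y b (pCons c p) = scl C c (idm C Y) + b \<cdot> pev Y b p"
  by (cases "c = 0 \<and> p = 0"; cases "c = 0") (auto simp: pev_def)

lemma pev_Hom: "b \<in> Hom C Y Y \<Longrightarrow> pev Y b p \<in> Hom C Y Y"
proof (induction p)
  case (pCons c p)
  then show ?case using cmp_in_Hom[of "pev Y b p" Y Y b Y] by (simp add: pev_pCons Hom_add Hom_scl)
qed simp

lemma pev_add:
  assumes b: "b \<in> Hom C Y Y"
  shows "pev Y b (p + q) = pev Y b p + pev Y b q"
proof (induction p q rule: poly_induct2)
  case (pCons c p d q)
  then show ?case
    using cmp_add_right[OF pev_Hom[OF b] pev_Hom[OF b] b] by (simp add: pev_pCons[OF b] scale_left_distrib)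
qed simp

lemma pev_smult:
  assumes b: "b \<in> Hom C Y Y"
  shows "pev Y b (smult c p) = scl C c (pev Y b p)"
proof (induction p)
  case (pCons d p)
  then show ?case
    using cmp_scl_right[OF pev_Hom[OF b] b] by (simp add: pev_pCons[OF b] scale_right_distrib)
qed simp

lemma pev_mult:
  assumes b: "b \<in> Hom C Y Y"
  shows "pev Y b (p * q) = pev Y b p \<cdot> pev Y b q"
proof (induction p)
  case 0
  then show ?case using cmp_zero_left[OF pev_Hom[OF b]] by simp
next
  case (pCons c p)
  note P = pev_Hom[OF b, of p] and Q = pev_Hom[OF b, of q]
  have "pev Y b (pCons c p * q) = scl C c (pev Y b q) + b \<cdot> (pev Y b p \<cdot> pev Y b q)"
    using pCons by (simp add: pev_add[OF b] pev_smult[OF b] pev_pCons[OF b])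
  also have "\<dots> = scl C c (idm C Y) \<cdot> pev Y b q + (b \<cdot> pev Y b p) \<cdot> pev Y b q"
    using cmp_assoc[OF Q P b] cmp_scl_left[OF Q idm_in_Hom, of c] cmp_idm_left[OF Q] by simp
  also have "\<dots> = pev Y b (pCons c p) \<cdot> pev Y b q"
    using cmp_add_left[OF Q Hom_scl[OF idm_in_Hom] cmp_in_Hom[OF P b]] by (simp add: pev_pCons[OF b])
  finally show ?case .
qed

lemma pev_1 [simp]: "b \<in> Hom C Y Y \<Longrightarrow> pev Y b 1 = idm C Y"
  by (simp add: one_pCons pev_pCons)

lemma pev_X: "b \<in> Hom C Y Y \<Longrightarrow> pev Y b [:0, 1:] = b"
  by (simp add: pev_pCons cmp_idm_right)

lemma pev_sum: "b \<in> Hom C Y Y \<Longrightarrow> pev Y b (sum p I) = (\<Sum>i\<in>I. pev Y b (p i))"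
  by (induction I rule: infinite_finite_induct) (auto simp: pev_add)

end

text \<open>Collects the assumptions of the linear theory without the triangulated structure, so
  that the opposite category is again an instance.\<close>

locale krull_schmidt_category = linear_category C
  for C :: "('o, 'm::ab_group_add, 'k::alg_closed_field) tricat" (structure) +
  assumes KS_zero: "\<exists>Z. zero_object C Z"
    and KS_biproduct: "\<exists>P. is_biproduct C X Y P"
    and KS_split: "\<lbrakk>e \<in> Hom C X X; e \<cdot> e = e\<rbrakk> \<Longrightarrow>
      \<exists>Y. \<exists>r\<in>Hom C X Y. \<exists>s\<in>Hom C Y X. r \<cdot> s = idm C Y \<and> s \<cdot> r = e"
    and KS_finite: "\<exists>B. finite B \<and> Hom C X Y = span B"
begin

lemma op_krull_schmidt: "krull_schmidt_category (opcat C)"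
proof -
  interpret op: linear_category "opcat C" by (rule op_linear_category)
  show ?thesis
  proof
    show "\<exists>Z. zero_object (opcat C) Z" using KS_zero by (simp add: zero_object_op)
    show "\<exists>P. is_biproduct (opcat C) X Y P" for X Y using KS_biproduct by (simp add: is_biproduct_op)
    show "\<exists>Y. \<exists>r\<in>Hom (opcat C) X Y. \<exists>s\<in>Hom (opcat C) Y X.
        r \<cdot>\<^bsub>opcat C\<^esub> s = idm (opcat C) Y \<and> s \<cdot>\<^bsub>opcat C\<^esub> r = e"
      if "e \<in> Hom (opcat C) X X" "e \<cdot>\<^bsub>opcat C\<^esub> e = e" for e X
      using KS_split[of e X] that by (simp only: opcat_simps) blast
    show "\<exists>B. finite B \<and> Hom (opcat C) X Y = module.span (scl (opcat C)) B" for X Y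
      using KS_finite[of Y X] by simp
  qed
qed

text \<open>\<open>A\<close> and \<open>B\<close> come from splitting \<open>e\<close> and the
  complementary idempotent \<open>idm C Y - e\<close>.\<close>

lemma idempotent_biproduct:
  assumes e: "e \<in> Hom C Y Y" "e \<cdot> e = e"
  obtains A B r s where "is_biproduct C A B Y" "r \<in> Hom C Y A" "s \<in> Hom C A Y" "r \<cdot> s = idm C A" "s \<cdot> r = e"
    "zero_object C B \<Longrightarrow> e = idm C Y"
proof -
  obtain A r s where rs: "r \<in> Hom C Y A" "s \<in> Hom C A Y" "r \<cdot> s = idm C A" "s \<cdot> r = e"
    using KS_split[OF e] by blast
  let ?e = "idm C Y - e"
  have e': "?e \<in> Hom C Y Y" using e by blast
  have ee: "e \<cdot> ?e = 0" "?e \<cdot> e = 0"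
    using cmp_diff_right[OF idm_in_Hom e(1) e(1)] cmp_diff_left[OF e(1) idm_in_Hom e(1)]
      cmp_idm_left[OF e(1)] cmp_idm_right[OF e(1)] e(2) by simp_all
  have "?e \<cdot> ?e = ?e" using cmp_diff_right[OF idm_in_Hom e(1) e'] ee cmp_idm_right[OF e'] by simp
  then obtain B r' s' where rs': "r' \<in> Hom C Y B" "s' \<in> Hom C B Y" "r' \<cdot> s' = idm C B" "s' \<cdot> r' = ?e"
    using KS_split[OF e'] by blast
  have "r \<cdot> e = r" using cmp_assoc[OF rs(1,2,1)] rs cmp_idm_left[OF rs(1)] by simp
  moreover have "?e \<cdot> s' = s'" using cmp_assoc[OF rs'(2,1,2)] rs' cmp_idm_right[OF rs'(2)] by simp
  ultimately have "r \<cdot> s' = (r \<cdot> e) \<cdot> (?e \<cdot> s')" by simp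
  then have 1: "r \<cdot> s' = 0"
    using cmp_assoc4[OF rs'(2) e' e(1) rs(1)] ee rs cmp_zero_left[OF rs'(2)] by simp
  have "r' \<cdot> ?e = r'" using cmp_assoc[OF rs'(1,2,1)] rs' cmp_idm_left[OF rs'(1)] by simp
  moreover have "e \<cdot> s = s" using cmp_assoc[OF rs(2,1,2)] rs cmp_idm_right[OF rs(2)] by simp
  ultimately have "r' \<cdot> s = (r' \<cdot> ?e) \<cdot> (e \<cdot> s)" by simp
  then have 2: "r' \<cdot> s = 0"
    using cmp_assoc4[OF rs(2) e(1) e' rs'(1)] ee rs' cmp_zero_left[OF rs(2)] by simp
  have "is_biproduct C A B Y" unfolding is_biproduct_def
    using rs rs' 1 2 by (intro exI[of _ s] exI[of _ s'] exI[of _ r] exI[of _ r']) simp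
  moreover have "e = idm C Y" if "zero_object C B"
  proof -
    have "s' = 0" using that rs'(2) unfolding zero_object_def by blast
    then show ?thesis using rs'(4) cmp_zero_left[OF rs'(1)] by simp
  qed
  ultimately show ?thesis using that rs by blast
qed

text \<open>With \<open>w\<close> inverse to \<open>g \<cdot> a\<close>, the endomorphism
  \<open>a \<cdot> (w \<cdot> g)\<close> is an idempotent with image \<open>A\<close>.\<close>

lemma retract_biproduct:
  assumes a: "a \<in> Hom C A X" and g: "g \<in> Hom C X A" and ga: "is_iso C A A (g \<cdot> a)"
  shows "\<exists>B. is_biproduct C A B X"
proof -
  obtain w where w: "w \<in> Hom C A A" "w \<cdot> (g \<cdot> a) = idm C A" using ga is_isoE by metis
  let ?g = "w \<cdot> g"
  have g': "?g \<in> Hom C X A" using cmp_in_Hom[OF g w(1)] .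
  have ga': "?g \<cdot> a = idm C A" using w cmp_assoc[OF a g w(1)] by simp
  have ag: "a \<cdot> ?g \<in> Hom C X X" using cmp_in_Hom[OF g' a] .
  have "(a \<cdot> ?g) \<cdot> (a \<cdot> ?g) = a \<cdot> ?g"
    using cmp_assoc4[OF g' a g' a] ga' cmp_idm_left[OF g'] by simp
  then obtain A' B r s where AB: "is_biproduct C A' B X" and rs: "r \<in> Hom C X A'" "s \<in> Hom C A' X"
    "r \<cdot> s = idm C A'" "s \<cdot> r = a \<cdot> ?g"
    by (rule idempotent_biproduct[OF ag]) blast
  obtain i j p q where ij: "i \<in> Hom C A' X" "j \<in> Hom C B X" "p \<in> Hom C X A'" "q \<in> Hom C X B"
    "p \<cdot> i = idm C A'" "q \<cdot> j = idm C B" "p \<cdot> j = 0" "q \<cdot> i = 0" "i \<cdot> p + j \<cdot> q = idm C X"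
    using AB by (rule is_biproductE)
  \<comment> \<open>\<open>A\<close> and the object \<open>A'\<close> found by splitting are images
    of the same idempotent; \<open>?b\<close> and \<open>?c\<close> are the mutually inverse
    comparison maps.\<close>
  let ?b = "?g \<cdot> s" and ?c = "r \<cdot> a"
  have b: "?b \<in> Hom C A' A" using cmp_in_Hom[OF rs(2) g'] .
  have c: "?c \<in> Hom C A A'" using cmp_in_Hom[OF a rs(1)] .
  have "?b \<cdot> ?c = ?g \<cdot> ((a \<cdot> ?g) \<cdot> a)" using cmp_assoc4[OF a rs(1,2) g'] rs by simp
  also have "\<dots> = idm C A" using cmp_assoc[OF a g' a] ga' cmp_idm_right[OF a] by simp
  finally have bc: "?b \<cdot> ?c = idm C A" .
  have "?c \<cdot> ?b = r \<cdot> ((s \<cdot> r) \<cdot> s)" using cmp_assoc4[OF rs(2) g' a rs(1)] rs(4) by simp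
  also have "\<dots> = idm C A'" using cmp_assoc[OF rs(2,1,2)] rs(3) cmp_idm_right[OF rs(2)] by simp
  finally have cb: "?c \<cdot> ?b = idm C A'" .
  have ic: "i \<cdot> ?c \<in> Hom C A X" and bp: "?b \<cdot> p \<in> Hom C X A"
    using cmp_in_Hom[OF c ij(1)] cmp_in_Hom[OF ij(3) b] .
  have "(?b \<cdot> p) \<cdot> (i \<cdot> ?c) = idm C A"
    using cmp_assoc4[OF c ij(1,3) b] ij(5) cmp_idm_left[OF c] bc by simp
  moreover have "(i \<cdot> ?c) \<cdot> (?b \<cdot> p) = i \<cdot> p"
    using cmp_assoc4[OF ij(3) b c ij(1)] cb cmp_idm_left[OF ij(3)] by simp
  moreover have "(?b \<cdot> p) \<cdot> j = 0" using cmp_assoc[OF ij(2,3) b] ij(7) cmp_zero_right[OF b] by simp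
  moreover have "q \<cdot> (i \<cdot> ?c) = 0" using cmp_assoc[OF c ij(1,4)] ij(8) cmp_zero_left[OF c] by simp
  ultimately have "is_biproduct C A B X" unfolding is_biproduct_def
    using ij ic bp by (intro exI[of _ "i \<cdot> ?c"] exI[of _ j] exI[of _ "?b \<cdot> p"] exI[of _ q]) simp
  then show ?thesis by blast
qed

lemma indecomposable_idempotent:
  assumes "indecomposable C Y" "e \<in> Hom C Y Y" "e \<cdot> e = e"
  shows "e = 0 \<or> e = idm C Y"
proof -
  obtain A B r s where AB: "is_biproduct C A B Y" "r \<in> Hom C Y A" "s \<in> Hom C A Y" "s \<cdot> r = e"
    "zero_object C B \<Longrightarrow> e = idm C Y"
    using assms(2,3) by (rule idempotent_biproduct) blast
  have "zero_object C A \<or> zero_object C B" using assms(1) AB(1) unfolding indecomposable_def by blast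
  moreover have "e = 0" if "zero_object C A"
  proof -
    have "s = 0" using that AB(3) unfolding zero_object_def by blast
    then show ?thesis using AB(4) cmp_zero_left[OF AB(2)] by simp
  qed
  ultimately show ?thesis using AB(5) by blast
qed

text \<open>The powers of \<open>b\<close> lie in a space spanned by \<open>N\<close> elements, so
  \<open>N + 1\<close> of them are dependent.\<close>

lemma annihilating_poly:
  assumes b: "b \<in> Hom C Y Y"
  shows "\<exists>p. p \<noteq> 0 \<and> pev Y b p = 0"
proof (rule ccontr)
  assume none: "\<nexists>p. p \<noteq> 0 \<and> pev Y b p = 0"
  obtain B where B: "finite B" "Hom C Y Y = span B" using KS_finite by blast
  define w where "w i = pev Y b (monom 1 i)" for i
  define N where "N = card B"
  \<comment> \<open>Two equal powers would already give an annihilating polynomial; injectivity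
    guarantees that the set of powers really has \<open>N + 1\<close> elements.\<close>
  have inj: "inj w"
  proof (rule injI)
    fix i j assume "w i = w j"
    then have "pev Y b (monom 1 i + smult (-1) (monom 1 j)) = 0"
      by (simp only: pev_add[OF b] pev_smult[OF b] w_def) simp
    then have eq: "monom (1::'k) i + smult (-1) (monom 1 j) = 0" using none by metis
    show "i = j"
    proof (rule ccontr)
      assume "i \<noteq> j"
      moreover have "coeff (monom (1::'k) i + smult (-1) (monom 1 j)) i = 0" unfolding eq by simp
      ultimately show False by (simp add: coeff_monom)
    qed
  qed
  let ?S = "w ` {..N}"
  have "independent ?S"
  proof (rule independent_if_scalars_zero)
    show "finite ?S" by simp
    fix u x assume sum0: "(\<Sum>x\<in>?S. scl C (u x) x) = 0" and x: "x \<in> ?S"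
    obtain k where k: "k \<le> N" "x = w k" using x by auto
    let ?p = "\<Sum>i\<le>N. smult (u (w i)) (monom 1 i)"
    have "pev Y b ?p = (\<Sum>i\<le>N. scl C (u (w i)) (w i))"
      by (simp add: pev_sum[OF b] pev_smult[OF b] w_def)
    also have "\<dots> = (\<Sum>x\<in>?S. scl C (u x) x)"
      using inj by (simp add: sum.reindex inj_on_subset)
    finally have "?p = 0" using sum0 none by metis
    then have "coeff ?p k = 0" by (metis coeff_0)
    moreover have "coeff ?p k = u (w k)"
      using k by (simp add: coeff_sum coeff_monom mult_delta_right)
    ultimately show "u x = 0" using k by simp
  qed
  moreover have "?S \<subseteq> span B" using pev_Hom[OF b] B unfolding w_def by auto
  ultimately have "card ?S \<le> card B" using independent_span_bound[OF B(1)] by blast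
  moreover have "card ?S = Suc N" using inj by (simp add: card_image inj_on_subset)
  ultimately show False by (simp add: N_def)
qed

lemma poly_monom_factor:
  fixes p :: "'a::comm_ring_1 poly"
  assumes "p \<noteq> 0"
  shows "\<exists>n c r. c \<noteq> 0 \<and> p = monom 1 n * pCons c r"
  using assms
proof (induction p)
  case (pCons c p)
  show ?case
  proof (cases "c = 0")
    case True
    then have "p \<noteq> 0" using pCons by auto
    then obtain n d r where "d \<noteq> 0" "p = monom 1 n * pCons d r" using pCons by blast
    moreover have "pCons 0 (monom 1 n * pCons d r) = monom 1 (Suc n) * pCons d r"
      by (simp add: monom_Suc)
    ultimately show ?thesis using True by metis
  next
    case False
    then show ?thesis by (intro exI[of _ 0] exI[of _ c] exI[of _ p]) simp
  qed
qed simp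

text \<open>
  Fitting's lemma: a relation \<open>b\<^sup>n (c + b r) = 0\<close> with \<open>c \<noteq> 0\<close> gives \<open>b\<^sup>n = b\<^sup>2\<^sup>n t\<^sup>n\<close> with \<open>t = - r / c\<close>,
  so that \<open>b\<^sup>n t\<^sup>n\<close> is idempotent.
\<close>

lemma indecomposable_iso_or_nilpotent:
  assumes Y: "indecomposable C Y" and b: "b \<in> Hom C Y Y"
  shows "is_iso C Y Y b \<or> (\<exists>n. pev Y b (monom 1 n) = 0)"
proof -
  obtain n c r where c: "c \<noteq> 0" and p0: "pev Y b (monom 1 n * pCons c r) = 0"
    using annihilating_poly[OF b] poly_monom_factor by metis
  let ?m = "monom 1 n :: 'k poly"
  let ?t = "smult (- 1 / c) r"
  let ?s = "pCons 0 ?t"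
  have ms: "pev Y b (?m * ?s) = pev Y b ?m"
  proof -
    have "?s = smult (- 1 / c) (pCons c r) + 1" using c by (simp add: one_pCons)
    then have "?m * ?s = smult (- 1 / c) (?m * pCons c r) + ?m"
      by (simp only: distrib_left mult_smult_right mult_1_right)
    then show ?thesis using p0 by (simp only: pev_add[OF b] pev_smult[OF b]) simp
  qed
  have msk: "pev Y b (?m * ?s ^ k) = pev Y b ?m" for k
  proof (induction k)
    case (Suc k)
    have "pev Y b (?m * ?s ^ Suc k) = pev Y b (?m * ?s) \<cdot> pev Y b (?s ^ k)"
      by (simp only: pev_mult[OF b, symmetric] power_Suc mult.assoc)
    also have "\<dots> = pev Y b (?m * ?s ^ k)" unfolding ms by (rule pev_mult[OF b, symmetric])
    finally show ?case using Suc by simp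
  qed simp
  have sn: "?s ^ k = monom 1 k * ?t ^ k" for k
  proof -
    have "?s = [:0, 1:] * ?t" by simp
    then show ?thesis by (simp only: power_mult_distrib) (simp add: monom_altdef)
  qed
  have mm: "pev Y b (?m * ?m * ?t ^ n) = pev Y b ?m" using msk[of n] sn[of n] by (simp add: mult.assoc)
  let ?e = "pev Y b (?m * ?t ^ n)"
  have "?e \<cdot> ?e = pev Y b (?m * ?m * ?t ^ n) \<cdot> pev Y b (?t ^ n)"
    by (simp only: pev_mult[OF b, symmetric] ac_simps)
  also have "\<dots> = ?e" unfolding mm by (rule pev_mult[OF b, symmetric])
  finally have "?e = 0 \<or> ?e = idm C Y" using indecomposable_idempotent[OF Y pev_Hom[OF b]] by blast
  moreover have "pev Y b ?m = 0" if "?e = 0"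
  proof -
    have "pev Y b ?m = pev Y b ?m \<cdot> ?e" using mm by (simp add: pev_mult[OF b, symmetric] mult.assoc)
    then show ?thesis using that cmp_zero_right[OF pev_Hom[OF b]] by simp
  qed
  moreover have "is_iso C Y Y b" if "pev Y b ([:0, 1:] * q) = idm C Y" for q
    using that pev_mult[OF b, of "[:0,1:]" q] pev_mult[OF b, of q "[:0,1:]"] pev_X[OF b]
    by (intro is_isoI[OF b pev_Hom[OF b, of q]]) (simp_all add: mult.commute)
  \<comment> \<open>If the idempotent is the identity, a factor \<open>b\<close> can be split off
    from it. For \<open>n = 0\<close> the factor \<open>?m\<close> contains none, and the relation
    \<open>ms\<close> supplies the inverse directly.\<close>
  moreover have "\<exists>q. pev Y b ([:0, 1:] * q) = idm C Y" if "?e = idm C Y"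
  proof (cases n)
    case 0
    then have "pev Y b ([:0, 1:] * ?t) = idm C Y" using ms b by simp
    then show ?thesis by blast
  next
    case (Suc l)
    then have "?m = [:0, 1:] * monom 1 l" by (simp add: monom_Suc)
    then show ?thesis using that by (metis mult.assoc)
  qed
  ultimately show ?thesis by blast
qed

text \<open>The inverse is the geometric series in \<open>b\<close>.\<close>

lemma nilpotent_one_minus_iso:
  assumes b: "b \<in> Hom C Y Y" and "pev Y b (monom 1 n) = 0"
  shows "is_iso C Y Y (idm C Y - b)"
proof -
  let ?x = "[:0, 1:] :: 'k poly"
  let ?q = "\<Sum>i<n. ?x ^ i"
  have x: "monom 1 n = ?x ^ n" by (simp add: monom_altdef)
  have "1 - ?x ^ n = (1 - ?x) * ?q" by (rule one_diff_power_eq)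
  then have eq: "(1 + smult (-1) ?x) * ?q = 1 + smult (-1) (?x ^ n)" by simp
  have "pev Y b (1 + smult (-1) (?x ^ n)) = idm C Y"
    using assms(2) b unfolding x by (simp only: pev_add[OF b] pev_smult[OF b]) simp
  then have 1: "pev Y b ((1 + smult (-1) ?x) * ?q) = idm C Y" by (simp only: eq)
  have u: "pev Y b (1 + smult (-1) ?x) = idm C Y - b"
    using b by (simp only: pev_add[OF b] pev_smult[OF b] pev_X[OF b]) simp
  have "pev Y b (1 + smult (-1) ?x) \<cdot> pev Y b ?q = idm C Y"
    using 1 pev_mult[OF b] by metis
  moreover have "pev Y b ?q \<cdot> pev Y b (1 + smult (-1) ?x) = idm C Y"
    using 1 pev_mult[OF b] mult.commute by metis
  ultimately show ?thesis unfolding u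
    using Hom_diff[OF idm_in_Hom b] pev_Hom[OF b, of ?q] by (intro is_isoI)
qed

text \<open>The idempotent \<open>b \<cdot> g\<close> is zero or the identity, and zero would make
  \<open>Y\<close> a zero object.\<close>

lemma split_mono_end_iso:
  assumes Y: "indecomposable C Y" and b: "b \<in> Hom C Y Y" and g: "g \<in> Hom C Y Y" and gb: "g \<cdot> b = idm C Y"
  shows "is_iso C Y Y b"
proof -
  have bg: "b \<cdot> g \<in> Hom C Y Y" using cmp_in_Hom[OF g b] .
  have "(b \<cdot> g) \<cdot> (b \<cdot> g) = b \<cdot> g" using cmp_assoc4[OF g b g b] gb cmp_idm_left[OF g] by simp
  then consider "b \<cdot> g = 0" | "b \<cdot> g = idm C Y" using indecomposable_idempotent[OF Y bg] by blast
  then show ?thesis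
  proof cases
    case 1
    have "b = (b \<cdot> g) \<cdot> b" using cmp_assoc[OF b g b] gb cmp_idm_right[OF b] by simp
    then have "b = 0" using 1 cmp_zero_left[OF b] by simp
    then have "idm C Y = 0" using gb cmp_zero_right[OF g] by simp
    then have "zero_object C Y" by (rule zero_objectI)
    then show ?thesis using Y unfolding indecomposable_def by blast
  next
    case 2
    then show ?thesis using b g gb is_isoI by blast
  qed
qed

text \<open>No \<open>g \<cdot> b\<close> is invertible, since \<open>b\<close> would be a split
  monomorphism and hence an isomorphism; so each is nilpotent by Fitting's lemma.\<close>

lemma noniso_end_rad:
  assumes Y: "indecomposable C Y" and b: "b \<in> Hom C Y Y" and "\<not> is_iso C Y Y b"
  shows "b \<in> rad C Y Y"
proof (rule radI[OF b])
  fix g assume g: "g \<in> Hom C Y Y"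
  have gb: "g \<cdot> b \<in> Hom C Y Y" using cmp_in_Hom[OF b g] .
  have "\<not> is_iso C Y Y (g \<cdot> b)"
  proof
    assume "is_iso C Y Y (g \<cdot> b)"
    then obtain w where w: "w \<in> Hom C Y Y" "w \<cdot> (g \<cdot> b) = idm C Y" using is_isoE by metis
    then have "(w \<cdot> g) \<cdot> b = idm C Y" using cmp_assoc[OF b g w(1)] by simp
    then show False using split_mono_end_iso[OF Y b cmp_in_Hom[OF g w(1)]] assms(3) by blast
  qed
  then show "is_iso C Y Y (idm C Y - g \<cdot> b)"
    using indecomposable_iso_or_nilpotent[OF Y gb] nilpotent_one_minus_iso[OF gb] by blast
qed

text \<open>The scalar is a root of an annihilating polynomial of minimal degree.\<close>

lemma end_scalar_plus_rad:
  assumes Y: "indecomposable C Y" and a: "a \<in> Hom C Y Y"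
  shows "\<exists>c. a - scl C c (idm C Y) \<in> rad C Y Y"
proof -
  obtain p where p: "p \<noteq> 0" "pev Y a p = 0" and min: "\<And>q. q \<noteq> 0 \<Longrightarrow> pev Y a q = 0 \<Longrightarrow> degree p \<le> degree q"
    using ex_has_least_nat[of "\<lambda>p. p \<noteq> 0 \<and> pev Y a p = 0" _ degree] annihilating_poly[OF a] by metis
  have "degree p > 0"
  proof (rule ccontr)
    assume "\<not> degree p > 0"
    then obtain c where c: "p = [:c:]" using degree_eq_zeroE by auto
    then have "scl C c (idm C Y) = 0" using p a by (simp add: pev_pCons)
    then have "idm C Y = 0" using c p by simp
    then show False using zero_objectI Y unfolding indecomposable_def by blast
  qed
  then obtain c where "poly p c = 0" using alg_closed_imp_poly_has_root by blast
  then obtain q where q: "p = [:-c, 1:] * q" by (metis poly_eq_0_iff_dvd dvdE)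
  let ?b = "a - scl C c (idm C Y)"
  have b: "?b \<in> Hom C Y Y" using a by blast
  have q0: "q \<noteq> 0" using p q by auto
  then have "degree q < degree p" unfolding q by (subst degree_mult_eq) auto
  then have nz: "pev Y a q \<noteq> 0" using min q0 by fastforce
  have "pev Y a [:-c, 1:] = ?b"
    using a by (simp add: pev_pCons[OF a] cmp_idm_right[OF a])
  then have "?b \<cdot> pev Y a q = 0" using p q pev_mult[OF a] by metis
  \<comment> \<open>An invertible factor could be cancelled, and then \<open>q\<close>, of smaller
    degree than \<open>p\<close>, would annihilate \<open>a\<close>.\<close>
  have "\<not> is_iso C Y Y ?b"
  proof
    assume "is_iso C Y Y ?b"
    then obtain w where w: "w \<in> Hom C Y Y" "w \<cdot> ?b = idm C Y" using is_isoE by metis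
    have "pev Y a q = w \<cdot> (?b \<cdot> pev Y a q)"
      using cmp_assoc[OF pev_Hom[OF a] b w(1)] w(2) cmp_idm_left[OF pev_Hom[OF a]] by simp
    then show False using \<open>?b \<cdot> pev Y a q = 0\<close> cmp_zero_right[OF w(1)] nz by simp
  qed
  then show ?thesis using noniso_end_rad[OF Y b] by blast
qed

lemma indecomposable_idm_not_rad: "indecomposable C Y \<Longrightarrow> idm C Y \<notin> rad C Y Y"
  using rad_idm_zero_object unfolding indecomposable_def by blast

text \<open>The endomorphism ring is local: if \<open>idm C Y - g \<cdot> f\<close> is not
  invertible it is radical, and then \<open>g \<cdot> f\<close> is invertible.\<close>

lemma not_rad_split:
  assumes Y: "indecomposable C Y" and f: "f \<in> Hom C Y Z" "f \<notin> rad C Y Z"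
  obtains g where "g \<in> Hom C Z Y" "g \<cdot> f = idm C Y"
proof -
  obtain g where g: "g \<in> Hom C Z Y" "\<not> is_iso C Y Y (idm C Y - g \<cdot> f)" using f radI by blast
  have gf: "g \<cdot> f \<in> Hom C Y Y" using cmp_in_Hom[OF f(1) g(1)] .
  have r: "idm C Y - g \<cdot> f \<in> rad C Y Y" using noniso_end_rad[OF Y _ g(2)] gf by blast
  have "is_iso C Y Y (idm C Y - idm C Y \<cdot> (idm C Y - g \<cdot> f))" using rad_iso[OF r idm_in_Hom] .
  then have "is_iso C Y Y (g \<cdot> f)" using cmp_idm_left[OF rad_Hom[OF r]] by simp
  then obtain w where w: "w \<in> Hom C Y Y" "w \<cdot> (g \<cdot> f) = idm C Y" using is_isoE by metis
  have "(w \<cdot> g) \<cdot> f = idm C Y" using cmp_assoc[OF f(1) g(1) w(1)] w by simp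
  then show ?thesis using that cmp_in_Hom[OF g(1) w(1)] by blast
qed

text \<open>A non-radical \<open>f\<close> has a left inverse \<open>g\<close>; the idempotent
  \<open>f \<cdot> g\<close> of the indecomposable \<open>Y\<close> is nonzero, hence the
  identity.\<close>

lemma nonisomorphic_Hom_rad:
  assumes X: "indecomposable C X" and Y: "indecomposable C Y" and "\<not> isomorphic C X Y" and f: "f \<in> Hom C X Y"
  shows "f \<in> rad C X Y"
proof (rule ccontr)
  assume "f \<notin> rad C X Y"
  then obtain g where g: "g \<in> Hom C Y X" "g \<cdot> f = idm C X" using not_rad_split[OF X f] by metis
  have fg: "f \<cdot> g \<in> Hom C Y Y" using cmp_in_Hom[OF g(1) f] .
  have "(f \<cdot> g) \<cdot> (f \<cdot> g) = f \<cdot> g" using cmp_assoc4[OF g(1) f g(1) f] g cmp_idm_left[OF g(1)] by simp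
  then consider "f \<cdot> g = 0" | "f \<cdot> g = idm C Y" using indecomposable_idempotent[OF Y fg] by blast
  then show False
  proof cases
    case 1
    have "f = (f \<cdot> g) \<cdot> f" using cmp_assoc[OF f g(1) f] g cmp_idm_right[OF f] by simp
    then have "f = 0" using 1 cmp_zero_left[OF f] by simp
    then have "idm C X = 0" using g cmp_zero_right[OF g(1)] by simp
    then show False using zero_objectI X unfolding indecomposable_def by blast
  next
    case 2
    then have "isomorphic C X Y" unfolding isomorphic_def using is_isoI[OF f g(1)] g by blast
    then show False using assms(3) by blast
  qed
qed

end


section \<open>Multiplicities and additive closures\<close>

text \<open>For indecomposable \<open>Y\<close>, this is the number of summands of \<open>X\<close> isomorphic to \<open>Y\<close>.\<close>

definition rmult :: "('o, 'm::ab_group_add, 'k::field) tricat \<Rightarrow> 'o \<Rightarrow> 'o \<Rightarrow> nat" where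
  "rmult C Y X = hdim C (Hom C Y X) - hdim C (rad C Y X)"

text \<open>The ideal of morphisms that factor through some finite direct sum of the
  \<open>Ts i\<close>, \<open>i \<in> I\<close>; as a span of composites it needs no direct sum to
  be formed.\<close>

definition factor_through ::
  "('o, 'm::ab_group_add, 'k::field) tricat \<Rightarrow> ('i \<Rightarrow> 'o) \<Rightarrow> 'i set \<Rightarrow> 'o \<Rightarrow> 'o \<Rightarrow> 'm set" where
  "factor_through C Ts I X Y = module.span (scl C)
     {a \<cdot>\<^bsub>C\<^esub> b | i a b. i \<in> I \<and> a \<in> Hom C (Ts i) Y \<and> b \<in> Hom C X (Ts i)}"

text \<open>
  \<open>X\<close> is a direct summand of a finite direct sum of copies of the \<open>Ts i\<close>, \<open>i \<in> I\<close>; in this form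
  membership is tested by linear conditions on the components of a morphism.
\<close>

definition in_add :: "('o, 'm::ab_group_add, 'k::field) tricat \<Rightarrow> ('i \<Rightarrow> 'o) \<Rightarrow> 'i set \<Rightarrow> 'o \<Rightarrow> bool" where
  "in_add C Ts I X \<longleftrightarrow> idm C X \<in> factor_through C Ts I X X"

context linear_category
begin

lemma rmult_op: "rmult (opcat C) Y X = rmult C X Y"
  by (simp add: rmult_def rad_op)

lemma factor_through_subspace: "subspace (factor_through C Ts I X Y)"
  unfolding factor_through_def by (rule subspace_span)

lemma factor_throughI:
  "\<lbrakk>i \<in> I; a \<in> Hom C (Ts i) Y; b \<in> Hom C X (Ts i)\<rbrakk> \<Longrightarrow> a \<cdot> b \<in> factor_through C Ts I X Y"
  unfolding factor_through_def by (rule span_base) blast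

lemma factor_through_least:
  assumes "subspace S"
    and "\<And>i a b. \<lbrakk>i \<in> I; a \<in> Hom C (Ts i) Y; b \<in> Hom C X (Ts i)\<rbrakk> \<Longrightarrow> a \<cdot> b \<in> S"
  shows "factor_through C Ts I X Y \<subseteq> S"
  unfolding factor_through_def using assms by (intro span_minimal) auto

lemma subspace_preimage_left:
  assumes "subspace S" "h \<in> Hom C Y Z"
  shows "subspace {z \<in> Hom C X Y. h \<cdot> z \<in> S}"
proof (rule subspaceI)
  show "0 \<in> {z \<in> Hom C X Y. h \<cdot> z \<in> S}" using assms subspace_0 by simp
next
  fix x y assume xy: "x \<in> {z \<in> Hom C X Y. h \<cdot> z \<in> S}" "y \<in> {z \<in> Hom C X Y. h \<cdot> z \<in> S}"
  then have "h \<cdot> (x + y) = h \<cdot> x + h \<cdot> y" using assms(2) by (intro cmp_add_right[of _ X Y _ _ Z]) auto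
  then show "x + y \<in> {z \<in> Hom C X Y. h \<cdot> z \<in> S}" using xy subspace_add[OF assms(1)] by auto
next
  fix c x assume x: "x \<in> {z \<in> Hom C X Y. h \<cdot> z \<in> S}"
  then have "h \<cdot> scl C c x = scl C c (h \<cdot> x)" using assms(2) by (intro cmp_scl_right[of _ X Y _ Z]) auto
  then show "scl C c x \<in> {z \<in> Hom C X Y. h \<cdot> z \<in> S}" using x subspace_scale[OF assms(1)] by auto
qed

lemma subspace_preimage_right:
  assumes "subspace S" "h \<in> Hom C X Y"
  shows "subspace {z \<in> Hom C Y Z. z \<cdot> h \<in> S}"
  using linear_category.subspace_preimage_left[OF op_linear_category, of S h Y X Z] assms by simp

lemma factor_through_cmp_left:
  assumes "z \<in> factor_through C Ts I X Y" "h \<in> Hom C Y Z"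
  shows "h \<cdot> z \<in> factor_through C Ts I X Z"
proof -
  have "factor_through C Ts I X Y \<subseteq> {z \<in> Hom C X Y. h \<cdot> z \<in> factor_through C Ts I X Z}"
  proof (rule factor_through_least[OF subspace_preimage_left[OF factor_through_subspace assms(2)]])
    fix i a b assume i: "i \<in> I" and a: "a \<in> Hom C (Ts i) Y" and b: "b \<in> Hom C X (Ts i)"
    have "h \<cdot> (a \<cdot> b) = (h \<cdot> a) \<cdot> b" by (rule cmp_assoc[OF b a assms(2)])
    then show "a \<cdot> b \<in> {z \<in> Hom C X Y. h \<cdot> z \<in> factor_through C Ts I X Z}"
      using factor_throughI[of i I "h \<cdot> a" Ts Z b X] cmp_in_Hom[OF a assms(2)] cmp_in_Hom[OF b a] i b by simp
  qed
  then show ?thesis using assms(1) by blast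
qed

lemma factor_through_op: "factor_through (opcat C) Ts I X Y = factor_through C Ts I Y X"
proof -
  have "{a \<cdot>\<^bsub>opcat C\<^esub> b | i a b. i \<in> I \<and> a \<in> Hom (opcat C) (Ts i) Y \<and> b \<in> Hom (opcat C) X (Ts i)} =
    {a \<cdot> b | i a b. i \<in> I \<and> a \<in> Hom C (Ts i) X \<and> b \<in> Hom C Y (Ts i)}"
    by auto
  then show ?thesis unfolding factor_through_def by simp
qed

lemma in_add_op: "in_add (opcat C) Ts I X = in_add C Ts I X"
  by (simp add: in_add_def factor_through_op)

lemma factor_through_cmp_right:
  assumes "z \<in> factor_through C Ts I Y Z" "h \<in> Hom C X Y"
  shows "z \<cdot> h \<in> factor_through C Ts I X Z"
  using linear_category.factor_through_cmp_left[OF op_linear_category, of z Ts I Z Y h X] assms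
  by (simp add: factor_through_op)

lemma factor_through_mono: "I \<subseteq> J \<Longrightarrow> factor_through C Ts I X Y \<subseteq> factor_through C Ts J X Y"
  by (rule factor_through_least[OF factor_through_subspace]) (rule factor_throughI, auto)

lemma in_add_mono: "in_add C Ts I X \<Longrightarrow> I \<subseteq> J \<Longrightarrow> in_add C Ts J X"
  unfolding in_add_def using factor_through_mono by blast

lemma factor_through_cong: "(\<And>i. i \<in> I \<Longrightarrow> Ts i = Ts' i) \<Longrightarrow> factor_through C Ts I X Y = factor_through C Ts' I X Y"
  by (rule subset_antisym; rule factor_through_least[OF factor_through_subspace]; rule factor_throughI) auto

lemma in_add_cong: "(\<And>i. i \<in> I \<Longrightarrow> Ts i = Ts' i) \<Longrightarrow> in_add C Ts I X = in_add C Ts' I X"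
  unfolding in_add_def using factor_through_cong by metis

lemma in_add_self: "i \<in> I \<Longrightarrow> in_add C Ts I (Ts i)"
  unfolding in_add_def using factor_throughI[of i I "idm C (Ts i)" Ts "Ts i" "idm C (Ts i)" "Ts i"]
    cmp_idm_left[OF idm_in_Hom, of "Ts i"] by simp

lemma in_add_zero_object: "zero_object C Z \<Longrightarrow> in_add C Ts I Z"
  unfolding in_add_def using zero_object_idm subspace_0[OF factor_through_subspace] by metis

lemma in_add_retract:
  assumes "in_add C Ts I X" "r \<in> Hom C X Y" "s \<in> Hom C Y X" "r \<cdot> s = idm C Y"
  shows "in_add C Ts I Y"
proof -
  have "r \<cdot> (idm C X \<cdot> s) \<in> factor_through C Ts I Y Y"
    using assms(1) unfolding in_add_def
    by (intro factor_through_cmp_left[OF _ assms(2)] factor_through_cmp_right[OF _ assms(3)])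
  then show ?thesis unfolding in_add_def using assms(4) cmp_idm_left[OF assms(3)] by simp
qed

lemma in_add_biproduct_right: "in_add C Ts I P \<Longrightarrow> is_biproduct C X Y P \<Longrightarrow> in_add C Ts I Y"
  using in_add_retract is_biproductE by metis

lemma in_add_biproduct_left: "in_add C Ts I P \<Longrightarrow> is_biproduct C X Y P \<Longrightarrow> in_add C Ts I X"
  using in_add_biproduct_right is_biproduct_sym by blast

lemma in_add_biproduct:
  assumes "in_add C Ts I X" "in_add C Ts I Y" "is_biproduct C X Y P"
  shows "in_add C Ts I P"
proof -
  obtain i j p q where ij: "i \<in> Hom C X P" "j \<in> Hom C Y P" "p \<in> Hom C P X" "q \<in> Hom C P Y"
    "i \<cdot> p + j \<cdot> q = idm C P"
    using assms(3) by (rule is_biproductE)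
  have "i \<cdot> (idm C X \<cdot> p) + j \<cdot> (idm C Y \<cdot> q) \<in> factor_through C Ts I P P"
    using assms(1,2) ij unfolding in_add_def
    by (intro subspace_add[OF factor_through_subspace] factor_through_cmp_left factor_through_cmp_right) auto
  then show ?thesis
    unfolding in_add_def using ij(5) cmp_idm_left[OF ij(3)] cmp_idm_left[OF ij(4)] by simp
qed

text \<open>As the identity of \<open>X\<close> is a combination of composites
  \<open>a \<cdot> b\<close>, every linear condition on \<open>g\<close> can be checked on its
  components. Vanishing, being radical and factoring through a given morphism are all instances, for
  different \<open>S\<close>.\<close>

lemma in_add_component_left:
  assumes X: "in_add C Ts I X" and g: "g \<in> Hom C X Y" and S: "subspace S"
    and comp: "\<And>i a b. \<lbrakk>i \<in> I; a \<in> Hom C (Ts i) X; b \<in> Hom C X (Ts i)\<rbrakk> \<Longrightarrow> (g \<cdot> a) \<cdot> b \<in> S"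
  shows "g \<in> S"
proof -
  have "factor_through C Ts I X X \<subseteq> {z \<in> Hom C X X. g \<cdot> z \<in> S}"
  proof (rule factor_through_least[OF subspace_preimage_left[OF S g]])
    fix i a b assume i: "i \<in> I" and a: "a \<in> Hom C (Ts i) X" and b: "b \<in> Hom C X (Ts i)"
    show "a \<cdot> b \<in> {z \<in> Hom C X X. g \<cdot> z \<in> S}"
      using comp[OF i a b] cmp_assoc[OF b a g] cmp_in_Hom[OF b a] by simp
  qed
  then show ?thesis using X cmp_idm_right[OF g] unfolding in_add_def by auto
qed

lemma in_add_component_right:
  assumes X: "in_add C Ts I X" and g: "g \<in> Hom C Y X" and S: "subspace S"
    and comp: "\<And>i a b. \<lbrakk>i \<in> I; a \<in> Hom C (Ts i) X; b \<in> Hom C X (Ts i)\<rbrakk> \<Longrightarrow> a \<cdot> (b \<cdot> g) \<in> S"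
  shows "g \<in> S"
proof (rule linear_category.in_add_component_left[OF op_linear_category, of Ts I X g Y S])
  show "in_add (opcat C) Ts I X" using X by (simp add: in_add_op)
  show "g \<in> Hom (opcat C) X Y" using g by simp
  show "module.subspace (scl (opcat C)) S" using S by simp
  fix i a b assume "i \<in> I" "a \<in> Hom (opcat C) (Ts i) X" "b \<in> Hom (opcat C) X (Ts i)"
  then show "(g \<cdot>\<^bsub>opcat C\<^esub> a) \<cdot>\<^bsub>opcat C\<^esub> b \<in> S" using comp[of i b a] by simp
qed

lemma in_add_zero_left:
  assumes "in_add C Ts I X" "g \<in> Hom C X Y" "\<And>i a. \<lbrakk>i \<in> I; a \<in> Hom C (Ts i) X\<rbrakk> \<Longrightarrow> g \<cdot> a = 0"
  shows "g = 0"
  using in_add_component_left[OF assms(1,2) subspace_single_0] assms(3) by auto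

lemma in_add_Hom_zero_left:
  assumes "in_add C Ts I X" "\<And>i. i \<in> I \<Longrightarrow> Hom C (Ts i) Y = {0}"
  shows "Hom C X Y = {0}"
proof -
  have "g = 0" if "g \<in> Hom C X Y" for g
    using in_add_zero_left[OF assms(1) that] cmp_in_Hom[OF _ that] assms(2) by blast
  then show ?thesis by auto
qed

lemma in_add_rad_left:
  assumes "in_add C Ts I X" "g \<in> Hom C X Y" "\<And>i a. \<lbrakk>i \<in> I; a \<in> Hom C (Ts i) X\<rbrakk> \<Longrightarrow> g \<cdot> a \<in> rad C (Ts i) Y"
  shows "g \<in> rad C X Y"
  using in_add_component_left[OF assms(1,2) rad_subspace] assms(3) rad_cmp_right by blast

lemma in_add_rad_right:
  assumes "in_add C Ts I X" "g \<in> Hom C Y X" "\<And>i b. \<lbrakk>i \<in> I; b \<in> Hom C X (Ts i)\<rbrakk> \<Longrightarrow> b \<cdot> g \<in> rad C Y (Ts i)"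
  shows "g \<in> rad C Y X"
  using in_add_component_right[OF assms(1,2) rad_subspace] assms(3) rad_cmp_left by blast

lemma subspace_factors_left:
  assumes "y \<in> Hom C E Y"
  shows "subspace {h \<in> Hom C X Y. \<exists>h'\<in>Hom C X E. h = y \<cdot> h'}"
proof (rule subspaceI)
  show "0 \<in> {h \<in> Hom C X Y. \<exists>h'\<in>Hom C X E. h = y \<cdot> h'}"
    using cmp_zero_right[OF assms] by (auto intro!: bexI[of _ 0])
next
  fix u v assume "u \<in> {h \<in> Hom C X Y. \<exists>h'\<in>Hom C X E. h = y \<cdot> h'}"
    "v \<in> {h \<in> Hom C X Y. \<exists>h'\<in>Hom C X E. h = y \<cdot> h'}"
  then obtain u' v' where uv: "u \<in> Hom C X Y" "v \<in> Hom C X Y" "u' \<in> Hom C X E" "u = y \<cdot> u'"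
    "v' \<in> Hom C X E" "v = y \<cdot> v'" by blast
  then have "u + v = y \<cdot> (u' + v')" using cmp_add_right[OF uv(3,5) assms] by simp
  then show "u + v \<in> {h \<in> Hom C X Y. \<exists>h'\<in>Hom C X E. h = y \<cdot> h'}"
    using Hom_add[OF uv(1,2)] Hom_add[OF uv(3,5)] by blast
next
  fix c u assume "u \<in> {h \<in> Hom C X Y. \<exists>h'\<in>Hom C X E. h = y \<cdot> h'}"
  then obtain u' where u: "u \<in> Hom C X Y" "u' \<in> Hom C X E" "u = y \<cdot> u'" by blast
  then have "scl C c u = y \<cdot> scl C c u'" using cmp_scl_right[OF u(2) assms] by simp
  then show "scl C c u \<in> {h \<in> Hom C X Y. \<exists>h'\<in>Hom C X E. h = y \<cdot> h'}"
    using Hom_scl[OF u(1)] Hom_scl[OF u(2)] by blast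
qed

lemma in_add_factors:
  assumes X: "in_add C Ts I X" and g: "g \<in> Hom C X Y" and y: "y \<in> Hom C E Y"
    and comp: "\<And>i a. \<lbrakk>i \<in> I; a \<in> Hom C (Ts i) X\<rbrakk> \<Longrightarrow> \<exists>h\<in>Hom C (Ts i) E. g \<cdot> a = y \<cdot> h"
  shows "\<exists>h\<in>Hom C X E. g = y \<cdot> h"
proof -
  have "g \<in> {h \<in> Hom C X Y. \<exists>h'\<in>Hom C X E. h = y \<cdot> h'}"
  proof (rule in_add_component_left[OF X g subspace_factors_left[OF y]])
    fix i a b assume i: "i \<in> I" and a: "a \<in> Hom C (Ts i) X" and b: "b \<in> Hom C X (Ts i)"
    obtain h where h: "h \<in> Hom C (Ts i) E" "g \<cdot> a = y \<cdot> h" using comp[OF i a] by blast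
    have "(g \<cdot> a) \<cdot> b = y \<cdot> (h \<cdot> b)" using h cmp_assoc[OF b h(1) y] by simp
    then show "(g \<cdot> a) \<cdot> b \<in> {h \<in> Hom C X Y. \<exists>h'\<in>Hom C X E. h = y \<cdot> h'}"
      using cmp_in_Hom[OF b h(1)] cmp_in_Hom[OF b cmp_in_Hom[OF a g]] by auto
  qed
  then show ?thesis by blast
qed

lemma rad_into_biproduct:
  assumes "f \<in> Hom C A P" "p \<cdot> f \<in> rad C A X" "q \<cdot> f \<in> rad C A Y"
    "i \<in> Hom C X P" "j \<in> Hom C Y P" "p \<in> Hom C P X" "q \<in> Hom C P Y" "i \<cdot> p + j \<cdot> q = idm C P"
  shows "f \<in> rad C A P"
proof -
  have "f = (i \<cdot> p + j \<cdot> q) \<cdot> f" using assms cmp_idm_left by metis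
  also have "\<dots> = i \<cdot> (p \<cdot> f) + j \<cdot> (q \<cdot> f)"
    using cmp_add_left[OF assms(1) cmp_in_Hom[OF assms(6,4)] cmp_in_Hom[OF assms(7,5)]]
      cmp_assoc[OF assms(1,6,4)] cmp_assoc[OF assms(1,7,5)] by simp
  finally show ?thesis using rad_add rad_cmp_left assms(2-5) by metis
qed

end

context krull_schmidt_category
begin

section \<open>Multiplicities as dimensions of Hom modulo radical\<close>

lemma hdim_Hom_eq: "hdim C (Hom C Y X) = hdim C (rad C Y X) + rmult C Y X"
proof -
  obtain B where "finite B" "Hom C Y X = span B" using KS_finite by blast
  then have "dim (rad C Y X) \<le> dim (Hom C Y X)"
    using rad_Hom by (intro fin_dim_mono[of _ _ B]) auto
  then show ?thesis by (simp add: rmult_def hdim_dim)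
qed

lemma hdim_quotient_cmp:
  assumes "subspace V" "V \<subseteq> Hom C A P" and h: "h \<in> Hom C P X"
    and "subspace W" "W \<subseteq> Hom C A X" and "subspace W'" "W' \<subseteq> W"
    and "\<And>v. v \<in> V \<Longrightarrow> h \<cdot> v \<in> W" and "\<And>w. w \<in> W \<Longrightarrow> \<exists>v\<in>V. w - h \<cdot> v \<in> W'"
  shows "hdim C V + hdim C W' = hdim C {v \<in> V. h \<cdot> v \<in> W'} + hdim C W"
proof -
  obtain B where B: "finite B" "Hom C A P = span B" using KS_finite by blast
  obtain B1 where B1: "finite B1" "Hom C A X = span B1" using KS_finite by blast
  have "V \<subseteq> span B" "W \<subseteq> span B1" using assms(2,5) B B1 by auto
  moreover have "h \<cdot> (x + y) = h \<cdot> x + h \<cdot> y" if "x \<in> V" "y \<in> V" for x y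
    using that assms(2) by (intro cmp_add_right[OF _ _ h]) auto
  moreover have "h \<cdot> scl C c x = scl C c (h \<cdot> x)" if "x \<in> V" for c x
    using that assms(2) by (intro cmp_scl_right[OF _ h]) auto
  ultimately show ?thesis unfolding hdim_dim
    using dim_quotient_iso[OF assms(1) _ B(1) assms(4) _ B1(1) assms(6,7), of "\<lambda>v. h \<cdot> v"] assms(8,9)
    by blast
qed

lemma rmult_rad: "Hom C Y X \<subseteq> rad C Y X \<Longrightarrow> rmult C Y X = 0"
  unfolding rmult_def using rad_Hom by (metis diff_self_eq_0 subsetI subset_antisym)

lemma rmult_0_rad: "rmult C Y X = 0 \<Longrightarrow> Hom C Y X = rad C Y X"
proof -
  assume 0: "rmult C Y X = 0"
  obtain B where B: "finite B" "Hom C Y X = span B" using KS_finite by blast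
  have "rad C Y X = Hom C Y X"
  proof (rule fin_dim_eq_imp_eq[OF _ rad_subspace _ B(1)])
    show "rad C Y X \<subseteq> Hom C Y X" using rad_Hom by blast
    show "Hom C Y X \<subseteq> span B" using B by simp
    show "dim (Hom C Y X) \<le> dim (rad C Y X)" using hdim_Hom_eq[of Y X] 0 by (simp add: hdim_dim)
  qed
  then show ?thesis by simp
qed

lemma rmult_zero_object: "zero_object C Z \<Longrightarrow> rmult C Y Z = 0"
  by (rule rmult_rad) (simp add: zero_object_def)

text \<open>The radical condition is imposed first on the component in \<open>X\<close>, then on the
  one in \<open>Y\<close>. Each step lowers the dimension by one multiplicity, and what satisfies
  both is \<open>rad C A P\<close>.\<close>

lemma rmult_biproduct:
  assumes "is_biproduct C X Y P"
  shows "rmult C A P = rmult C A X + rmult C A Y"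
proof -
  obtain i j p q where ij: "i \<in> Hom C X P" "j \<in> Hom C Y P" "p \<in> Hom C P X" "q \<in> Hom C P Y"
    "p \<cdot> i = idm C X" "q \<cdot> j = idm C Y" "p \<cdot> j = 0" "q \<cdot> i = 0" "i \<cdot> p + j \<cdot> q = idm C P"
    using assms by (rule is_biproductE)
  let ?V = "{f \<in> Hom C A P. p \<cdot> f \<in> rad C A X}"
  have sub: "rad C A X \<subseteq> Hom C A X" "rad C A Y \<subseteq> Hom C A Y" using rad_Hom by blast+
  have 1: "hdim C (Hom C A P) + hdim C (rad C A X) = hdim C ?V + hdim C (Hom C A X)"
  proof (rule hdim_quotient_cmp[OF Hom_subspace subset_refl ij(3) Hom_subspace subset_refl rad_subspace sub(1)])
    fix w assume w: "w \<in> Hom C A X"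
    show "\<exists>v\<in>Hom C A P. w - p \<cdot> v \<in> rad C A X"
      using cmp_assoc[OF w ij(1,3)] ij(5) cmp_idm_left[OF w] cmp_in_Hom[OF w ij(1)]
      by (intro bexI[of _ "i \<cdot> w"]) simp_all
  qed (rule cmp_in_Hom[OF _ ij(3)])
  have sV: "subspace ?V" by (rule subspace_preimage_left[OF rad_subspace ij(3)])
  have eq: "{f \<in> ?V. q \<cdot> f \<in> rad C A Y} = rad C A P"
    using rad_into_biproduct[OF _ _ _ ij(1-4,9)] rad_cmp_left[OF _ ij(3)] rad_cmp_left[OF _ ij(4)] rad_Hom
    by blast
  have 2: "hdim C ?V + hdim C (rad C A Y) = hdim C {f \<in> ?V. q \<cdot> f \<in> rad C A Y} + hdim C (Hom C A Y)"
  proof (rule hdim_quotient_cmp[OF sV _ ij(4) Hom_subspace subset_refl rad_subspace sub(2)])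
    fix w assume w: "w \<in> Hom C A Y"
    show "\<exists>v\<in>?V. w - q \<cdot> v \<in> rad C A Y"
      using cmp_assoc[OF w ij(2,4)] ij(6) cmp_idm_left[OF w] cmp_in_Hom[OF w ij(2)]
        cmp_assoc[OF w ij(2,3)] ij(7) cmp_zero_left[OF w]
      by (intro bexI[of _ "j \<cdot> w"]) simp_all
  qed (use cmp_in_Hom[OF _ ij(4)] in auto)
  show ?thesis
    using 1 2 eq hdim_Hom_eq[of A P] hdim_Hom_eq[of A X] hdim_Hom_eq[of A Y] by simp
qed

lemma rmult_biproduct_left:
  assumes "is_biproduct C X Y P"
  shows "rmult C P A = rmult C X A + rmult C Y A"
  using krull_schmidt_category.rmult_biproduct[OF op_krull_schmidt, of X Y P A] assms
  by (simp add: rmult_op is_biproduct_op)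

lemma rmult_iso: "isomorphic C X Y \<Longrightarrow> rmult C A X = rmult C A Y"
  using KS_zero is_biproduct_iso_zero rmult_biproduct rmult_zero_object by (metis add.right_neutral)

text \<open>Here the ground field must be algebraically closed: endomorphisms modulo radical are the
  scalars.\<close>

lemma rmult_self: assumes Y: "indecomposable C Y" shows "rmult C Y Y = 1"
proof -
  obtain B where B: "finite B" "Hom C Y Y = span B" using KS_finite by blast
  have "dim (Hom C Y Y) = dim (rad C Y Y) + 1"
    by (rule dim_insert_hyperplane[OF Hom_subspace _ B(1) rad_subspace _ idm_in_Hom
          indecomposable_idm_not_rad[OF Y] end_scalar_plus_rad[OF Y]])
      (use B rad_Hom in auto)
  then show ?thesis by (simp add: rmult_def hdim_dim)
qed

lemma rmult_pos_biproduct: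
  assumes Y: "indecomposable C Y" and "rmult C Y X > 0"
  shows "\<exists>X'. is_biproduct C Y X' X"
proof -
  obtain f where f: "f \<in> Hom C Y X" "f \<notin> rad C Y X" using rmult_rad assms(2) by (metis less_nat_zero_code subsetI)
  then obtain g where g: "g \<in> Hom C X Y" "g \<cdot> f = idm C Y" using not_rad_split[OF Y] by metis
  then show ?thesis using retract_biproduct[OF f(1) g(1)] is_iso_idm by simp
qed

text \<open>Needed because duality exchanges the two arguments. Copies of \<open>Y\<close> are split
  off from \<open>X\<close> one at a time; when none is left, a non-radical map
  \<open>X \<rightarrow> Y\<close> would have a right inverse and thus provide one.\<close>

lemma rmult_commute:
  assumes Y: "indecomposable C Y"
  shows "rmult C X Y = rmult C Y X"
proof (induction "rmult C Y X" arbitrary: X)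
  case 0
  have "g \<in> rad C X Y" if g: "g \<in> Hom C X Y" for g
  proof (rule ccontr)
    assume n: "g \<notin> rad C X Y"
    have "indecomposable (opcat C) Y" using Y by (simp add: indecomposable_op)
    moreover have "g \<in> Hom (opcat C) Y X" "g \<notin> rad (opcat C) Y X" using g n by (simp_all add: rad_op)
    ultimately obtain h where "h \<in> Hom (opcat C) X Y" "h \<cdot>\<^bsub>opcat C\<^esub> g = idm (opcat C) Y"
      by (rule krull_schmidt_category.not_rad_split[OF op_krull_schmidt])
    then have h: "h \<in> Hom C Y X" "g \<cdot> h = idm C Y" by simp_all
    have "h \<in> rad C Y X" using h(1) rmult_0_rad[of Y X] 0 by simp
    then show False using rad_cmp_left[OF _ g] h(2) indecomposable_idm_not_rad[OF Y] by metis
  qed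
  then show ?case using rmult_rad[of X Y] 0 by auto
next
  case (Suc n)
  obtain X' where X': "is_biproduct C Y X' X" using rmult_pos_biproduct[OF Y, of X] Suc.hyps(2) by auto
  have "rmult C X' Y = rmult C Y X'"
    using Suc.hyps(1)[of X'] Suc.hyps(2) rmult_biproduct[OF X', of Y] rmult_self[OF Y] by simp
  then show ?case using rmult_biproduct[OF X', of Y] rmult_biproduct_left[OF X', of Y] by simp
qed

lemma rmult_nonisomorphic:
  "\<lbrakk>indecomposable C X; indecomposable C Y; \<not> isomorphic C X Y\<rbrakk> \<Longrightarrow> rmult C X Y = 0"
  using nonisomorphic_Hom_rad rmult_rad by blast

text \<open>If all maps from \<open>Ts j\<close> to \<open>F\<close> are radical, the identity of
  \<open>F\<close> is \<open>w + r\<close> with \<open>r\<close> radical and \<open>w\<close>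
  factoring through the other objects; then \<open>w\<close> is invertible.\<close>

lemma in_add_drop:
  assumes F: "in_add C Ts I F" and j: "Hom C (Ts j) F \<subseteq> rad C (Ts j) F"
  shows "in_add C Ts (I - {j}) F"
proof -
  let ?S = "{x + y | x y. x \<in> factor_through C Ts (I - {j}) F F \<and> y \<in> rad C F F}"
  have "factor_through C Ts I F F \<subseteq> ?S"
  proof (rule factor_through_least)
    show "subspace ?S" using subspace_sums[OF factor_through_subspace rad_subspace] .
    fix i a b assume i: "i \<in> I" and a: "a \<in> Hom C (Ts i) F" and b: "b \<in> Hom C F (Ts i)"
    show "a \<cdot> b \<in> ?S"
    proof (cases "i = j")
      case True
      then have "a \<cdot> b \<in> rad C F F" using a b j rad_cmp_right by blast
      then show ?thesis using subspace_0[OF factor_through_subspace] by (metis (mono_tags, lifting) CollectI add_0)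
    next
      case False
      then have "a \<cdot> b \<in> factor_through C Ts (I - {j}) F F" using i a b by (intro factor_throughI) auto
      then show ?thesis using rad_zero by (metis (mono_tags, lifting) CollectI add.right_neutral)
    qed
  qed
  then obtain w r where wr: "idm C F = w + r" "w \<in> factor_through C Ts (I - {j}) F F" "r \<in> rad C F F"
    using F unfolding in_add_def by blast
  have "is_iso C F F (idm C F - idm C F \<cdot> r)" using rad_iso[OF wr(3) idm_in_Hom] .
  then have "is_iso C F F w" using wr(1) cmp_idm_left[OF rad_Hom[OF wr(3)]] by simp
  then obtain z where "z \<in> Hom C F F" "z \<cdot> w = idm C F" using is_isoE by metis
  then show ?thesis unfolding in_add_def using factor_through_cmp_left[OF wr(2)] by metis
qed

lemma in_add_nonzero_rmult:
  assumes X: "in_add C Ts I X" and "\<not> zero_object C X"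
  shows "\<exists>i\<in>I. rmult C (Ts i) X > 0"
proof (rule ccontr)
  assume none: "\<not> (\<exists>i\<in>I. rmult C (Ts i) X > 0)"
  have "idm C X \<in> rad C X X"
  proof (rule in_add_rad_left[OF X idm_in_Hom])
    fix i a assume "i \<in> I" "a \<in> Hom C (Ts i) X"
    then have "a \<in> rad C (Ts i) X" using none rmult_0_rad[of "Ts i" X] by auto
    then show "idm C X \<cdot> a \<in> rad C (Ts i) X" by (rule rad_cmp_left) simp
  qed
  then show False using rad_idm_zero_object assms(2) by blast
qed

text \<open>Takes the place of a decomposition into indecomposables: the total multiplicity drops
  with each summand that is split off.\<close>

lemma in_add_induct:
  assumes X: "in_add C Ts I X" and fin: "finite I" and ind: "\<And>i. i \<in> I \<Longrightarrow> indecomposable C (Ts i)"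
    and zero: "\<And>Z. zero_object C Z \<Longrightarrow> P Z"
    and step: "\<And>i X' X. \<lbrakk>i \<in> I; in_add C Ts I X'; P X'; is_biproduct C (Ts i) X' X\<rbrakk> \<Longrightarrow> P X"
  shows "P X"
  using X
proof (induction "\<Sum>i\<in>I. rmult C (Ts i) X" arbitrary: X rule: less_induct)
  case less
  show ?case
  proof (cases "zero_object C X")
    case False
    then obtain i where i: "i \<in> I" "rmult C (Ts i) X > 0"
      using in_add_nonzero_rmult[OF less.prems] by blast
    obtain X' where X': "is_biproduct C (Ts i) X' X" using rmult_pos_biproduct[OF ind] i by blast
    have le: "rmult C (Ts l) X' \<le> rmult C (Ts l) X" for l using rmult_biproduct[OF X'] by simp
    have lt: "rmult C (Ts i) X' < rmult C (Ts i) X"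
      using rmult_biproduct[OF X', of "Ts i"] rmult_self[OF ind[OF i(1)]] by simp
    have "(\<Sum>i\<in>I. rmult C (Ts i) X') < (\<Sum>i\<in>I. rmult C (Ts i) X)"
      using i(1) le lt by (intro sum_strict_mono_ex1 fin) auto
    moreover have "in_add C Ts I X'" using in_add_biproduct_right[OF less.prems X'] .
    ultimately show ?thesis using step[OF i(1) _ _ X'] less.hyps by blast
  qed (rule zero)
qed

text \<open>Each generator \<open>a b\<close> of \<open>factor_through\<close> costs one further copy of \<open>T\<close>.\<close>

lemma in_add_retract_power:
  assumes T: "is_dsum C I Ts T" and X: "in_add C Ts I X"
  obtains m P u v where "is_dsum C {..<m} (\<lambda>_. T) P" "v \<in> Hom C X P" "u \<in> Hom C P X" "u \<cdot> v = idm C X"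
proof -
  obtain \<iota> \<pi> where ip: "\<And>i. i \<in> I \<Longrightarrow> \<iota> i \<in> Hom C (Ts i) T" "\<And>i. i \<in> I \<Longrightarrow> \<pi> i \<in> Hom C T (Ts i)"
    "\<And>i. i \<in> I \<Longrightarrow> \<pi> i \<cdot> \<iota> i = idm C (Ts i)"
    using T unfolding is_dsum_def by metis
  let ?Q = "\<lambda>z. \<exists>m P u v. is_dsum C {..<m::nat} (\<lambda>_. T) P \<and> v \<in> Hom C X P \<and> u \<in> Hom C P X \<and> u \<cdot> v = z"
  have "?Q (idm C X)"
  proof (rule span_induct_alt[where h = ?Q])
    show "idm C X \<in> span {a \<cdot> b | i a b. i \<in> I \<and> a \<in> Hom C (Ts i) X \<and> b \<in> Hom C X (Ts i)}"
      using X unfolding in_add_def factor_through_def .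
    obtain Z where Z: "zero_object C Z" using KS_zero by blast
    have "is_dsum C {..<0} (\<lambda>_. T) Z" unfolding is_dsum_def using zero_object_idm[OF Z] by simp
    then show "?Q 0" using cmp_zero_left[OF zero_in_Hom] by (metis zero_in_Hom)
  next
    fix c x y assume x: "x \<in> {a \<cdot> b | i a b. i \<in> I \<and> a \<in> Hom C (Ts i) X \<and> b \<in> Hom C X (Ts i)}" and y: "?Q y"
    obtain i a b where iab: "x = a \<cdot> b" "i \<in> I" "a \<in> Hom C (Ts i) X" "b \<in> Hom C X (Ts i)" using x by blast
    obtain m P u v where P: "is_dsum C {..<m::nat} (\<lambda>_. T) P" "v \<in> Hom C X P" "u \<in> Hom C P X" "u \<cdot> v = y"
      using y by blast
    obtain j q where jq0: "\<forall>l\<in>{..<m}. j l \<in> Hom C T P \<and> q l \<in> Hom C P T"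
      "\<forall>l\<in>{..<m}. \<forall>l'\<in>{..<m}. q l \<cdot> j l' = (if l = l' then idm C T else 0)"
      "(\<Sum>l<m. j l \<cdot> q l) = idm C P"
      using P(1) unfolding is_dsum_def by blast
    have jq: "\<And>l. l < m \<Longrightarrow> j l \<in> Hom C T P" "\<And>l. l < m \<Longrightarrow> q l \<in> Hom C P T"
      "\<And>l l'. l < m \<Longrightarrow> l' < m \<Longrightarrow> q l \<cdot> j l' = (if l = l' then idm C T else 0)"
      "(\<Sum>l<m. j l \<cdot> q l) = idm C P"
      using jq0 by simp_all
    obtain P' where "is_biproduct C P T P'" using KS_biproduct by blast
    then obtain i1 i2 p1 p2 where b': "i1 \<in> Hom C P P'" "i2 \<in> Hom C T P'" "p1 \<in> Hom C P' P" "p2 \<in> Hom C P' T"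
      "p1 \<cdot> i1 = idm C P" "p2 \<cdot> i2 = idm C T" "p1 \<cdot> i2 = 0" "p2 \<cdot> i1 = 0" "i1 \<cdot> p1 + i2 \<cdot> p2 = idm C P'"
      by (rule is_biproductE)
    \<comment> \<open>The new copy of \<open>T\<close> gets the index \<open>m\<close>; the old ones
      keep theirs.\<close>
    let ?j = "\<lambda>l. if l < m then i1 \<cdot> j l else i2" and ?q = "\<lambda>l. if l < m then q l \<cdot> p1 else p2"
    have jq_in: "\<forall>l\<in>{..<Suc m}. ?j l \<in> Hom C T P' \<and> ?q l \<in> Hom C P' T"
      using cmp_in_Hom[OF jq(1) b'(1)] b'(2) cmp_in_Hom[OF b'(3) jq(2)] b'(4) by auto
    have jq_orth: "\<forall>l\<in>{..<Suc m}. \<forall>l'\<in>{..<Suc m}. ?q l \<cdot> ?j l' = (if l = l' then idm C T else 0)"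
    proof (intro ballI)
      fix l l' assume l: "l \<in> {..<Suc m}" "l' \<in> {..<Suc m}"
      have 1: "(q l \<cdot> p1) \<cdot> (i1 \<cdot> j l') = q l \<cdot> j l'" if "l < m" "l' < m"
        using cmp_assoc4[OF jq(1)[OF that(2)] b'(1,3) jq(2)[OF that(1)]] b'(5) cmp_idm_left[OF jq(1)[OF that(2)]] by simp
      have 2: "(q l \<cdot> p1) \<cdot> i2 = 0" if "l < m"
        using cmp_assoc[OF b'(2,3) jq(2)[OF that]] b'(7) cmp_zero_right[OF jq(2)[OF that]] by simp
      have 3: "p2 \<cdot> (i1 \<cdot> j l') = 0" if "l' < m"
        using cmp_assoc[OF jq(1)[OF that] b'(1,4)] b'(8) cmp_zero_left[OF jq(1)[OF that]] by simp
      show "?q l \<cdot> ?j l' = (if l = l' then idm C T else 0)"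
        using l 1 2 3 jq(3) b'(6) by auto
    qed
    have "(\<Sum>l<m. (i1 \<cdot> j l) \<cdot> (q l \<cdot> p1)) = (\<Sum>l<m. i1 \<cdot> ((j l \<cdot> q l) \<cdot> p1))"
      using cmp_assoc4[OF b'(3) jq(2) jq(1) b'(1)] by (intro sum.cong) auto
    also have "\<dots> = i1 \<cdot> (\<Sum>l<m. (j l \<cdot> q l) \<cdot> p1)"
      by (rule cmp_sum_right[where X = P', OF _ b'(1), symmetric])
        (simp add: cmp_in_Hom[OF b'(3) cmp_in_Hom[OF jq(2) jq(1)]])
    also have "(\<Sum>l<m. (j l \<cdot> q l) \<cdot> p1) = (\<Sum>l<m. j l \<cdot> q l) \<cdot> p1"
      by (rule cmp_sum_left[where Z = P, OF _ b'(3), symmetric]) (simp add: cmp_in_Hom[OF jq(2) jq(1)])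
    finally have jq_sum: "(\<Sum>l<Suc m. ?j l \<cdot> ?q l) = idm C P'"
      using jq(4) cmp_idm_left[OF b'(3)] b'(9) by simp
    have "is_dsum C {..<Suc m} (\<lambda>_. T) P'"
      unfolding is_dsum_def
      by (rule conjI[OF finite_lessThan], rule exI[of _ ?j], rule exI[of _ ?q], intro conjI)
        (fact jq_in jq_orth jq_sum)+
    moreover have h1: "\<iota> i \<cdot> b \<in> Hom C X T" and h2: "a \<cdot> \<pi> i \<in> Hom C T X"
      using cmp_in_Hom[OF iab(4) ip(1)[OF iab(2)]] cmp_in_Hom[OF ip(2)[OF iab(2)] iab(3)] .
    have s1: "i1 \<cdot> v \<in> Hom C X P'" and s2: "scl C c (i2 \<cdot> (\<iota> i \<cdot> b)) \<in> Hom C X P'"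
      and t1: "u \<cdot> p1 \<in> Hom C P' X" and t2: "(a \<cdot> \<pi> i) \<cdot> p2 \<in> Hom C P' X"
      using cmp_in_Hom[OF P(2) b'(1)] Hom_scl[OF cmp_in_Hom[OF h1 b'(2)]]
        cmp_in_Hom[OF b'(3) P(3)] cmp_in_Hom[OF b'(4) h2] .
    moreover have "(u \<cdot> p1 + (a \<cdot> \<pi> i) \<cdot> p2) \<cdot> (i1 \<cdot> v + scl C c (i2 \<cdot> (\<iota> i \<cdot> b))) = scl C c x + y"
    proof -
      have "((a \<cdot> \<pi> i) \<cdot> p2) \<cdot> (i2 \<cdot> (\<iota> i \<cdot> b)) = (a \<cdot> \<pi> i) \<cdot> (\<iota> i \<cdot> b)"
        using cmp_assoc4[OF h1 b'(2,4) h2] b'(6) cmp_idm_left[OF h1] by simp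
      also have "\<dots> = x"
        using cmp_assoc4[OF iab(4) ip(1)[OF iab(2)] ip(2)[OF iab(2)] iab(3)] ip(3)[OF iab(2)]
          cmp_idm_left[OF iab(4)] iab(1) by simp
      finally have e1: "((a \<cdot> \<pi> i) \<cdot> p2) \<cdot> (i2 \<cdot> (\<iota> i \<cdot> b)) = x" .
      have e2: "(u \<cdot> p1) \<cdot> (i1 \<cdot> v) = y"
        using cmp_assoc4[OF P(2) b'(1,3) P(3)] b'(5) cmp_idm_left[OF P(2)] P(4) by simp
      have e3: "(u \<cdot> p1) \<cdot> (i2 \<cdot> (\<iota> i \<cdot> b)) = 0"
        using cmp_assoc4[OF h1 b'(2,3) P(3)] b'(7) cmp_zero_left[OF h1] cmp_zero_right[OF P(3)] by simp
      have e4: "((a \<cdot> \<pi> i) \<cdot> p2) \<cdot> (i1 \<cdot> v) = 0"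
        using cmp_assoc4[OF P(2) b'(1,4) h2] b'(8) cmp_zero_left[OF P(2)] cmp_zero_right[OF h2] by simp
      note i2h = cmp_in_Hom[OF h1 b'(2)]
      show ?thesis
        using cmp_add_left[OF Hom_add[OF s1 s2] t1 t2] cmp_add_right[OF s1 s2 t1] cmp_add_right[OF s1 s2 t2]
          cmp_scl_right[OF i2h t1] cmp_scl_right[OF i2h t2] e1 e2 e3 e4 by (simp add: add.commute)
    qed
    ultimately show "?Q (scl C c x + y)"
      using Hom_add[OF s1 s2] Hom_add[OF t1 t2] by blast
  qed
  then show ?thesis using that by blast
qed

lemma is_dsum_in_add:
  assumes T: "is_dsum C I Ts T"
  shows "in_add C Ts I T"
proof -
  obtain \<iota> \<pi> where ip: "\<forall>i\<in>I. \<iota> i \<in> Hom C (Ts i) T \<and> \<pi> i \<in> Hom C T (Ts i)"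
    "(\<Sum>i\<in>I. \<iota> i \<cdot> \<pi> i) = idm C T"
    using T unfolding is_dsum_def by blast
  have "(\<Sum>i\<in>I. \<iota> i \<cdot> \<pi> i) \<in> factor_through C Ts I T T"
    using ip(1) by (intro subspace_sum[OF factor_through_subspace] factor_throughI) auto
  then show ?thesis unfolding in_add_def ip(2) .
qed

text \<open>Allows the definition of \<open>add T\<close> by powers of \<open>T\<close> to be
  replaced throughout by the linear test.\<close>

lemma add_closure_eq:
  assumes T: "is_dsum C I Ts T"
  shows "X \<in> add_closure C T \<longleftrightarrow> in_add C Ts I X"
proof
  assume "in_add C Ts I X"
  then obtain m P u v where P: "is_dsum C {..<m} (\<lambda>_. T) P" "v \<in> Hom C X P" "u \<in> Hom C P X" "u \<cdot> v = idm C X"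
    by (rule in_add_retract_power[OF T])
  then obtain Y where "is_biproduct C X Y P" using retract_biproduct[OF P(2,3)] is_iso_idm by auto
  then show "X \<in> add_closure C T" unfolding add_closure_def using P(1) by blast
next
  assume "X \<in> add_closure C T"
  then obtain m P Y where P: "is_dsum C {..<m::nat} (\<lambda>_. T) P" "is_biproduct C X Y P"
    unfolding add_closure_def by blast
  have T': "in_add C Ts I T" by (rule is_dsum_in_add[OF T])
  obtain j q where jq: "\<forall>l\<in>{..<m}. j l \<in> Hom C T P \<and> q l \<in> Hom C P T"
      "(\<Sum>l<m. j l \<cdot> q l) = idm C P"
    using P(1) unfolding is_dsum_def by blast
  have "(\<Sum>l<m. j l \<cdot> (idm C T \<cdot> q l)) \<in> factor_through C Ts I P P"
    using jq(1) T' unfolding in_add_def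
    by (intro subspace_sum[OF factor_through_subspace] factor_through_cmp_left factor_through_cmp_right) auto
  moreover have "(\<Sum>l<m. j l \<cdot> (idm C T \<cdot> q l)) = (\<Sum>l<m. j l \<cdot> q l)"
    using jq(1) cmp_idm_left[of _ P T] by (intro sum.cong) auto
  ultimately have "in_add C Ts I P" unfolding in_add_def jq(2) by simp
  then show "in_add C Ts I X" using in_add_biproduct_left P(2) by blast
qed

end


section \<open>Arrows of the quiver and radical approximations\<close>

context linear_category
begin

lemma subspace_image_left:
  assumes S: "subspace S" "S \<subseteq> Hom C X E" and y: "y \<in> Hom C E Y"
  shows "subspace ((\<lambda>h. y \<cdot> h) ` S)"
proof (rule subspaceI)
  show "0 \<in> (\<lambda>h. y \<cdot> h) ` S" using cmp_zero_right[OF y] subspace_0[OF S(1)] by (metis image_eqI)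
next
  fix u v assume "u \<in> (\<lambda>h. y \<cdot> h) ` S" "v \<in> (\<lambda>h. y \<cdot> h) ` S"
  then obtain u' v' where uv: "u' \<in> S" "v' \<in> S" "u = y \<cdot> u'" "v = y \<cdot> v'" by blast
  have "u' \<in> Hom C X E" "v' \<in> Hom C X E" using uv S(2) by blast+
  then have "u + v = y \<cdot> (u' + v')" using cmp_add_right[OF _ _ y, of u' X v'] uv by simp
  then show "u + v \<in> (\<lambda>h. y \<cdot> h) ` S" using subspace_add[OF S(1) uv(1,2)] by blast
next
  fix c u assume "u \<in> (\<lambda>h. y \<cdot> h) ` S"
  then obtain u' where u: "u' \<in> S" "u = y \<cdot> u'" by blast
  have "u' \<in> Hom C X E" using u S(2) by blast
  then have "scl C c u = y \<cdot> scl C c u'" using cmp_scl_right[OF _ y, of u' X c] u by simp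
  then show "scl C c u \<in> (\<lambda>h. y \<cdot> h) ` S" using subspace_scale[OF S(1) u(1)] by blast
qed

lemma is_dsum_op:
  assumes "is_dsum C I A P"
  shows "is_dsum (opcat C) I A P"
proof -
  obtain \<iota> \<pi> where ip: "finite I" "\<forall>i\<in>I. \<iota> i \<in> Hom C (A i) P \<and> \<pi> i \<in> Hom C P (A i)"
    "\<forall>i\<in>I. \<forall>j\<in>I. \<pi> i \<cdot> \<iota> j = (if i = j then idm C (A i) else 0)"
    "(\<Sum>i\<in>I. \<iota> i \<cdot> \<pi> i) = idm C P"
    using assms unfolding is_dsum_def by blast
  show ?thesis unfolding is_dsum_def opcat_simps
    by (rule conjI[OF ip(1)], rule exI[of _ \<pi>], rule exI[of _ \<iota>]) (use ip in auto)
qed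

end

context krull_schmidt_category
begin

text \<open>\<open>W\<close> is the direct sum of the sources of the listed morphisms and
  \<open>x\<close> has them as components. The pairs carry the index because one morphism may be
  listed for several sources.\<close>

lemma finite_sum_approx:
  assumes "finite G" and "\<And>i h. (i, h) \<in> G \<Longrightarrow> i \<in> S \<and> h \<in> Hom C (Ts i) Y"
  shows "\<exists>W x. in_add C Ts S W \<and> x \<in> Hom C W Y \<and> (\<forall>(i, h)\<in>G. \<exists>h'\<in>Hom C (Ts i) W. h = x \<cdot> h') \<and>
    ((\<forall>(i, h)\<in>G. h \<in> rad C (Ts i) Y) \<longrightarrow> x \<in> rad C W Y)"
  using assms
proof (induction G rule: finite_induct)
  case empty
  obtain Z where Z: "zero_object C Z" using KS_zero by blast
  show ?case by (rule exI[of _ Z], rule exI[of _ 0]) (use in_add_zero_object[OF Z] in simp)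
next
  case (insert g G)
  obtain i h where g: "g = (i, h)" by (cases g)
  have ih: "i \<in> S" "h \<in> Hom C (Ts i) Y" using insert.prems g by auto
  obtain W x where W: "in_add C Ts S W" "x \<in> Hom C W Y" "\<forall>(i, h)\<in>G. \<exists>h'\<in>Hom C (Ts i) W. h = x \<cdot> h'"
    "(\<forall>(i, h)\<in>G. h \<in> rad C (Ts i) Y) \<longrightarrow> x \<in> rad C W Y"
  proof -
    have "\<And>i h. (i, h) \<in> G \<Longrightarrow> i \<in> S \<and> h \<in> Hom C (Ts i) Y" using insert.prems by blast
    from insert.IH[OF this] show ?thesis using that by blast
  qed
  obtain P where P: "is_biproduct C W (Ts i) P" using KS_biproduct by blast
  then obtain i1 i2 p1 p2 where b: "i1 \<in> Hom C W P" "i2 \<in> Hom C (Ts i) P" "p1 \<in> Hom C P W" "p2 \<in> Hom C P (Ts i)"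
    "p1 \<cdot> i1 = idm C W" "p2 \<cdot> i2 = idm C (Ts i)" "p1 \<cdot> i2 = 0" "p2 \<cdot> i1 = 0"
    by (rule is_biproductE)
  let ?x = "x \<cdot> p1 + h \<cdot> p2"
  have xp: "x \<cdot> p1 \<in> Hom C P Y" and hp: "h \<cdot> p2 \<in> Hom C P Y"
    using cmp_in_Hom[OF b(3) W(2)] cmp_in_Hom[OF b(4) ih(2)] .
  have x: "?x \<in> Hom C P Y" using xp hp by blast
  have x1: "?x \<cdot> i1 = x"
    using cmp_add_left[OF b(1) xp hp] cmp_assoc[OF b(1,3) W(2)] cmp_assoc[OF b(1,4) ih(2)] b(5,8)
      cmp_idm_right[OF W(2)] cmp_zero_right[OF ih(2)] by simp
  have x2: "?x \<cdot> i2 = h"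
    using cmp_add_left[OF b(2) xp hp] cmp_assoc[OF b(2,3) W(2)] cmp_assoc[OF b(2,4) ih(2)] b(6,7)
      cmp_idm_right[OF ih(2)] cmp_zero_right[OF W(2)] by simp
  have "in_add C Ts S P" using in_add_biproduct[OF W(1) in_add_self[OF ih(1)] P] .
  moreover have "\<exists>h'\<in>Hom C (Ts l) P. k = ?x \<cdot> h'" if lk: "(l, k) \<in> insert g G" for l k
  proof (cases "(l, k) = g")
    case True
    then have "k = ?x \<cdot> i2" "i2 \<in> Hom C (Ts l) P" using x2 b(2) g by simp_all
    then show ?thesis by blast
  next
    case False
    then obtain h' where h': "h' \<in> Hom C (Ts l) W" "k = x \<cdot> h'" using W(3) lk by blast
    then have "k = ?x \<cdot> (i1 \<cdot> h')" using cmp_assoc[OF h'(1) b(1) x] x1 by simp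
    then show ?thesis using cmp_in_Hom[OF h'(1) b(1)] by blast
  qed
  moreover have "?x \<in> rad C P Y" if "\<forall>(i, h)\<in>insert g G. h \<in> rad C (Ts i) Y"
    using that W(4) g rad_cmp_right[OF _ b(3)] rad_cmp_right[OF _ b(4)] by (intro rad_add) auto
  ultimately show ?case using x by blast
qed

text \<open>The components of \<open>x\<close> are bases of the spaces
  \<open>rad C (Ts i) Y\<close>. The result is a right approximation of the radical, with no claim
  of minimality.\<close>

lemma radical_approx:
  assumes "finite S"
  shows "\<exists>W x. in_add C Ts S W \<and> x \<in> rad C W Y \<and> (\<forall>i\<in>S. \<forall>h\<in>rad C (Ts i) Y. \<exists>h'\<in>Hom C (Ts i) W. h = x \<cdot> h')"
proof -
  have "\<exists>B. finite B \<and> B \<subseteq> rad C (Ts i) Y \<and> rad C (Ts i) Y \<subseteq> span B" for i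
  proof -
    obtain B0 where B0: "finite B0" "Hom C (Ts i) Y = span B0" using KS_finite by blast
    have "rad C (Ts i) Y \<subseteq> span B0" using B0 rad_Hom by blast
    then obtain B where "{} \<subseteq> B" "B \<subseteq> rad C (Ts i) Y" "independent B" "rad C (Ts i) Y \<subseteq> span B" "finite B"
      "card B = dim (rad C (Ts i) Y)"
      by (rule finite_span_basis_exists[OF empty_subsetI independent_empty _ B0(1)])
    then show ?thesis by blast
  qed
  then obtain B where B: "\<And>i. finite (B i)" "\<And>i. B i \<subseteq> rad C (Ts i) Y" "\<And>i. rad C (Ts i) Y \<subseteq> span (B i)" by metis
  have "finite (Sigma S B)" using assms B(1) by blast
  moreover have "i \<in> S \<and> h \<in> Hom C (Ts i) Y" if "(i, h) \<in> Sigma S B" for i h using that B(2) rad_Hom by blast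
  ultimately obtain W x where W: "in_add C Ts S W" "x \<in> Hom C W Y"
    "\<forall>(i, h)\<in>Sigma S B. \<exists>h'\<in>Hom C (Ts i) W. h = x \<cdot> h'"
    "(\<forall>(i, h)\<in>Sigma S B. h \<in> rad C (Ts i) Y) \<longrightarrow> x \<in> rad C W Y"
    using finite_sum_approx[of "Sigma S B" S Ts Y] by blast
  have "x \<in> rad C W Y" using W(4) B(2) by blast
  moreover have "\<exists>h'\<in>Hom C (Ts i) W. h = x \<cdot> h'" if i: "i \<in> S" and h: "h \<in> rad C (Ts i) Y" for i h
  proof -
    have "span (B i) \<subseteq> (\<lambda>h. x \<cdot> h) ` Hom C (Ts i) W"
      using W(3) i by (intro span_minimal subspace_image_left[OF Hom_subspace subset_refl W(2)]) auto
    then show ?thesis using h B(3) by blast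
  qed
  ultimately show ?thesis using W(1) by blast
qed

end

text \<open>No rigidity is assumed, so the locale is stable under \<open>opcat\<close>; statements
  on arrows out of a vertex come from those on arrows into it.\<close>

locale basic_sum = krull_schmidt_category C
  for C :: "('o, 'm::ab_group_add, 'k::alg_closed_field) tricat" (structure) +
  fixes n :: nat and T :: 'o and Ts :: "nat \<Rightarrow> 'o"
  assumes dsum: "is_dsum C {1..n} Ts T"
    and ind: "i \<in> {1..n} \<Longrightarrow> indecomposable C (Ts i)"
    and noniso: "\<lbrakk>i \<in> {1..n}; j \<in> {1..n}; i \<noteq> j\<rbrakk> \<Longrightarrow> \<not> isomorphic C (Ts i) (Ts j)"
begin

lemma add_closure_T: "X \<in> add_closure C T \<longleftrightarrow> in_add C Ts {1..n} X"
  using add_closure_eq[OF dsum] .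

lemma Ts_Hom_rad: "\<lbrakk>i \<in> {1..n}; j \<in> {1..n}; i \<noteq> j; f \<in> Hom C (Ts i) (Ts j)\<rbrakk> \<Longrightarrow> f \<in> rad C (Ts i) (Ts j)"
  using nonisomorphic_Hom_rad ind noniso by blast

lemma rmult_Ts: "\<lbrakk>i \<in> {1..n}; j \<in> {1..n}\<rbrakk> \<Longrightarrow> rmult C (Ts i) (Ts j) = (if i = j then 1 else 0)"
  using rmult_self ind rmult_nonisomorphic noniso by auto

lemma avoiding_Hom_rad':
  assumes "in_add C Ts S X" "S \<subseteq> {1..n}" "j \<in> {1..n}" "j \<notin> S" "f \<in> Hom C (Ts j) X"
  shows "f \<in> rad C (Ts j) X"
proof (rule in_add_rad_right[OF assms(1,5)])
  fix i b assume "i \<in> S" "b \<in> Hom C X (Ts i)"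
  then show "b \<cdot> f \<in> rad C (Ts j) (Ts i)" using assms cmp_in_Hom[OF assms(5)] by (intro Ts_Hom_rad) auto
qed

lemma rmult_avoiding:
  "\<lbrakk>in_add C Ts S X; S \<subseteq> {1..n}; j \<in> {1..n}; j \<notin> S\<rbrakk> \<Longrightarrow> rmult C (Ts j) X = 0"
  using avoiding_Hom_rad' by (intro rmult_rad) blast

lemma avoiding_Hom_rad:
  assumes "in_add C Ts S X" "S \<subseteq> {1..n}" "j \<in> {1..n}" "j \<notin> S" "f \<in> Hom C X (Ts j)"
  shows "f \<in> rad C X (Ts j)"
proof (rule in_add_rad_left[OF assms(1,5)])
  fix i a assume "i \<in> S" "a \<in> Hom C (Ts i) X"
  then show "f \<cdot> a \<in> rad C (Ts i) (Ts j)" using assms cmp_in_Hom[OF _ assms(5)] by (intro Ts_Hom_rad) auto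
qed

lemma op_basic_sum: "basic_sum (opcat C) n T Ts"
proof -
  have "isomorphic (opcat C) X Y = isomorphic C Y X" for X Y
    unfolding isomorphic_def using is_iso_op[of X Y] by blast
  then show ?thesis
    by (intro basic_sum.intro basic_sum_axioms.intro)
      (simp_all add: op_krull_schmidt is_dsum_op[OF dsum, simplified] indecomposable_op ind noniso)
qed

lemma rad2_add_op: "rad2_add (opcat C) T X Y = rad2_add C T Y X"
proof -
  have cl: "add_closure (opcat C) T = add_closure C T"
    using basic_sum.add_closure_T[OF op_basic_sum] add_closure_T by (auto simp: in_add_op)
  have "{g \<cdot>\<^bsub>opcat C\<^esub> f | Z f g. Z \<in> add_closure (opcat C) T \<and> f \<in> rad (opcat C) X Z \<and> g \<in> rad (opcat C) Z Y}
    = {g \<cdot> f | Z f g. Z \<in> add_closure C T \<and> f \<in> rad C Y Z \<and> g \<in> rad C Z X}"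
    by (auto simp: cl rad_op)
  then show ?thesis unfolding rad2_add_def by simp
qed

lemma arrows_op: "arrows (opcat C) T Ts i j = arrows C T Ts j i"
  by (simp add: arrows_def rad2_add_op rad_op)

lemma rad2_add_least:
  assumes "subspace S"
    and "\<And>Z f g. \<lbrakk>in_add C Ts {1..n} Z; f \<in> rad C X Z; g \<in> rad C Z Y\<rbrakk> \<Longrightarrow> g \<cdot> f \<in> S"
  shows "rad2_add C T X Y \<subseteq> S"
  unfolding rad2_add_def using assms by (intro span_minimal) (auto simp: add_closure_T)

lemma rad2_addI: "\<lbrakk>in_add C Ts {1..n} Z; f \<in> rad C X Z; g \<in> rad C Z Y\<rbrakk> \<Longrightarrow> g \<cdot> f \<in> rad2_add C T X Y"
  unfolding rad2_add_def by (rule span_base) (auto simp: add_closure_T)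

lemma rad2_add_rad: "rad2_add C T X Y \<subseteq> rad C X Y"
  using rad2_add_least[OF rad_subspace] rad_cmp_right rad_Hom by metis

lemma rad2_add_subspace: "subspace (rad2_add C T X Y)"
  unfolding rad2_add_def by (rule subspace_span)

lemma hdim_rad_eq: "hdim C (rad C (Ts i) (Ts j)) = arrows C T Ts i j + hdim C (rad2_add C T (Ts i) (Ts j))"
proof -
  obtain B where B: "finite B" "Hom C (Ts i) (Ts j) = span B" using KS_finite by blast
  have "rad C (Ts i) (Ts j) \<subseteq> span B" using B rad_Hom by blast
  then show ?thesis
    using fin_dim_mono[OF rad2_add_rad _ B(1), of "Ts i" "Ts j"] by (simp add: arrows_def hdim_dim)
qed

lemma arrows_0_rad2:
  assumes "arrows C T Ts i j = 0"
  shows "rad2_add C T (Ts i) (Ts j) = rad C (Ts i) (Ts j)"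
proof -
  obtain B where B: "finite B" "Hom C (Ts i) (Ts j) = span B" using KS_finite by blast
  have "rad C (Ts i) (Ts j) \<subseteq> span B" using B rad_Hom by blast
  then show ?thesis
    using fin_dim_eq_imp_eq[OF rad2_add_rad rad2_add_subspace _ B(1)] hdim_rad_eq[of i j] assms
    by (simp add: hdim_dim)
qed

text \<open>
  The summands of \<open>E\<close> that are superfluous for the approximation \<open>u\<close> are summands of \<open>X\<close> as well.
\<close>

lemma arrows_rmult:
  assumes rj: "r \<in> {1..n}" and E: "in_add C Ts {1..n} E"
    and u: "u \<in> rad C E (Ts j)" and v: "v \<in> Hom C X E" and uv: "u \<cdot> v = 0"
    and approx: "\<And>Z h. \<lbrakk>in_add C Ts {1..n} Z; h \<in> rad C Z (Ts j)\<rbrakk> \<Longrightarrow> \<exists>h'\<in>Hom C Z E. h = u \<cdot> h'"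
    and exact: "\<And>t. \<lbrakk>t \<in> Hom C (Ts r) E; u \<cdot> t = 0\<rbrakk> \<Longrightarrow> \<exists>t'\<in>Hom C (Ts r) X. t = v \<cdot> t'"
    and ext: "\<And>s. s \<in> Hom C X (Ts r) \<Longrightarrow> \<exists>s'\<in>Hom C E (Ts r). s = s' \<cdot> v"
  shows "arrows C T Ts r j + rmult C (Ts r) X = rmult C (Ts r) E"
proof -
  let ?R = "Ts r" and ?J = "Ts j"
  let ?A = "{g \<in> Hom C ?R E. u \<cdot> g \<in> rad2_add C T ?R ?J}"
  note u' = rad_Hom[OF u]
  have sub: "rad C ?R ?J \<subseteq> Hom C ?R ?J" "rad C ?R E \<subseteq> Hom C ?R E" using rad_Hom by blast+
  \<comment> \<open>Together with \<open>S2\<close>: the square of the radical is the image under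
    \<open>u\<close> of \<open>rad C ?R E\<close>, because radical maps into \<open>?J\<close> lift
    through \<open>u\<close>.\<close>
  have S1: "rad2_add C T ?R ?J \<subseteq> (\<lambda>s. u \<cdot> s) ` rad C ?R E"
  proof (rule rad2_add_least[OF subspace_image_left[OF rad_subspace sub(2) u']])
    fix Z f g assume Z: "in_add C Ts {1..n} Z" and f: "f \<in> rad C ?R Z" and g: "g \<in> rad C Z ?J"
    obtain h where h: "h \<in> Hom C Z E" "g = u \<cdot> h" using approx[OF Z g] by blast
    have "g \<cdot> f = u \<cdot> (h \<cdot> f)" using h cmp_assoc[OF rad_Hom[OF f] h(1) u'] by simp
    then show "g \<cdot> f \<in> (\<lambda>s. u \<cdot> s) ` rad C ?R E" using rad_cmp_left[OF f h(1)] by blast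
  qed
  have S2: "u \<cdot> s \<in> rad2_add C T ?R ?J" if "s \<in> rad C ?R E" for s using rad2_addI[OF E that u] .
  \<comment> \<open>First count: the codimension of \<open>?A\<close> in \<open>Hom C ?R E\<close>
    is the number of arrows.\<close>
  have Q1: "hdim C (Hom C ?R E) + hdim C (rad2_add C T ?R ?J) = hdim C ?A + hdim C (rad C ?R ?J)"
  proof (rule hdim_quotient_cmp[OF Hom_subspace subset_refl u' rad_subspace sub(1) rad2_add_subspace rad2_add_rad])
    show "u \<cdot> g \<in> rad C ?R ?J" if "g \<in> Hom C ?R E" for g using rad_cmp_right[OF u that] .
    fix w assume "w \<in> rad C ?R ?J"
    then obtain h where "h \<in> Hom C ?R E" "w = u \<cdot> h" using approx[OF in_add_self[OF rj]] by blast
    then show "\<exists>g\<in>Hom C ?R E. w - u \<cdot> g \<in> rad2_add C T ?R ?J"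
      using subspace_0[OF rad2_add_subspace] by (intro bexI[of _ h]) simp_all
  qed
  \<comment> \<open>Composition with \<open>v\<close> also reflects the radical: by
    \<open>ext\<close> every test map \<open>X \<rightarrow> ?R\<close> extends over
    \<open>E\<close>.\<close>
  have eq: "{t \<in> Hom C ?R X. v \<cdot> t \<in> rad C ?R E} = rad C ?R X"
  proof (rule subset_antisym; rule subsetI)
    fix t assume "t \<in> {t \<in> Hom C ?R X. v \<cdot> t \<in> rad C ?R E}"
    then have t: "t \<in> Hom C ?R X" "v \<cdot> t \<in> rad C ?R E" by auto
    show "t \<in> rad C ?R X"
    proof (rule radI[OF t(1)])
      fix g assume "g \<in> Hom C X ?R"
      then obtain s where s: "s \<in> Hom C E ?R" "g = s \<cdot> v" using ext by blast
      then show "is_iso C ?R ?R (idm C ?R - g \<cdot> t)"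
        using rad_iso[OF t(2) s(1)] cmp_assoc[OF t(1) v s(1)] by simp
    qed
  next
    fix t assume "t \<in> rad C ?R X"
    then show "t \<in> {t \<in> Hom C ?R X. v \<cdot> t \<in> rad C ?R E}" using rad_Hom rad_cmp_left[OF _ v] by blast
  qed
  have sA: "subspace ?A" by (rule subspace_preimage_left[OF rad2_add_subspace u'])
  \<comment> \<open>Second count: modulo \<open>rad C ?R E\<close> all elements of \<open>?A\<close>
    come from \<open>X\<close>, so the codimension of the radical in \<open>?A\<close> is the
    multiplicity in \<open>X\<close>.\<close>
  have Q2: "hdim C (Hom C ?R X) + hdim C (rad C ?R E) = hdim C {t \<in> Hom C ?R X. v \<cdot> t \<in> rad C ?R E} + hdim C ?A"
  proof (rule hdim_quotient_cmp[OF Hom_subspace subset_refl v sA _ rad_subspace])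
    show "?A \<subseteq> Hom C ?R E" by blast
    show "rad C ?R E \<subseteq> ?A" using S2 sub(2) by blast
    show "v \<cdot> t \<in> ?A" if t: "t \<in> Hom C ?R X" for t
      using cmp_in_Hom[OF t v] cmp_assoc[OF t v u'] uv cmp_zero_left[OF t] subspace_0[OF rad2_add_subspace] by simp
    fix g assume "g \<in> ?A"
    then obtain s where s: "g \<in> Hom C ?R E" "s \<in> rad C ?R E" "u \<cdot> g = u \<cdot> s" using S1 by blast
    have "u \<cdot> (g - s) = 0" using cmp_diff_right[OF s(1) rad_Hom[OF s(2)] u'] s(3) by simp
    then obtain t where t: "t \<in> Hom C ?R X" "g - s = v \<cdot> t" using exact[of "g - s"] s(1) rad_Hom[OF s(2)] by blast
    have "g - v \<cdot> t = s" using t(2) by (simp add: diff_eq_eq algebra_simps)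
    then show "\<exists>t\<in>Hom C ?R X. g - v \<cdot> t \<in> rad C ?R E" using t(1) s(2) by (metis)
  qed
  show ?thesis
    using Q1 Q2 eq hdim_Hom_eq[of ?R E] hdim_Hom_eq[of ?R X] hdim_rad_eq[of r j] by simp
qed

text \<open>
  Nakayama's lemma in the form \<open>x = y d + x r\<close> with \<open>r\<close> radical, so that \<open>x = y d (1 - r)\<^sup>-\<^sup>1\<close>; here
  \<open>x\<close> approximates the radical maps from the \<open>Ts b\<close>, \<open>b \<in> S\<close>, and \<open>y\<close> the other ones.
\<close>

lemma radical_approx_avoiding:
  assumes S: "S \<subseteq> {1..n}" and arr: "\<And>b. b \<in> S \<Longrightarrow> arrows C T Ts b j = 0"
  obtains E y where "in_add C Ts ({1..n} - S) E" "y \<in> Hom C E (Ts j)"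
    "\<forall>i\<in>{1..n}. \<forall>h\<in>rad C (Ts i) (Ts j). \<exists>h'\<in>Hom C (Ts i) E. h = y \<cdot> h'"
proof -
  let ?J = "Ts j"
  have finS: "finite S" "finite ({1..n} - S)" using S finite_subset by auto
  obtain W x where W: "in_add C Ts S W" "x \<in> rad C W ?J"
    "\<forall>i\<in>S. \<forall>h\<in>rad C (Ts i) ?J. \<exists>h'\<in>Hom C (Ts i) W. h = x \<cdot> h'"
    using radical_approx[OF finS(1), of Ts ?J] by blast
  obtain E y where E: "in_add C Ts ({1..n} - S) E" "y \<in> rad C E ?J"
    "\<forall>i\<in>{1..n} - S. \<forall>h\<in>rad C (Ts i) ?J. \<exists>h'\<in>Hom C (Ts i) E. h = y \<cdot> h'"
    using radical_approx[OF finS(2), of Ts ?J] by blast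
  note x' = rad_Hom[OF W(2)] and y' = rad_Hom[OF E(2)]
  \<comment> \<open>The maps into \<open>?J\<close> that factor through \<open>y\<close> up to
    \<open>x\<close> composed with a radical map; this is the submodule of the Nakayama
    argument.\<close>
  define M where "M X = {a + b | a b. a \<in> (\<lambda>d. y \<cdot> d) ` Hom C X E \<and> b \<in> (\<lambda>r. x \<cdot> r) ` rad C X W}" for X
  have subM: "subspace (M X)" for X
    unfolding M_def using rad_Hom
    by (intro subspace_sums subspace_image_left[OF Hom_subspace subset_refl y']
        subspace_image_left[OF rad_subspace _ x']) auto
  have M1: "y \<cdot> d \<in> M X" if "d \<in> Hom C X E" for d X
  proof -
    have "y \<cdot> d = y \<cdot> d + x \<cdot> 0" using cmp_zero_right[OF x'] by simp
    then show ?thesis unfolding M_def using that rad_zero by blast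
  qed
  have M2: "x \<cdot> r \<in> M X" if "r \<in> rad C X W" for r X
  proof -
    have "x \<cdot> r = y \<cdot> 0 + x \<cdot> r" using cmp_zero_right[OF y'] by simp
    then show ?thesis unfolding M_def using that zero_in_Hom by blast
  qed
  have MH: "M X \<subseteq> Hom C X ?J" for X
    unfolding M_def using cmp_in_Hom[OF _ x'] cmp_in_Hom[OF _ y'] rad_Hom by (auto intro: Hom_add)
  have rad2M: "rad2_add C T X ?J \<subseteq> M X" for X
  proof (rule rad2_add_least[OF subM])
    fix Z f g assume Z: "in_add C Ts {1..n} Z" and f: "f \<in> rad C X Z" and g: "g \<in> rad C Z ?J"
    note f' = rad_Hom[OF f] and g' = rad_Hom[OF g]
    have "g \<in> {g \<in> Hom C Z ?J. g \<cdot> f \<in> M X}"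
    proof (rule in_add_component_left[OF Z g' subspace_preimage_right[OF subM f']])
      fix l a b assume l: "l \<in> {1..n}" and a: "a \<in> Hom C (Ts l) Z" and b: "b \<in> Hom C Z (Ts l)"
      have bf: "b \<cdot> f \<in> rad C X (Ts l)" using rad_cmp_left[OF f b] .
      have ga: "g \<cdot> a \<in> rad C (Ts l) ?J" using rad_cmp_right[OF g a] .
      have "((g \<cdot> a) \<cdot> b) \<cdot> f = (g \<cdot> a) \<cdot> (b \<cdot> f)" using cmp_assoc[OF f' b rad_Hom[OF ga]] by simp
      also have "\<dots> \<in> M X"
      proof (cases "l \<in> S")
        case True
        then obtain h where h: "h \<in> Hom C (Ts l) W" "g \<cdot> a = x \<cdot> h" using W(3) ga by blast
        then show ?thesis using cmp_assoc[OF rad_Hom[OF bf] h(1) x'] M2[OF rad_cmp_left[OF bf h(1)]] by simp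
      next
        case False
        then obtain h where h: "h \<in> Hom C (Ts l) E" "g \<cdot> a = y \<cdot> h" using E(3) ga l by blast
        then show ?thesis
          using cmp_assoc[OF rad_Hom[OF bf] h(1) y'] M1[OF cmp_in_Hom[OF rad_Hom[OF bf] h(1)]] by simp
      qed
      finally show "(g \<cdot> a) \<cdot> b \<in> {g \<in> Hom C Z ?J. g \<cdot> f \<in> M X}"
        using cmp_in_Hom[OF b rad_Hom[OF ga]] by simp
    qed
    then show "g \<cdot> f \<in> M X" by blast
  qed
  have "x \<in> M W"
  proof (rule in_add_component_left[OF W(1) x' subM])
    fix i a b assume i: "i \<in> S" and a: "a \<in> Hom C (Ts i) W" and b: "b \<in> Hom C W (Ts i)"
    \<comment> \<open>The absence of arrows enters here: radical maps from \<open>Ts i\<close> to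
      \<open>?J\<close> lie in the square of the radical, and the square is contained in
      \<open>M\<close>.\<close>
    have "x \<cdot> a \<in> M (Ts i)"
      using rad_cmp_right[OF W(2) a] rad2M[of "Ts i"] arrows_0_rad2[OF arr[OF i]] by blast
    then obtain d r where dr: "x \<cdot> a = y \<cdot> d + x \<cdot> r" "d \<in> Hom C (Ts i) E" "r \<in> rad C (Ts i) W"
      unfolding M_def by blast
    have "(x \<cdot> a) \<cdot> b = y \<cdot> (d \<cdot> b) + x \<cdot> (r \<cdot> b)"
      using cmp_add_left[OF b cmp_in_Hom[OF dr(2) y'] cmp_in_Hom[OF rad_Hom[OF dr(3)] x']] dr(1)
        cmp_assoc[OF b dr(2) y'] cmp_assoc[OF b rad_Hom[OF dr(3)] x'] by simp
    then show "(x \<cdot> a) \<cdot> b \<in> M W"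
      using subspace_add[OF subM M1[OF cmp_in_Hom[OF b dr(2)]] M2[OF rad_cmp_right[OF dr(3) b]]] by simp
  qed
  then obtain a b where ab: "x = a + b" "a \<in> (\<lambda>d. y \<cdot> d) ` Hom C W E" "b \<in> (\<lambda>r. x \<cdot> r) ` rad C W W"
    unfolding M_def by (elim CollectE exE conjE) (rule that)
  obtain d where d: "d \<in> Hom C W E" "a = y \<cdot> d" using ab(2) by blast
  obtain r where r: "r \<in> rad C W W" "b = x \<cdot> r" using ab(3) by blast
  have dr: "x = y \<cdot> d + x \<cdot> r" "d \<in> Hom C W E" "r \<in> rad C W W" using ab(1) d r by metis+
  have "is_iso C W W (idm C W - idm C W \<cdot> r)" using rad_iso[OF dr(3) idm_in_Hom] .
  then have "is_iso C W W (idm C W - r)" using cmp_idm_left[OF rad_Hom[OF dr(3)]] by simp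
  then obtain w where w: "w \<in> Hom C W W" "(idm C W - r) \<cdot> w = idm C W" using is_isoE by metis
  have r1: "idm C W - r \<in> Hom C W W" using rad_Hom[OF dr(3)] by blast
  have "x \<cdot> (idm C W - r) = x - x \<cdot> r"
    using cmp_diff_right[OF idm_in_Hom rad_Hom[OF dr(3)] x'] cmp_idm_right[OF x'] by simp
  also have "\<dots> = y \<cdot> d" using dr(1) by (metis add_diff_cancel_right')
  finally have "x = y \<cdot> (d \<cdot> w)"
    using cmp_assoc[OF w(1) r1 x'] w(2) cmp_idm_right[OF x'] cmp_assoc[OF w(1) dr(2) y'] by simp
  note x_eq = this
  have "\<exists>h'\<in>Hom C (Ts i) E. h = y \<cdot> h'" if i: "i \<in> {1..n}" and h: "h \<in> rad C (Ts i) ?J" for i h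
  proof (cases "i \<in> S")
    case True
    then obtain h' where h': "h' \<in> Hom C (Ts i) W" "h = x \<cdot> h'" using W(3) h by blast
    note dw = cmp_in_Hom[OF w(1) dr(2)]
    have "h = y \<cdot> ((d \<cdot> w) \<cdot> h')" using h'(2) cmp_assoc[OF h'(1) dw y'] x_eq by simp
    then show ?thesis using cmp_in_Hom[OF h'(1) dw] by blast
  next
    case False
    then show ?thesis using E(3) h i by blast
  qed
  then show ?thesis using that E(1) y' by blast
qed

text \<open>Without a loop at \<open>j\<close>, radical endomorphisms of \<open>Ts j\<close> cost
  nothing extra: they factor through the other summands as well.\<close>

lemma radical_factor:
  assumes j: "j \<in> {1..n}" and loop: "arrows C T Ts j j = 0"
  obtains E y where "in_add C Ts ({1..n} - {j}) E" "y \<in> Hom C E (Ts j)"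
    "\<forall>Z h. in_add C Ts {1..n} Z \<longrightarrow> h \<in> rad C Z (Ts j) \<longrightarrow> (\<exists>h'\<in>Hom C Z E. h = y \<cdot> h')"
proof -
  have sub: "{j} \<subseteq> {1..n}" and arr: "\<And>b. b \<in> {j} \<Longrightarrow> arrows C T Ts b j = 0" using j loop by auto
  obtain E y where E: "in_add C Ts ({1..n} - {j}) E" "y \<in> Hom C E (Ts j)"
    "\<forall>i\<in>{1..n}. \<forall>h\<in>rad C (Ts i) (Ts j). \<exists>h'\<in>Hom C (Ts i) E. h = y \<cdot> h'"
    by (rule radical_approx_avoiding[OF sub arr])
  have "\<exists>h'\<in>Hom C Z E. h = y \<cdot> h'" if Z: "in_add C Ts {1..n} Z" and h: "h \<in> rad C Z (Ts j)" for Z h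
    using E(3) rad_cmp_right[OF h] by (intro in_add_factors[OF Z rad_Hom[OF h] E(2)]) blast
  then show ?thesis using that E(1,2) by blast
qed

end


section \<open>Triangulated categories\<close>

context triangulated_category
begin

lemma suspm_Hom: "f \<in> Hom C X Y \<Longrightarrow> suspm C f \<in> Hom C (susp C X) (susp C Y)"
  using suspm_fully_faithful bij_betwE by blast

lemma suspm_inj: "\<lbrakk>suspm C f = suspm C g; f \<in> Hom C X Y; g \<in> Hom C X Y\<rbrakk> \<Longrightarrow> f = g"
  using suspm_fully_faithful[of X Y] unfolding bij_betw_def by (meson inj_onD)

lemma suspm_surj:
  assumes "g \<in> Hom C (susp C X) (susp C Y)"
  obtains f where "f \<in> Hom C X Y" "g = suspm C f"
  using suspm_fully_faithful[of X Y] assms unfolding bij_betw_def by blast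

lemma suspm_zero [simp]: "suspm C 0 = 0"
  using suspm_add[OF zero_in_Hom zero_in_Hom] by simp

lemma suspm_neg: "f \<in> Hom C X Y \<Longrightarrow> suspm C (- f) = - suspm C f"
  using suspm_add[of f X Y "- f"] Hom_neg by (simp add: add_eq_0_iff)

lemma suspm_surj_neg:
  assumes "g \<in> Hom C (susp C X) (susp C Y)"
  obtains f where "f \<in> Hom C X Y" "g = - suspm C f"
proof -
  obtain f where f: "f \<in> Hom C X Y" "g = suspm C f" using assms by (rule suspm_surj)
  have "g = - suspm C (- f)" using f suspm_neg[OF f(1)] by simp
  then show ?thesis using that Hom_neg[OF f(1)] by blast
qed

lemma zero_object_susp: "zero_object C Z \<Longrightarrow> zero_object C (susp C Z)"
  using zero_object_idm suspm_idm[of Z] by (intro zero_objectI) simp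

lemma Hom_susp_zero_iff: "Hom C (susp C X) (susp C Y) = {0} \<longleftrightarrow> Hom C X Y = {0}"
proof
  assume 0: "Hom C (susp C X) (susp C Y) = {0}"
  have "f = 0" if f: "f \<in> Hom C X Y" for f
    using suspm_inj[OF _ f zero_in_Hom] suspm_Hom[OF f] 0 by simp
  then show "Hom C X Y = {0}" by auto
next
  assume 0: "Hom C X Y = {0}"
  have "g = 0" if g: "g \<in> Hom C (susp C X) (susp C Y)" for g
    using g 0 by (elim suspm_surj) simp
  then show "Hom C (susp C X) (susp C Y) = {0}" by auto
qed

lemma triD:
  assumes "tri C X Y Z u v w"
  shows "u \<in> Hom C X Y" "v \<in> Hom C Y Z" "w \<in> Hom C Z (susp C X)"
  using tri_Hom[OF assms] by auto

lemma tri_rot: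
  assumes "tri C X Y Z u v w"
  shows "tri C Y Z (susp C X) v w (- suspm C u)"
  using assms tri_rotate[OF triD[OF assms]] by simp

lemma tri_cmp_zero:
  assumes t: "tri C X Y Z u v w"
  shows "v \<cdot> u = 0"
proof -
  obtain Z0 where Z0: "zero_object C Z0" using zero_object_exists by blast
  obtain c where "c \<in> Hom C Z0 Z" "c \<cdot> 0 = v \<cdot> u"
    using tri_morphism[OF tri_idm[OF Z0] t idm_in_Hom triD(1)[OF t]] by blast
  then show ?thesis using cmp_zero_right by metis
qed

lemma tri_cmp_zero': "tri C X Y Z u v w \<Longrightarrow> w \<cdot> v = 0"
  using tri_cmp_zero[OF tri_rot] .

lemma tri_cmp_zero'':
  assumes "tri C X Y Z u v w"
  shows "suspm C u \<cdot> w = 0"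
  using tri_cmp_zero'[OF tri_rot[OF assms]] cmp_neg_left[OF triD(3)[OF assms] suspm_Hom[OF triD(1)[OF assms]]] by simp

text \<open>The lemmas \<open>tri_ext...\<close> and \<open>tri_lift...\<close> are exactness of the
  contravariant and covariant Hom functors at the successive places of a triangle. Here the
  comparison is with \<open>Z0 \<rightarrow> W \<rightarrow> W\<close>, where \<open>Z0\<close> is a
  zero object.\<close>

lemma tri_ext1:
  assumes t: "tri C X Y Z u v w" and f: "f \<in> Hom C Y W" "f \<cdot> u = 0"
  obtains h where "h \<in> Hom C Z W" "f = h \<cdot> v"
proof -
  obtain Z0 where Z0: "zero_object C Z0" using zero_object_exists by blast
  have "tri C W W (susp C Z0) (idm C W) 0 (- suspm C 0)"
    using tri_idm[OF zero_object_susp[OF Z0], of W] by simp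
  then have t': "tri C Z0 W W 0 (idm C W) 0" by (subst tri_rotate) auto
  have "f \<cdot> u = 0 \<cdot> 0" using f(2) cmp_zero_left[OF zero_in_Hom] by simp
  then obtain c where "c \<in> Hom C Z W" "c \<cdot> v = idm C W \<cdot> f"
    using tri_morphism[OF t t' zero_in_Hom f(1)] by blast
  then show ?thesis using that cmp_idm_left[OF f(1)] by metis
qed

text \<open>Morphisms of triangles can only be completed at the third place, so both triangles are
  rotated and the resulting map is desuspended by full faithfulness.\<close>

lemma tri_lift1:
  assumes t: "tri C X Y Z u v w" and g: "g \<in> Hom C W Y" "v \<cdot> g = 0"
  obtains h where "h \<in> Hom C W X" "g = u \<cdot> h"
proof -
  obtain Z0 where Z0: "zero_object C Z0" using zero_object_exists by blast
  have t': "tri C W Z0 (susp C W) 0 0 (- suspm C (idm C W))" using tri_rot[OF tri_idm[OF Z0]] .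
  have "0 \<cdot> 0 = v \<cdot> g" using g(2) cmp_zero_left[OF zero_in_Hom] by simp
  then obtain c where c: "c \<in> Hom C (susp C W) (susp C X)" "suspm C g \<cdot> (- suspm C (idm C W)) = (- suspm C u) \<cdot> c"
    using tri_morphism[OF t' tri_rot[OF t] g(1) zero_in_Hom] by blast
  obtain h where h: "h \<in> Hom C W X" "c = suspm C h" using c(1) by (rule suspm_surj)
  note u = triD(1)[OF t]
  have "- suspm C g = - (suspm C u \<cdot> c)"
    using c cmp_neg_left[OF c(1) suspm_Hom[OF u]] cmp_neg_right[OF idm_in_Hom suspm_Hom[OF g(1)]]
      cmp_idm_right[OF suspm_Hom[OF g(1)]] by (simp add: suspm_idm)
  then have "suspm C g = suspm C (u \<cdot> h)" using suspm_cmp[OF h(1) u] h(2) by simp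
  then have "g = u \<cdot> h" using suspm_inj g(1) cmp_in_Hom[OF h(1) u] by blast
  then show ?thesis using that h(1) by blast
qed

lemma tri_ext2:
  assumes t: "tri C X Y Z u v w" and f: "f \<in> Hom C Z W" "f \<cdot> v = 0"
  obtains h where "h \<in> Hom C (susp C X) W" "f = h \<cdot> w"
  using tri_ext1[OF tri_rot[OF t] f] by blast

lemma tri_ext0:
  assumes t: "tri C X Y Z u v w" and f: "f \<in> Hom C X W" "suspm C f \<cdot> w = 0"
  obtains h where "h \<in> Hom C Y W" "f = h \<cdot> u"
proof -
  note u = triD(1)[OF t]
  obtain h where h: "h \<in> Hom C (susp C Y) (susp C W)" "suspm C f = h \<cdot> (- suspm C u)"
    using tri_ext2[OF tri_rot[OF t] suspm_Hom[OF f(1)] f(2)] by blast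
  obtain g where g: "g \<in> Hom C Y W" "h = - suspm C g" using h(1) by (rule suspm_surj_neg)
  have "suspm C f = suspm C (g \<cdot> u)"
    using h(2) g(2) cmp_neg_left[OF suspm_Hom[OF u] suspm_Hom[OF g(1)]]
      cmp_neg_right[OF suspm_Hom[OF u] h(1)] suspm_cmp[OF u g(1)] by simp
  then have "f = g \<cdot> u" using suspm_inj f(1) cmp_in_Hom[OF u g(1)] by blast
  then show ?thesis using that g(1) by blast
qed

lemma tri_lift2:
  assumes t: "tri C X Y Z u v w" and g: "g \<in> Hom C W Z" "w \<cdot> g = 0"
  obtains h where "h \<in> Hom C W Y" "g = v \<cdot> h"
  using tri_lift1[OF tri_rot[OF t] g] by blast

lemma tri_lift3:
  assumes t: "tri C X Y Z u v w" and g: "g \<in> Hom C W (susp C X)" "suspm C u \<cdot> g = 0"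
  obtains h where "h \<in> Hom C W Z" "g = w \<cdot> h"
proof -
  have "(- suspm C u) \<cdot> g = 0" using g cmp_neg_left[OF g(1) suspm_Hom[OF triD(1)[OF t]]] by simp
  then show ?thesis using tri_lift2[OF tri_rot[OF t] g(1)] that by blast
qed

lemma tri_lift4:
  assumes t: "tri C X Y Z u v w" and g: "g \<in> Hom C W (susp C Y)" "suspm C v \<cdot> g = 0"
  obtains h where "h \<in> Hom C W (susp C X)" "g = suspm C u \<cdot> h"
proof -
  note u = suspm_Hom[OF triD(1)[OF t]]
  obtain h where h: "h \<in> Hom C W (susp C X)" "g = (- suspm C u) \<cdot> h" using tri_lift3[OF tri_rot[OF t] g] by blast
  have "g = suspm C u \<cdot> (- h)" using h cmp_neg_left[OF h(1) u] cmp_neg_right[OF h(1) u] by simp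
  then show ?thesis using that Hom_neg[OF h(1)] by blast
qed

lemma tri_Hom_susp_zero:
  assumes t: "tri C X Y Z u v w" and X: "Hom C W (susp C X) = {0}" and Z: "Hom C W (susp C Z) = {0}"
  shows "Hom C W (susp C Y) = {0}"
proof -
  have "g = 0" if g: "g \<in> Hom C W (susp C Y)" for g
  proof -
    have "suspm C v \<cdot> g = 0" using cmp_in_Hom[OF g suspm_Hom[OF triD(2)[OF t]]] Z by simp
    then obtain h where h: "h \<in> Hom C W (susp C X)" "g = suspm C u \<cdot> h" using tri_lift4[OF t g] by blast
    then show "g = 0" using X cmp_zero_right[OF suspm_Hom[OF triD(1)[OF t]]] by simp
  qed
  then show ?thesis by auto
qed

section \<open>Split triangles, and triangles with a prescribed morphism\<close>

lemma split_tri_biproduct: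
  assumes t: "tri C X Y Z u v 0"
  shows "is_biproduct C X Z Y"
proof -
  note u = triD(1)[OF t] and v = triD(2)[OF t]
  have "0 \<cdot> idm C Z = 0" using cmp_zero_left[OF idm_in_Hom] .
  then obtain j where j: "j \<in> Hom C Z Y" "idm C Z = v \<cdot> j" using tri_lift2[OF t idm_in_Hom] by blast
  have "suspm C (idm C X) \<cdot> 0 = 0" using cmp_zero_right[OF idm_in_Hom] by (simp add: suspm_idm)
  then obtain p where p: "p \<in> Hom C Y X" "idm C X = p \<cdot> u" using tri_ext0[OF t idm_in_Hom] by blast
  have vu: "v \<cdot> u = 0" by (rule tri_cmp_zero[OF t])
  have pj: "p \<cdot> j \<in> Hom C Z X" and upj: "u \<cdot> (p \<cdot> j) \<in> Hom C Z Y"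
    using cmp_in_Hom[OF j(1) p(1)] cmp_in_Hom[OF cmp_in_Hom[OF j(1) p(1)] u] .
  \<comment> \<open>The section \<open>j\<close> of \<open>v\<close> is corrected so that the
    retraction \<open>p\<close> of \<open>u\<close> vanishes on it.\<close>
  let ?j = "j - u \<cdot> (p \<cdot> j)"
  have j': "?j \<in> Hom C Z Y" using j(1) upj by blast
  have vj: "v \<cdot> ?j = idm C Z"
    using cmp_diff_right[OF j(1) upj v] j(2) cmp_assoc[OF pj u v] vu cmp_zero_left[OF pj] by simp
  have pj': "p \<cdot> ?j = 0"
    using cmp_diff_right[OF j(1) upj p(1)] cmp_assoc[OF pj u p(1)] p(2) cmp_idm_left[OF pj] by simp
  have up: "u \<cdot> p \<in> Hom C Y Y" and jv: "?j \<cdot> v \<in> Hom C Y Y" using cmp_in_Hom[OF p(1) u] cmp_in_Hom[OF v j'] .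
  \<comment> \<open>The defect of the biproduct equation: \<open>v\<close> kills it, so it factors
    through \<open>u\<close>; \<open>p\<close> kills it too, so that factor is zero.\<close>
  let ?d = "idm C Y - u \<cdot> p - ?j \<cdot> v"
  have d1: "idm C Y - u \<cdot> p \<in> Hom C Y Y" using up by blast
  have d: "?d \<in> Hom C Y Y" using d1 jv by blast
  have "v \<cdot> ?d = 0"
    using cmp_diff_right[OF d1 jv v] cmp_diff_right[OF idm_in_Hom up v] cmp_idm_right[OF v]
      cmp_assoc[OF p(1) u v] vu cmp_zero_left[OF p(1)] cmp_assoc[OF v j' v] vj cmp_idm_left[OF v] by simp
  then obtain h where h: "h \<in> Hom C Y X" "?d = u \<cdot> h" using tri_lift1[OF t d] by blast
  have "p \<cdot> ?d = 0"
    using cmp_diff_right[OF d1 jv p(1)] cmp_diff_right[OF idm_in_Hom up p(1)] cmp_idm_right[OF p(1)]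
      cmp_assoc[OF p(1) u p(1)] p(2) cmp_idm_left[OF p(1)] cmp_assoc[OF v j' p(1)] pj' cmp_zero_left[OF v] by simp
  then have "h = 0" using h cmp_assoc[OF h(1) u p(1)] p(2) cmp_idm_left[OF h(1)] by simp
  then have "?d = 0" using h cmp_zero_right[OF u] by simp
  then have "u \<cdot> p + ?j \<cdot> v = idm C Y" by (simp add: diff_eq_eq)
  then show ?thesis unfolding is_biproduct_def
    using u j' p v vj pj' vu by (intro exI[of _ u] exI[of _ ?j] exI[of _ p] exI[of _ v]) simp
qed

lemma tri_replace_third:
  assumes t: "tri C X Y K u v w" and b: "b \<in> Hom C K' K" "b' \<in> Hom C K K'" "b' \<cdot> b = idm C K'" "b \<cdot> b' = idm C K"
  shows "tri C X Y K' u (b' \<cdot> v) (w \<cdot> b)"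
proof (rule tri_iso[OF t _ _ _ is_iso_idm is_iso_idm])
  note uvw = triD[OF t]
  show "u \<in> Hom C X Y" by (rule uvw)
  show "b' \<cdot> v \<in> Hom C Y K'" using cmp_in_Hom[OF uvw(2) b(2)] .
  show "w \<cdot> b \<in> Hom C K' (susp C X)" using cmp_in_Hom[OF b(1) uvw(3)] .
  show "is_iso C K K' b'" using is_isoI[OF b(2,1,4,3)] .
  show "idm C Y \<cdot> u = u \<cdot> idm C X" using cmp_idm_left[OF uvw(1)] cmp_idm_right[OF uvw(1)] by simp
  show "b' \<cdot> v = (b' \<cdot> v) \<cdot> idm C Y" using cmp_idm_right[OF cmp_in_Hom[OF uvw(2) b(2)]] by simp
  show "suspm C (idm C X) \<cdot> w = (w \<cdot> b) \<cdot> b'"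
    using cmp_assoc[OF b(2,1) uvw(3)] b(4) cmp_idm_right[OF uvw(3)] cmp_idm_left[OF uvw(3)]
    by (simp add: suspm_idm)
qed

text \<open>Completing \<open>u\<close> to a triangle gives a zero third morphism because
  \<open>u\<close> is split; the third object is then identified with \<open>Z\<close>.\<close>

lemma biproduct_split_tri:
  assumes "u \<in> Hom C X P" "j \<in> Hom C Z P" "p \<in> Hom C P X" "v \<in> Hom C P Z"
    and "p \<cdot> u = idm C X" "v \<cdot> j = idm C Z" "p \<cdot> j = 0" "v \<cdot> u = 0" "u \<cdot> p + j \<cdot> v = idm C P"
  shows "tri C X P Z u v 0"
proof -
  obtain K c d where t: "tri C X P K u c d" using tri_exists[OF assms(1)] by blast
  note c = triD(2)[OF t] and d = triD(3)[OF t]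
  have "suspm C p \<cdot> (suspm C u \<cdot> d) = d"
    using cmp_assoc[OF d suspm_Hom[OF assms(1)] suspm_Hom[OF assms(3)]] suspm_cmp[OF assms(1,3)] assms(5)
      suspm_idm cmp_idm_left[OF d] by simp
  then have d0: "d = 0" using tri_cmp_zero''[OF t] cmp_zero_right[OF suspm_Hom[OF assms(3)]] by simp
  obtain e where e: "e \<in> Hom C K Z" "v = e \<cdot> c" using tri_ext1[OF t assms(4,8)] by blast
  let ?f = "c \<cdot> j"
  have f: "?f \<in> Hom C Z K" using cmp_in_Hom[OF assms(2) c] .
  have ef: "e \<cdot> ?f = idm C Z" using cmp_assoc[OF assms(2) c e(1)] e(2) assms(6) by simp
  have cu: "c \<cdot> u = 0" using tri_cmp_zero[OF t] .
  have jv: "j \<cdot> v \<in> Hom C P P" and up: "u \<cdot> p \<in> Hom C P P"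
    using cmp_in_Hom[OF assms(4,2)] cmp_in_Hom[OF assms(3,1)] .
  have "c = c \<cdot> (u \<cdot> p + j \<cdot> v)" using assms(9) cmp_idm_right[OF c] by simp
  also have "\<dots> = c \<cdot> (j \<cdot> v)"
    using cmp_add_right[OF up jv c] cmp_assoc[OF assms(3,1) c] cu cmp_zero_left[OF assms(3)] by simp
  finally have cjv: "c = ?f \<cdot> v" using cmp_assoc[OF assms(4,2) c] by simp
  have fe: "?f \<cdot> e \<in> Hom C K K" using cmp_in_Hom[OF e(1) f] .
  let ?d = "?f \<cdot> e - idm C K"
  have d': "?d \<in> Hom C K K" using fe by blast
  have "?d \<cdot> c = 0"
    using cmp_diff_left[OF c fe idm_in_Hom] cmp_assoc[OF c e(1) f] e(2) cjv cmp_idm_left[OF c] by simp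
  then obtain h where "h \<in> Hom C (susp C X) K" "?d = h \<cdot> d" using tri_ext2[OF t d'] by blast
  then have fe': "?f \<cdot> e = idm C K" using d0 cmp_zero_right by fastforce
  show ?thesis
    using tri_replace_third[OF t f e(1) ef fe'] e(2) d0 cmp_zero_left[OF f] by simp
qed

lemma susp_cover:
  obtains Y b b' where "b \<in> Hom C (susp C Y) K" "b' \<in> Hom C K (susp C Y)"
    "b' \<cdot> b = idm C (susp C Y)" "b \<cdot> b' = idm C K"
proof -
  obtain Y a where "is_iso C (susp C Y) K a" using susp_ess_surj[of K] unfolding isomorphic_def by blast
  then show ?thesis by (rule is_isoE) (rule that)
qed

text \<open>The suspension is only essentially surjective, so the third object has to be replaced by
  an isomorphic suspension before rotating back.\<close>

lemma tri_from_second: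
  assumes v: "v \<in> Hom C Y Z"
  obtains X u w where "tri C X Y Z u v w"
proof -
  obtain K c d where t: "tri C Y Z K v c d" using tri_exists[OF v] by blast
  obtain X b b' where b: "b \<in> Hom C (susp C X) K" "b' \<in> Hom C K (susp C X)"
    "b' \<cdot> b = idm C (susp C X)" "b \<cdot> b' = idm C K" by (rule susp_cover)
  have t': "tri C Y Z (susp C X) v (b' \<cdot> c) (d \<cdot> b)" by (rule tri_replace_third[OF t b])
  obtain u where u: "u \<in> Hom C X Y" "d \<cdot> b = - suspm C u" using triD(3)[OF t'] by (rule suspm_surj_neg)
  have "tri C X Y Z u v (b' \<cdot> c)"
    using t' u tri_rotate[OF u(1) v triD(2)[OF t']] by simp
  then show ?thesis using that by blast
qed

lemma tri_from_third:
  assumes w: "w \<in> Hom C Z (susp C X)"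
  obtains Y u v where "tri C X Y Z u v w"
proof -
  obtain Y v d where t: "tri C Y Z (susp C X) v w d" by (rule tri_from_second[OF w])
  obtain u where u: "u \<in> Hom C X Y" "d = - suspm C u" using triD(3)[OF t] by (rule suspm_surj_neg)
  have "tri C X Y Z u v w" using t u tri_rotate[OF u(1) triD(1)[OF t] w] by simp
  then show ?thesis using that by blast
qed

lemma is_biproduct_desusp:
  assumes "is_biproduct C (susp C X) (susp C Y) (susp C P)"
  shows "is_biproduct C X Y P"
proof -
  obtain i' j' p' q' where s: "i' \<in> Hom C (susp C X) (susp C P)" "j' \<in> Hom C (susp C Y) (susp C P)"
    "p' \<in> Hom C (susp C P) (susp C X)" "q' \<in> Hom C (susp C P) (susp C Y)"
    "p' \<cdot> i' = idm C (susp C X)" "q' \<cdot> j' = idm C (susp C Y)" "p' \<cdot> j' = 0" "q' \<cdot> i' = 0"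
    "i' \<cdot> p' + j' \<cdot> q' = idm C (susp C P)"
    using assms by (rule is_biproductE)
  obtain i where i: "i \<in> Hom C X P" "i' = suspm C i" using s(1) by (rule suspm_surj)
  obtain j where j: "j \<in> Hom C Y P" "j' = suspm C j" using s(2) by (rule suspm_surj)
  obtain p where p: "p \<in> Hom C P X" "p' = suspm C p" using s(3) by (rule suspm_surj)
  obtain q where q: "q \<in> Hom C P Y" "q' = suspm C q" using s(4) by (rule suspm_surj)
  note ip = cmp_in_Hom[OF p(1) i(1)] and jq = cmp_in_Hom[OF q(1) j(1)]
  have "p \<cdot> i = idm C X"
    using suspm_inj[OF _ cmp_in_Hom[OF i(1) p(1)] idm_in_Hom] suspm_cmp[OF i(1) p(1)] s(5) i p by (simp add: suspm_idm)
  moreover have "q \<cdot> j = idm C Y"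
    using suspm_inj[OF _ cmp_in_Hom[OF j(1) q(1)] idm_in_Hom] suspm_cmp[OF j(1) q(1)] s(6) j q by (simp add: suspm_idm)
  moreover have "p \<cdot> j = 0"
    using suspm_inj[OF _ cmp_in_Hom[OF j(1) p(1)] zero_in_Hom] suspm_cmp[OF j(1) p(1)] s(7) j p by simp
  moreover have "q \<cdot> i = 0"
    using suspm_inj[OF _ cmp_in_Hom[OF i(1) q(1)] zero_in_Hom] suspm_cmp[OF i(1) q(1)] s(8) i q by simp
  moreover have "i \<cdot> p + j \<cdot> q = idm C P"
    using suspm_inj[OF _ Hom_add[OF ip jq] idm_in_Hom] suspm_add[OF ip jq] suspm_cmp[OF p(1) i(1)]
      suspm_cmp[OF q(1) j(1)] s(9) i j p q by (simp add: suspm_idm)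
  ultimately show ?thesis unfolding is_biproduct_def
    using i(1) j(1) p(1) q(1) by (intro exI[of _ i] exI[of _ j] exI[of _ p] exI[of _ q]) simp
qed

end

section \<open>The Calabi-Yau property\<close>

sublocale two_CY_category_with_cto \<subseteq> krull_schmidt_category C
  by unfold_locales (use zero_object_exists biproduct_exists idempotents_split Hom_finite_dim in auto)

context two_CY_category_with_cto
begin

text \<open>The coordinate at \<open>a\<close> in a basis of the whole ambient space, cut off
  outside \<open>Hom C X Y\<close> as \<open>dualHom\<close> demands.\<close>

lemma dual_functional_exists:
  assumes "a \<in> Hom C X Y" "a \<noteq> 0"
  shows "\<exists>\<xi>\<in>dualHom C X Y. \<xi> a = 1"
proof -
  have "independent {a}" using assms by simp
  define B where "B = extend_basis {a}"
  have B: "independent B" "a \<in> B" "\<And>v. v \<in> span B"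
    using extend_basis_superset[OF \<open>independent {a}\<close>] independent_extend_basis[OF \<open>independent {a}\<close>]
      span_extend_basis[OF \<open>independent {a}\<close>]
    unfolding B_def by auto
  let ?\<xi> = "\<lambda>f. if f \<in> Hom C X Y then representation B f a else 0"
  have "?\<xi> \<in> dualHom C X Y"
    unfolding dualHom_def using B
    by (auto simp: representation_add representation_scale Hom_add Hom_scl)
  moreover have "?\<xi> a = 1" using assms(1) representation_basis[OF B(1,2)] by simp
  ultimately show ?thesis by (intro bexI[of _ ?\<xi>])
qed

lemma CY_duality:
  obtains \<Phi> :: "'o \<Rightarrow> 'o \<Rightarrow> ('m \<Rightarrow> 'k) \<Rightarrow> 'm" where
    "\<And>X Y. bij_betw (\<Phi> X Y) (dualHom C X Y) (Hom C Y (susp C (susp C X)))"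
    "\<And>X Y c \<xi>. \<xi> \<in> dualHom C X Y \<Longrightarrow> \<Phi> X Y (\<lambda>f. c * \<xi> f) = scl C c (\<Phi> X Y \<xi>)"
    "\<And>X Y Y' b \<xi>. b \<in> Hom C Y' Y \<Longrightarrow> \<xi> \<in> dualHom C X Y \<Longrightarrow>
        \<Phi> X Y' (\<lambda>f. if f \<in> Hom C X Y' then \<xi> (b \<cdot> f) else 0) = \<Phi> X Y \<xi> \<cdot> b"
proof -
  obtain \<Phi> :: "'o \<Rightarrow> 'o \<Rightarrow> ('m \<Rightarrow> 'k) \<Rightarrow> 'm" where \<Phi>:
     "\<forall>X Y. bij_betw (\<Phi> X Y) (dualHom C X Y) (Hom C Y (susp C (susp C X)))"
     "\<forall>X Y c. \<forall>\<xi>\<in>dualHom C X Y. \<Phi> X Y (\<lambda>f. c * \<xi> f) = scl C c (\<Phi> X Y \<xi>)"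
     "\<forall>X Y Y'. \<forall>b\<in>Hom C Y' Y. \<forall>\<xi>\<in>dualHom C X Y.
        \<Phi> X Y' (\<lambda>f. if f \<in> Hom C X Y' then \<xi> (b \<cdot> f) else 0) = \<Phi> X Y \<xi> \<cdot> b"
    using two_Calabi_Yau unfolding two_Calabi_Yau_def by (elim exE conjE) (rule that)
  show ?thesis
    by (rule that[of \<Phi>]; rule \<Phi>[rule_format])
qed

text \<open>Nondegeneracy of the composition pairing. For \<open>\<xi>\<close> with
  \<open>\<xi> a = 1\<close>, naturality identifies \<open>\<Phi> X Y \<xi> \<cdot> a\<close> with
  the image of the functional \<open>\<xi> (a \<cdot> f)\<close> of \<open>f\<close>, which takes
  the value 1 at the identity.\<close>

lemma CY_pairing:
  assumes a: "a \<in> Hom C X Y" "a \<noteq> 0"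
  obtains b where "b \<in> Hom C Y (susp C (susp C X))" "b \<cdot> a \<noteq> 0"
proof -
  obtain \<Phi> :: "'o \<Rightarrow> 'o \<Rightarrow> ('m \<Rightarrow> 'k) \<Rightarrow> 'm" where \<Phi>:
    "\<And>X Y. bij_betw (\<Phi> X Y) (dualHom C X Y) (Hom C Y (susp C (susp C X)))"
    "\<And>X Y c \<xi>. \<xi> \<in> dualHom C X Y \<Longrightarrow> \<Phi> X Y (\<lambda>f. c * \<xi> f) = scl C c (\<Phi> X Y \<xi>)"
    "\<And>X Y Y' b \<xi>. b \<in> Hom C Y' Y \<Longrightarrow> \<xi> \<in> dualHom C X Y \<Longrightarrow>
        \<Phi> X Y' (\<lambda>f. if f \<in> Hom C X Y' then \<xi> (b \<cdot> f) else 0) = \<Phi> X Y \<xi> \<cdot> b"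
    by (rule CY_duality) blast
  obtain \<xi> where \<xi>: "\<xi> \<in> dualHom C X Y" "\<xi> a = 1" using dual_functional_exists[OF a] by blast
  define \<eta> where "\<eta> = (\<lambda>f. if f \<in> Hom C X X then \<xi> (a \<cdot> f) else 0)"
  define z where "z = (\<lambda>f::'m. 0::'k)"
  have \<eta>: "\<eta> \<in> dualHom C X X"
    unfolding \<eta>_def using \<xi>(1) cmp_in_Hom[OF _ a(1)] cmp_add_right[OF _ _ a(1)] cmp_scl_right[OF _ a(1)]
    unfolding dualHom_def by (auto simp: Hom_add Hom_scl)
  have zero: "z \<in> dualHom C X X" unfolding dualHom_def z_def by auto
  have z0: "\<Phi> X X z = 0" using \<Phi>(2)[OF zero, of 0] by (simp add: z_def)
  have "\<eta> (idm C X) \<noteq> z (idm C X)" using \<xi>(2) cmp_idm_right[OF a(1)] by (simp add: \<eta>_def z_def)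
  then have "\<eta> \<noteq> z" by metis
  then have "\<Phi> X X \<eta> \<noteq> 0"
    using inj_on_eq_iff[OF bij_betw_imp_inj_on[OF \<Phi>(1)] \<eta> zero] z0 by simp
  then have "\<Phi> X Y \<xi> \<cdot> a \<noteq> 0" using \<Phi>(3)[OF a(1) \<xi>(1)] unfolding \<eta>_def by simp
  moreover have "\<Phi> X Y \<xi> \<in> Hom C Y (susp C (susp C X))" using \<Phi>(1) \<xi>(1) bij_betwE by blast
  ultimately show ?thesis using that by blast
qed

lemma Ext_zero_sym:
  assumes "Hom C Y (susp C X) = {0}"
  shows "Hom C X (susp C Y) = {0}"
proof -
  have "a = 0" if a: "a \<in> Hom C X (susp C Y)" for a
  proof (rule ccontr)
    assume "a \<noteq> 0"
    then obtain b where b: "b \<in> Hom C (susp C Y) (susp C (susp C X))" "b \<cdot> a \<noteq> 0" using CY_pairing[OF a] by blast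
    have "b = 0" using b(1) assms Hom_susp_zero_iff by blast
    then show False using b(2) cmp_zero_left[OF a] by simp
  qed
  then show ?thesis by auto
qed

text \<open>\<open>V\<close> is a line with chosen generator \<open>\<delta>\<close>; the generator
  serves as the third morphism of an exchange triangle.\<close>

definition spans :: "'m \<Rightarrow> 'm set \<Rightarrow> bool" where
  "spans \<delta> V \<longleftrightarrow> \<delta> \<in> V \<and> \<delta> \<noteq> 0 \<and> (\<forall>d\<in>V. \<exists>c. d = scl C c \<delta>)"

lemma spans_hdim: "spans \<delta> V \<Longrightarrow> hdim C V = 1"
proof -
  assume s: "spans \<delta> V"
  have "V \<subseteq> span {\<delta>}"
  proof
    fix d assume "d \<in> V"
    then obtain c where "d = scl C c \<delta>" using s unfolding spans_def by blast
    then show "d \<in> span {\<delta>}" using span_base[of \<delta> "{\<delta>}"] span_scale by simp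
  qed
  then have "card {\<delta>} = dim V" using s unfolding spans_def by (intro basis_card_eq_dim) auto
  then show ?thesis by (simp add: hdim_dim)
qed

text \<open>A functional \<open>\<xi>\<close> with \<open>\<xi> \<delta> = 1\<close> spans the dual
  of a line, so its image under the duality, desuspended, spans the other extension space.\<close>

lemma Ext_spans_sym:
  assumes \<delta>: "spans \<delta> (Hom C X (susp C Y))"
  obtains \<eta> where "spans \<eta> (Hom C Y (susp C X))"
proof -
  obtain \<Phi> :: "'o \<Rightarrow> 'o \<Rightarrow> ('m \<Rightarrow> 'k) \<Rightarrow> 'm" where \<Phi>:
    "\<And>X Y. bij_betw (\<Phi> X Y) (dualHom C X Y) (Hom C Y (susp C (susp C X)))"
    "\<And>X Y c \<xi>. \<xi> \<in> dualHom C X Y \<Longrightarrow> \<Phi> X Y (\<lambda>f. c * \<xi> f) = scl C c (\<Phi> X Y \<xi>)"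
    by (rule CY_duality) blast
  let ?H = "Hom C X (susp C Y)" and ?D = "dualHom C X (susp C Y)" and ?P = "\<Phi> X (susp C Y)"
  have d: "\<delta> \<in> ?H" "\<delta> \<noteq> 0" using \<delta> unfolding spans_def by auto
  obtain \<xi> where \<xi>: "\<xi> \<in> ?D" "\<xi> \<delta> = 1" using dual_functional_exists[OF d] by blast
  have "?P \<xi> \<in> Hom C (susp C Y) (susp C (susp C X))" using \<Phi>(1) \<xi>(1) bij_betwE by blast
  then obtain \<eta> where \<eta>: "\<eta> \<in> Hom C Y (susp C X)" "?P \<xi> = suspm C \<eta>" by (rule suspm_surj)
  define z where "z = (\<lambda>f::'m. 0::'k)"
  have zero: "z \<in> ?D" unfolding dualHom_def z_def by auto
  have z0: "?P z = 0" using \<Phi>(2)[OF zero, of 0] by (simp add: z_def)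
  have "\<xi> \<delta> \<noteq> z \<delta>" using \<xi>(2) by (simp add: z_def)
  then have "\<xi> \<noteq> z" by metis
  then have "?P \<xi> \<noteq> 0"
    using inj_on_eq_iff[OF bij_betw_imp_inj_on[OF \<Phi>(1)] \<xi>(1) zero] z0 by simp
  then have nz: "\<eta> \<noteq> 0" using \<eta>(2) by auto
  have "\<exists>c. e = scl C c \<eta>" if e: "e \<in> Hom C Y (susp C X)" for e
  proof -
    obtain \<zeta> where \<zeta>: "\<zeta> \<in> ?D" "suspm C e = ?P \<zeta>"
      using \<Phi>(1)[of X "susp C Y"] suspm_Hom[OF e] unfolding bij_betw_def by blast
    have "\<zeta> f = \<zeta> \<delta> * \<xi> f" for f
    proof (cases "f \<in> ?H")
      case True
      then obtain c where c: "f = scl C c \<delta>" using \<delta> unfolding spans_def by blast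
      then show ?thesis using \<zeta>(1) \<xi> d(1) unfolding dualHom_def by simp
    next
      case False
      then show ?thesis using \<zeta>(1) \<xi>(1) unfolding dualHom_def by simp
    qed
    then have "\<zeta> = (\<lambda>f. \<zeta> \<delta> * \<xi> f)" by blast
    then have "suspm C e = scl C (\<zeta> \<delta>) (suspm C \<eta>)" using \<zeta>(2) \<Phi>(2)[OF \<xi>(1), of "\<zeta> \<delta>"] \<eta>(2) by simp
    then have "suspm C e = suspm C (scl C (\<zeta> \<delta>) \<eta>)" using suspm_scl[OF \<eta>(1)] by simp
    then show ?thesis using suspm_inj[OF _ e Hom_scl[OF \<eta>(1)]] by blast
  qed
  then have "spans \<eta> (Hom C Y (susp C X))" unfolding spans_def using \<eta>(1) nz by blast
  then show ?thesis using that by blast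
qed

text \<open>Some map pairs nontrivially with \<open>a\<close>, and every candidate is a multiple of
  \<open>suspm C \<delta>\<close>.\<close>

lemma Ext_spans_pairing:
  assumes "a \<in> Hom C X (susp C Y)" "a \<noteq> 0" and \<delta>: "spans \<delta> (Hom C Y (susp C X))"
  shows "suspm C \<delta> \<cdot> a \<noteq> 0"
proof
  assume 0: "suspm C \<delta> \<cdot> a = 0"
  have d: "\<delta> \<in> Hom C Y (susp C X)" using \<delta> unfolding spans_def by blast
  obtain b where b: "b \<in> Hom C (susp C Y) (susp C (susp C X))" "b \<cdot> a \<noteq> 0" using CY_pairing[OF assms(1,2)] by blast
  obtain e where e: "e \<in> Hom C Y (susp C X)" "b = suspm C e" using b(1) by (rule suspm_surj)
  obtain c where "e = scl C c \<delta>" using \<delta> e(1) unfolding spans_def by blast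
  then have "b = scl C c (suspm C \<delta>)" using e suspm_scl[OF d] by simp
  then have "b \<cdot> a = 0" using cmp_scl_left[OF assms(1) suspm_Hom[OF d]] 0 by simp
  then show False using b(2) by blast
qed

end


section \<open>Exchange triangles\<close>

locale cluster_sum = two_CY_category_with_cto C
  for C :: "('o, 'm::ab_group_add, 'k::alg_closed_field) tricat" (structure) +
  fixes n :: nat and T :: 'o and Ts :: "nat \<Rightarrow> 'o"
  assumes ct: "cluster_tilting C T"
    and ct_dsum: "is_dsum C {1..n} Ts T"
    and ct_ind: "i \<in> {1..n} \<Longrightarrow> indecomposable C (Ts i)"
begin

lemma ct_noniso:
  assumes "i \<in> {1..n}" "j \<in> {1..n}" "i \<noteq> j"
  shows "\<not> isomorphic C (Ts i) (Ts j)"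
proof -
  obtain \<iota> \<pi> where ip: "\<forall>i\<in>{1..n}. \<iota> i \<in> Hom C (Ts i) T \<and> \<pi> i \<in> Hom C T (Ts i)"
    "\<forall>i\<in>{1..n}. \<forall>j\<in>{1..n}. \<pi> i \<cdot> \<iota> j = (if i = j then idm C (Ts i) else 0)"
    "(\<Sum>i\<in>{1..n}. \<iota> i \<cdot> \<pi> i) = idm C T"
    using ct_dsum unfolding is_dsum_def by blast
  \<comment> \<open>\<open>basic_object\<close> numbers the summands from 0, the family
    \<open>Ts\<close> from 1.\<close>
  have "(\<Sum>i<n. \<iota> (Suc i) \<cdot> \<pi> (Suc i)) = idm C T" using ip(3) by (simp add: sum.atLeast1_atMost_eq)
  then have "is_dsum C {..<n} (\<lambda>i. Ts (Suc i)) T"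
    unfolding is_dsum_def using ip(1,2)
    by (intro conjI[OF finite_lessThan] exI[of _ "\<lambda>i. \<iota> (Suc i)"] exI[of _ "\<lambda>i. \<pi> (Suc i)"]) auto
  moreover have "\<forall>i<n. indecomposable C (Ts (Suc i))" using ct_ind by auto
  ultimately have *: "\<forall>i<n. \<forall>j<n. i \<noteq> j \<longrightarrow> \<not> isomorphic C (Ts (Suc i)) (Ts (Suc j))"
    using ct unfolding cluster_tilting_def basic_object_def by blast
  obtain i' j' where "i = Suc i'" "j = Suc j'" using assms by (metis One_nat_def atLeastAtMost_iff not0_implies_Suc not_one_le_zero)
  then show ?thesis using * assms by auto
qed

end

sublocale cluster_sum \<subseteq> basic_sum C n T Ts
  by unfold_locales (use ct_dsum ct_ind ct_noniso in auto)

context two_CY_category_with_cto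
begin

lemma in_add_Ext_zero_right:
  assumes "in_add C Ts I Y" "\<And>i. i \<in> I \<Longrightarrow> Hom C X (susp C (Ts i)) = {0}"
  shows "Hom C X (susp C Y) = {0}"
proof (rule Ext_zero_sym, rule in_add_Hom_zero_left[OF assms(1)])
  fix i assume "i \<in> I"
  then show "Hom C (Ts i) (susp C X) = {0}" by (intro Ext_zero_sym[OF assms(2)])
qed

lemma in_add_Ext_zero:
  assumes "in_add C Ts I X" "in_add C Ts' J Y"
    and "\<And>i j. \<lbrakk>i \<in> I; j \<in> J\<rbrakk> \<Longrightarrow> Hom C (Ts i) (susp C (Ts' j)) = {0}"
  shows "Hom C X (susp C Y) = {0}"
  by (rule in_add_Hom_zero_left[OF assms(1)], rule in_add_Ext_zero_right[OF assms(2)], rule assms(3))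

text \<open>
  Octahedral axiom for \<open>D \<rightarrow> \<Sigma>A \<rightarrow> \<Sigma>A'\<close>; the hypothesis makes the resulting triangle split.
\<close>

lemma tri_push:
  assumes t: "tri C A B D a b w" and t': "tri C A A' Q s t x" and zero: "suspm C a \<cdot> x = 0"
  obtains B' a' b' w' where "tri C A' B' D a' b' w'" "is_biproduct C B Q B'"
proof -
  note abw = triD[OF t] and stx = triD[OF t']
  \<comment> \<open>Rotation brings in negated suspensions; the two signs in the connecting morphism
    of the octahedron cancel below.\<close>
  have T1: "tri C D (susp C A) (susp C B) w (- suspm C a) (- suspm C b)" by (intro tri_rot t)
  have T2: "tri C (susp C A) (susp C A') (susp C Q) (- suspm C s) (- suspm C t) (- suspm C x)" by (intro tri_rot t')
  have w': "(- suspm C s) \<cdot> w \<in> Hom C D (susp C A')"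
    using cmp_in_Hom[OF abw(3) Hom_neg[OF suspm_Hom[OF stx(1)]]] .
  obtain B' a' b' where T0: "tri C A' B' D a' b' ((- suspm C s) \<cdot> w)" by (rule tri_from_third[OF w'])
  have T3: "tri C D (susp C A') (susp C B') ((- suspm C s) \<cdot> w) (- suspm C a') (- suspm C b')" by (intro tri_rot T0)
  obtain f g where fg: "tri C (susp C B) (susp C B') (susp C Q) f g (suspm C (- suspm C a) \<cdot> (- suspm C x))"
    using tri_octahedral[OF T1 T2 T3] by blast
  have "suspm C (- suspm C a) \<cdot> (- suspm C x) = suspm C (suspm C a \<cdot> x)"
    using suspm_neg[OF suspm_Hom[OF abw(1)]]
      cmp_neg_left[OF Hom_neg[OF suspm_Hom[OF stx(3)]] suspm_Hom[OF suspm_Hom[OF abw(1)]]]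
      cmp_neg_right[OF suspm_Hom[OF stx(3)] suspm_Hom[OF suspm_Hom[OF abw(1)]]]
      suspm_cmp[OF stx(3) suspm_Hom[OF abw(1)]] by simp
  then have "tri C (susp C B) (susp C B') (susp C Q) f g 0" using fg zero by simp
  then have "is_biproduct C B Q B'" using is_biproduct_desusp split_tri_biproduct by blast
  then show ?thesis using that T0 by blast
qed

end

context cluster_sum
begin

lemma rigid:
  assumes ij: "i \<in> {1..n}" "j \<in> {1..n}"
  shows "Hom C (Ts i) (susp C (Ts j)) = {0}"
proof -
  obtain \<iota> \<pi> where ip: "\<forall>i\<in>{1..n}. \<iota> i \<in> Hom C (Ts i) T \<and> \<pi> i \<in> Hom C T (Ts i)"
    "\<forall>i\<in>{1..n}. \<forall>j\<in>{1..n}. \<pi> i \<cdot> \<iota> j = (if i = j then idm C (Ts i) else 0)"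
    using ct_dsum unfolding is_dsum_def by blast
  have i: "\<iota> i \<in> Hom C (Ts i) T" "\<pi> i \<in> Hom C T (Ts i)" "\<pi> i \<cdot> \<iota> i = idm C (Ts i)" using ip ij by auto
  have j: "\<iota> j \<in> Hom C (Ts j) T" "\<pi> j \<in> Hom C T (Ts j)" "\<pi> j \<cdot> \<iota> j = idm C (Ts j)" using ip ij by auto
  have T0: "Hom C T (susp C T) = {0}" using ct unfolding cluster_tilting_def Ext1_def by blast
  have "f = 0" if f: "f \<in> Hom C (Ts i) (susp C (Ts j))" for f
  proof -
    note sj = suspm_Hom[OF j(1)] and sp = suspm_Hom[OF j(2)]
    note f1 = cmp_in_Hom[OF f sj]
    have "(suspm C (\<iota> j) \<cdot> f) \<cdot> \<pi> i = 0" using cmp_in_Hom[OF i(2) f1] T0 by simp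
    then have "suspm C (\<iota> j) \<cdot> f = 0"
      using cmp_assoc[OF i(1,2) f1] i(3) cmp_idm_right[OF f1] cmp_zero_left[OF i(1)] by simp
    then have "suspm C (\<pi> j) \<cdot> (suspm C (\<iota> j) \<cdot> f) = 0" using cmp_zero_right[OF sp] by simp
    then show "f = 0"
      using cmp_assoc[OF f sj sp] suspm_cmp[OF j(1,2)] j(3) suspm_idm cmp_idm_left[OF f] by simp
  qed
  then show ?thesis by auto
qed

lemma ct_mem:
  assumes "\<And>i. i \<in> {1..n} \<Longrightarrow> Hom C (Ts i) (susp C X) = {0}"
  shows "in_add C Ts {1..n} X"
proof -
  have "Ext1 C T X = {0}"
    unfolding Ext1_def using in_add_Hom_zero_left[OF is_dsum_in_add[OF ct_dsum] assms] .
  then show ?thesis using ct add_closure_T unfolding cluster_tilting_def by blast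
qed

text \<open>If \<open>Ts j\<close> were a summand of \<open>E\<close>, the nonzero
  \<open>\<delta>\<close> would extend to a map \<open>E \<rightarrow> \<Sigma>X\<close>.\<close>

lemma in_add_drop_Ext:
  assumes E: "in_add C Ts {1..n} E" and EX: "Hom C E (susp C X) = {0}" and j: "j \<in> {1..n}"
    and \<delta>: "\<delta> \<in> Hom C (Ts j) (susp C X)" "\<delta> \<noteq> 0"
  shows "in_add C Ts ({1..n} - {j}) E"
proof (rule in_add_drop[OF E], rule subsetI, rule ccontr)
  fix a assume a: "a \<in> Hom C (Ts j) E" "a \<notin> rad C (Ts j) E"
  then obtain g where g: "g \<in> Hom C E (Ts j)" "g \<cdot> a = idm C (Ts j)" using not_rad_split[OF ind[OF j]] by metis
  have "\<delta> \<cdot> g = 0" using cmp_in_Hom[OF g(1) \<delta>(1)] EX by simp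
  then have "\<delta> = 0" using cmp_assoc[OF a(1) g(1) \<delta>(1)] g(2) cmp_idm_right[OF \<delta>(1)] cmp_zero_left[OF a(1)] by simp
  then show False using \<delta>(2) by blast
qed

text \<open>\<open>E\<close> lies in \<open>add T\<close> because every map
  \<open>Ts i \<rightarrow> \<Sigma>E\<close> comes from one to \<open>\<Sigma>X\<close>; there only
  multiples of \<open>\<delta>\<close> occur, and the triangle kills \<open>\<delta>\<close>. The
  vanishing of \<open>Hom C E (susp C X)\<close> then keeps \<open>Ts j\<close> out of
  \<open>E\<close>.\<close>

lemma right_exchange_triangle:
  assumes j: "j \<in> {1..n}" and X: "\<And>i. i \<in> {1..n} - {j} \<Longrightarrow> Hom C (Ts i) (susp C X) = {0}"
    and XX: "Hom C X (susp C X) = {0}" and \<delta>: "spans \<delta> (Hom C (Ts j) (susp C X))"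
  obtains E u v where "in_add C Ts ({1..n} - {j}) E" "tri C X E (Ts j) v u \<delta>"
proof -
  have d: "\<delta> \<in> Hom C (Ts j) (susp C X)" "\<delta> \<noteq> 0" using \<delta> unfolding spans_def by auto
  obtain E v u where t: "tri C X E (Ts j) v u \<delta>" by (rule tri_from_third[OF d(1)])
  note vu = triD[OF t]
  have "y = 0" if i: "i \<in> {1..n}" and y: "y \<in> Hom C (Ts i) (susp C E)" for i y
  proof -
    have "suspm C u \<cdot> y = 0" using cmp_in_Hom[OF y suspm_Hom[OF vu(2)]] rigid[OF i j] by simp
    then obtain y' where y': "y' \<in> Hom C (Ts i) (susp C X)" "y = suspm C v \<cdot> y'" using tri_lift4[OF t y] by blast
    show "y = 0"
    proof (cases "i = j")
      case True
      then obtain c where "y' = scl C c \<delta>" using \<delta> y'(1) unfolding spans_def by blast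
      then show ?thesis using y'(2) cmp_scl_right[OF d(1) suspm_Hom[OF vu(1)]] tri_cmp_zero''[OF t] by simp
    next
      case False
      then show ?thesis using X[of i] i y' cmp_zero_right[OF suspm_Hom[OF vu(1)]] by simp
    qed
  qed
  then have E: "in_add C Ts {1..n} E" by (intro ct_mem) auto
  have "y = 0" if y: "y \<in> Hom C E (susp C X)" for y
  proof -
    have "y \<cdot> v = 0" using cmp_in_Hom[OF vu(1) y] XX by simp
    then obtain y' where y': "y' \<in> Hom C (Ts j) (susp C X)" "y = y' \<cdot> u" using tri_ext1[OF t y] by blast
    then obtain c where "y' = scl C c \<delta>" using \<delta> unfolding spans_def by blast
    then show "y = 0" using y'(2) cmp_scl_left[OF vu(2) d(1)] tri_cmp_zero'[OF t] by simp
  qed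
  then have "Hom C E (susp C X) = {0}" by auto
  then show ?thesis using that in_add_drop_Ext[OF E _ j d] t by blast
qed

text \<open>The third morphism is a generator \<open>\<eta>\<close> dual to \<open>\<delta>\<close>.
  An obstruction is a multiple of \<open>\<delta>\<close> whose pairing with \<open>\<eta>\<close>
  vanishes, in one order or the other; as both pairings are nonzero on \<open>\<delta>\<close>, it
  is zero.\<close>

lemma left_exchange_triangle:
  assumes j: "j \<in> {1..n}" and X: "\<And>i. i \<in> {1..n} - {j} \<Longrightarrow> Hom C (Ts i) (susp C X) = {0}"
    and XX: "Hom C X (susp C X) = {0}" and \<delta>: "spans \<delta> (Hom C (Ts j) (susp C X))"
  obtains F p q \<eta> where "in_add C Ts ({1..n} - {j}) F" "tri C (Ts j) F X p q \<eta>" "\<eta> \<noteq> 0"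
proof -
  have d: "\<delta> \<in> Hom C (Ts j) (susp C X)" "\<delta> \<noteq> 0" using \<delta> unfolding spans_def by auto
  obtain \<eta> where \<eta>: "spans \<eta> (Hom C X (susp C (Ts j)))" by (rule Ext_spans_sym[OF \<delta>])
  have e: "\<eta> \<in> Hom C X (susp C (Ts j))" "\<eta> \<noteq> 0" using \<eta> unfolding spans_def by auto
  have ed: "suspm C \<eta> \<cdot> \<delta> \<noteq> 0" by (rule Ext_spans_pairing[OF d \<eta>])
  have de: "suspm C \<delta> \<cdot> \<eta> \<noteq> 0" by (rule Ext_spans_pairing[OF e \<delta>])
  obtain F p q where t: "tri C (Ts j) F X p q \<eta>" by (rule tri_from_third[OF e(1)])
  note pq = triD[OF t]
  have "y = 0" if i: "i \<in> {1..n}" and y: "y \<in> Hom C (Ts i) (susp C F)" for i y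
  proof -
    note sq = suspm_Hom[OF pq(2)]
    have "suspm C q \<cdot> y = 0"
    proof (cases "i = j")
      case True
      then obtain c where c: "suspm C q \<cdot> y = scl C c \<delta>" using \<delta> cmp_in_Hom[OF y sq] unfolding spans_def by blast
      have "suspm C \<eta> \<cdot> (suspm C q \<cdot> y) = suspm C (\<eta> \<cdot> q) \<cdot> y"
        using cmp_assoc[OF y sq suspm_Hom[OF e(1)]] suspm_cmp[OF pq(2) e(1)] by simp
      then have "suspm C \<eta> \<cdot> scl C c \<delta> = 0" using c tri_cmp_zero'[OF t] cmp_zero_left[OF y] by simp
      then have "scl C c (suspm C \<eta> \<cdot> \<delta>) = 0" using cmp_scl_right[OF d(1) suspm_Hom[OF e(1)]] by simp
      then show ?thesis using ed c by simp
    next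
      case False
      then show ?thesis using X[of i] i cmp_in_Hom[OF y sq] by simp
    qed
    then obtain y' where y': "y' \<in> Hom C (Ts i) (susp C (Ts j))" "y = suspm C p \<cdot> y'" using tri_lift4[OF t y] by blast
    then show "y = 0" using rigid[OF i j] cmp_zero_right[OF suspm_Hom[OF pq(1)]] by simp
  qed
  then have F: "in_add C Ts {1..n} F" by (intro ct_mem) auto
  have "y = 0" if y: "y \<in> Hom C F (susp C X)" for y
  proof -
    obtain c where c: "y \<cdot> p = scl C c \<delta>" using \<delta> cmp_in_Hom[OF pq(1) y] unfolding spans_def by blast
    have "suspm C (y \<cdot> p) \<cdot> \<eta> = suspm C y \<cdot> (suspm C p \<cdot> \<eta>)"
      using cmp_assoc[OF e(1) suspm_Hom[OF pq(1)] suspm_Hom[OF y]] suspm_cmp[OF pq(1) y] by simp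
    then have "suspm C (scl C c \<delta>) \<cdot> \<eta> = 0"
      using c tri_cmp_zero''[OF t] cmp_zero_right[OF suspm_Hom[OF y]] by simp
    then have "scl C c (suspm C \<delta> \<cdot> \<eta>) = 0"
      using suspm_scl[OF d(1)] cmp_scl_left[OF e(1) suspm_Hom[OF d(1)]] by simp
    then have "y \<cdot> p = 0" using de c by simp
    then obtain y' where "y' \<in> Hom C X (susp C X)" "y = y' \<cdot> q" using tri_ext1[OF t y] by blast
    then show "y = 0" using XX cmp_zero_left[OF pq(2)] by simp
  qed
  then have "Hom C F (susp C X) = {0}" by auto
  then show ?thesis using that in_add_drop_Ext[OF F _ j d] t e by blast
qed

text \<open>Every map \<open>Ts i \<rightarrow> \<Sigma>X\<close> has the form
  \<open>\<delta> \<cdot> s\<close>, and \<open>\<delta>\<close> kills radical \<open>s\<close>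
  because these factor through \<open>y\<close>. Only the scalars remain, and only for
  \<open>i = j\<close>.\<close>

lemma exchange_partner_exists:
  assumes j: "j \<in> {1..n}" and E: "in_add C Ts ({1..n} - {j}) E" and y: "y \<in> Hom C E (Ts j)"
    and approx: "\<forall>i\<in>{1..n}. \<forall>h\<in>rad C (Ts i) (Ts j). \<exists>h'\<in>Hom C (Ts i) E. h = y \<cdot> h'"
  obtains X v \<delta> where "tri C X E (Ts j) v y \<delta>" "spans \<delta> (Hom C (Ts j) (susp C X))"
    "\<forall>i\<in>{1..n} - {j}. Hom C (Ts i) (susp C X) = {0}" "Hom C X (susp C X) = {0}"
proof -
  obtain X v \<delta> where t: "tri C X E (Ts j) v y \<delta>" by (rule tri_from_second[OF y])
  note v = triD(1)[OF t] and d = triD(3)[OF t]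
  have dy: "\<delta> \<cdot> y = 0" by (rule tri_cmp_zero'[OF t])
  have E_rigid: "Hom C (Ts i) (susp C E) = {0}" if "i \<in> {1..n}" for i
    using that by (intro in_add_Ext_zero_right[OF E rigid]) auto
  have lift: "\<exists>s\<in>Hom C (Ts i) (Ts j). z = \<delta> \<cdot> s" if i: "i \<in> {1..n}" and z: "z \<in> Hom C (Ts i) (susp C X)" for i z
  proof -
    have "suspm C v \<cdot> z = 0" using cmp_in_Hom[OF z suspm_Hom[OF v]] E_rigid[OF i] by simp
    then show ?thesis using tri_lift3[OF t z] by blast
  qed
  have rad0: "\<delta> \<cdot> h = 0" if i: "i \<in> {1..n}" and h: "h \<in> rad C (Ts i) (Ts j)" for i h
  proof -
    obtain h' where "h' \<in> Hom C (Ts i) E" "h = y \<cdot> h'" using approx i h by blast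
    then show ?thesis using cmp_assoc[OF _ y d, of h' "Ts i"] dy cmp_zero_left by simp
  qed
  have 1: "Hom C (Ts i) (susp C X) = {0}" if i: "i \<in> {1..n} - {j}" for i
  proof -
    have "z = 0" if z: "z \<in> Hom C (Ts i) (susp C X)" for z
    proof -
      obtain s where s: "s \<in> Hom C (Ts i) (Ts j)" "z = \<delta> \<cdot> s" using lift[OF _ z] i by blast
      have "s \<in> rad C (Ts i) (Ts j)" using Ts_Hom_rad[OF _ j _ s(1)] i by blast
      then show "z = 0" using rad0[of i s] s(2) i by simp
    qed
    then show ?thesis by auto
  qed
  \<comment> \<open>Otherwise \<open>y\<close> would have a right inverse, although it is radical
    because \<open>E\<close> avoids \<open>Ts j\<close>.\<close>
  have "\<delta> \<noteq> 0"
  proof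
    assume "\<delta> = 0"
    then have "\<delta> \<cdot> idm C (Ts j) = 0" using cmp_zero_left[OF idm_in_Hom] by simp
    then obtain s where s: "s \<in> Hom C (Ts j) E" "idm C (Ts j) = y \<cdot> s" using tri_lift2[OF t idm_in_Hom] by blast
    have "y \<in> rad C E (Ts j)" using avoiding_Hom_rad[OF E _ j _ y] by blast
    then have "idm C (Ts j) \<in> rad C (Ts j) (Ts j)" using rad_cmp_right[OF _ s(1)] s(2) by simp
    then show False using indecomposable_idm_not_rad[OF ind[OF j]] by blast
  qed
  moreover have "\<exists>c. z = scl C c \<delta>" if z: "z \<in> Hom C (Ts j) (susp C X)" for z
  proof -
    obtain s where s: "s \<in> Hom C (Ts j) (Ts j)" "z = \<delta> \<cdot> s" using lift[OF j z] by blast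
    obtain c where c: "s - scl C c (idm C (Ts j)) \<in> rad C (Ts j) (Ts j)" using end_scalar_plus_rad[OF ind[OF j] s(1)] by blast
    have "\<delta> \<cdot> (s - scl C c (idm C (Ts j))) = 0" by (rule rad0[OF j c])
    then have "z = scl C c \<delta>"
      using cmp_diff_right[OF s(1) Hom_scl[OF idm_in_Hom] d] cmp_scl_right[OF idm_in_Hom d] cmp_idm_right[OF d] s(2)
      by simp
    then show ?thesis by blast
  qed
  ultimately have sp: "spans \<delta> (Hom C (Ts j) (susp C X))" unfolding spans_def using d by blast
  have XE: "Hom C X (susp C E) = {0}"
    by (rule Ext_zero_sym, rule in_add_Hom_zero_left[OF E 1])
  \<comment> \<open>A self-extension is \<open>\<delta> \<cdot> h\<close>; \<open>h\<close> extends
    over \<open>E\<close> to a radical map, which factors through \<open>y\<close> and is killed by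
    \<open>\<delta>\<close>.\<close>
  have "z = 0" if z: "z \<in> Hom C X (susp C X)" for z
  proof -
    have "suspm C v \<cdot> z = 0" using cmp_in_Hom[OF z suspm_Hom[OF v]] XE by simp
    then obtain h where h: "h \<in> Hom C X (Ts j)" "z = \<delta> \<cdot> h" using tri_lift3[OF t z] by blast
    have "suspm C h \<cdot> \<delta> = 0" using cmp_in_Hom[OF d suspm_Hom[OF h(1)]] rigid[OF j j] by simp
    then obtain h' where h': "h' \<in> Hom C E (Ts j)" "h = h' \<cdot> v" using tri_ext0[OF t h(1)] by blast
    have "h' \<in> rad C E (Ts j)" using avoiding_Hom_rad[OF E _ j _ h'(1)] by blast
    then have "\<exists>e\<in>Hom C E E. h' = y \<cdot> e"
    proof -
      assume r: "h' \<in> rad C E (Ts j)"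
      show ?thesis
      proof (rule in_add_factors[OF E h'(1) y])
        fix i a assume "i \<in> {1..n} - {j}" "a \<in> Hom C (Ts i) E"
        then show "\<exists>h\<in>Hom C (Ts i) E. h' \<cdot> a = y \<cdot> h" using approx rad_cmp_right[OF r] by blast
      qed
    qed
    then obtain e where e: "e \<in> Hom C E E" "h' = y \<cdot> e" by blast
    have "\<delta> \<cdot> h' = 0" using e cmp_assoc[OF e(1) y d] dy cmp_zero_left[OF e(1)] by simp
    then show "z = 0" using h(2) h'(2) cmp_assoc[OF v h'(1) d] cmp_zero_left[OF v] by simp
  qed
  then have "Hom C X (susp C X) = {0}" by auto
  then show ?thesis using that t sp 1 by blast
qed

text \<open>Both equations are instances of \<open>arrows_rmult\<close>, the second in the opposite
  category. Exactness on the triangles and rigidity of \<open>T\<close> provide the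
  hypotheses.\<close>

lemma exchange_arrows:
  assumes j: "j \<in> {1..n}" and loop: "arrows C T Ts j j = 0" and r: "r \<in> {1..n}" "r \<noteq> j"
    and E: "in_add C Ts ({1..n} - {j}) E" and F: "in_add C Ts ({1..n} - {j}) F"
    and tE: "tri C X E (Ts j) v u \<delta>" and tF: "tri C (Ts j) F X p q \<eta>"
    and X: "\<And>i. i \<in> {1..n} - {j} \<Longrightarrow> Hom C (Ts i) (susp C X) = {0}"
  shows "arrows C T Ts r j + rmult C (Ts r) X = rmult C (Ts r) E"
    and "arrows C T Ts j r + rmult C (Ts r) X = rmult C (Ts r) F"
proof -
  note v = triD[OF tE] and p = triD[OF tF]
  have E': "in_add C Ts {1..n} E" and F': "in_add C Ts {1..n} F" using in_add_mono E F by blast+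
  show "arrows C T Ts r j + rmult C (Ts r) X = rmult C (Ts r) E"
  proof (rule arrows_rmult[OF r(1) E' _ v(1)])
    show "u \<in> rad C E (Ts j)" using avoiding_Hom_rad[OF E _ j _ v(2)] by blast
    show "u \<cdot> v = 0" by (rule tri_cmp_zero[OF tE])
  next
    \<comment> \<open>Since \<open>E0\<close> avoids \<open>Ts j\<close>, \<open>\<delta>\<close>
      vanishes after composition with \<open>y0\<close>. Hence radical maps lift through
      \<open>u\<close>, although \<open>u\<close> was not constructed as an approximation.\<close>
    obtain E0 y0 where E0: "in_add C Ts ({1..n} - {j}) E0" "y0 \<in> Hom C E0 (Ts j)"
      "\<forall>Z h. in_add C Ts {1..n} Z \<longrightarrow> h \<in> rad C Z (Ts j) \<longrightarrow> (\<exists>h'\<in>Hom C Z E0. h = y0 \<cdot> h')"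
      by (rule radical_factor[OF j loop])
    have dy: "\<delta> \<cdot> y0 = 0" using cmp_in_Hom[OF E0(2) v(3)] in_add_Hom_zero_left[OF E0(1) X] by simp
    fix Z h assume Z: "in_add C Ts {1..n} Z" and h: "h \<in> rad C Z (Ts j)"
    obtain h' where h': "h' \<in> Hom C Z E0" "h = y0 \<cdot> h'" using E0(3) Z h by blast
    have "\<delta> \<cdot> h = 0" using h'(2) cmp_assoc[OF h'(1) E0(2) v(3)] dy cmp_zero_left[OF h'(1)] by simp
    then show "\<exists>h'\<in>Hom C Z E. h = u \<cdot> h'" using tri_lift2[OF tE rad_Hom[OF h]] by blast
  next
    fix t assume "t \<in> Hom C (Ts r) E" "u \<cdot> t = 0"
    then show "\<exists>t'\<in>Hom C (Ts r) X. t = v \<cdot> t'" using tri_lift1[OF tE] by blast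
  next
    fix s assume s: "s \<in> Hom C X (Ts r)"
    have "suspm C s \<cdot> \<delta> = 0" using cmp_in_Hom[OF v(3) suspm_Hom[OF s]] rigid[OF j r(1)] by simp
    then show "\<exists>s'\<in>Hom C E (Ts r). s = s' \<cdot> v" using tri_ext0[OF tE s] by blast
  qed
  interpret op: basic_sum "opcat C" n T Ts by (rule op_basic_sum)
  have "arrows (opcat C) T Ts r j + rmult (opcat C) (Ts r) X = rmult (opcat C) (Ts r) F"
  proof (rule op.arrows_rmult[of r F p j q X])
    show "r \<in> {1..n}" by (rule r)
    show "in_add (opcat C) Ts {1..n} F" using F' by (simp add: in_add_op)
    show "p \<in> rad (opcat C) F (Ts j)" using avoiding_Hom_rad'[OF F _ j _ p(1)] by (simp add: rad_op)
    show "q \<in> Hom (opcat C) X F" using p(2) by simp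
    show "p \<cdot>\<^bsub>opcat C\<^esub> q = 0" using tri_cmp_zero[OF tF] by simp
  next
    have loop': "arrows (opcat C) T Ts j j = 0" using loop by (simp add: arrows_op)
    obtain E0 y0 where E0: "in_add (opcat C) Ts ({1..n} - {j}) E0" "y0 \<in> Hom (opcat C) E0 (Ts j)"
      "\<forall>Z h. in_add (opcat C) Ts {1..n} Z \<longrightarrow> h \<in> rad (opcat C) Z (Ts j) \<longrightarrow>
        (\<exists>h'\<in>Hom (opcat C) Z E0. h = y0 \<cdot>\<^bsub>opcat C\<^esub> h')"
      by (rule op.radical_factor[OF j loop'])
    have E0': "in_add C Ts ({1..n} - {j}) E0" "y0 \<in> Hom C (Ts j) E0" using E0(1,2) by (simp_all add: in_add_op)
    have "Hom C X (susp C E0) = {0}" by (rule in_add_Ext_zero_right[OF E0'(1) Ext_zero_sym[OF X]])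
    then have ye: "suspm C y0 \<cdot> \<eta> = 0" using cmp_in_Hom[OF p(3) suspm_Hom[OF E0'(2)]] by simp
    fix Z h assume Z: "in_add (opcat C) Ts {1..n} Z" and h: "h \<in> rad (opcat C) Z (Ts j)"
    obtain h' where h': "h' \<in> Hom C E0 Z" "h = h' \<cdot> y0" using E0(3) Z h by (auto simp del: One_nat_def)
    have "suspm C h \<cdot> \<eta> = 0"
      using h'(2) suspm_cmp[OF E0'(2) h'(1)] cmp_assoc[OF p(3) suspm_Hom[OF E0'(2)] suspm_Hom[OF h'(1)]] ye
        cmp_zero_right[OF suspm_Hom[OF h'(1)]] by simp
    moreover have "h \<in> Hom C (Ts j) Z" using h' cmp_in_Hom[OF E0'(2)] by simp
    ultimately obtain g where "g \<in> Hom C F Z" "h = g \<cdot> p" using tri_ext0[OF tF] by blast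
    then show "\<exists>h'\<in>Hom (opcat C) Z F. h = p \<cdot>\<^bsub>opcat C\<^esub> h'" by auto
  next
    fix t assume "t \<in> Hom (opcat C) (Ts r) F" "p \<cdot>\<^bsub>opcat C\<^esub> t = 0"
    then obtain t' where "t' \<in> Hom C X (Ts r)" "t = t' \<cdot> q" using tri_ext1[OF tF, of t] by auto
    then show "\<exists>t'\<in>Hom (opcat C) (Ts r) X. t = q \<cdot>\<^bsub>opcat C\<^esub> t'" by auto
  next
    fix s assume "s \<in> Hom (opcat C) X (Ts r)"
    then have s: "s \<in> Hom C (Ts r) X" by simp
    have "\<eta> \<cdot> s = 0" using cmp_in_Hom[OF s p(3)] rigid[OF r(1) j] by simp
    then obtain s' where "s' \<in> Hom C (Ts r) F" "s = q \<cdot> s'" using tri_lift2[OF tF s] by blast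
    then show "\<exists>s'\<in>Hom (opcat C) F (Ts r). s = s' \<cdot>\<^bsub>opcat C\<^esub> q" by auto
  qed
  \<comment> \<open>Passing to the opposite category has exchanged the arguments of
    \<open>rmult\<close>, which is harmless as \<open>Ts r\<close> is indecomposable.\<close>
  then show "arrows C T Ts j r + rmult C (Ts r) X = rmult C (Ts r) F"
    by (simp add: arrows_op rmult_op rmult_commute[OF ind[OF r(1)]])
qed

end


section \<open>Mutation\<close>

text \<open>Formulated symmetrically in the two cluster-tilting objects, so that their roles can be
  exchanged.\<close>

locale mutation_pair = two_CY_category_with_cto C
  for C :: "('o, 'm::ab_group_add, 'k::alg_closed_field) tricat" (structure) +
  fixes n k :: nat and T T' :: 'o and Ts Ts' :: "nat \<Rightarrow> 'o"
  assumes ct1: "cluster_tilting C T" and dsum1: "is_dsum C {1..n} Ts T"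
    and ind1: "i \<in> {1..n} \<Longrightarrow> indecomposable C (Ts i)"
    and ct2: "cluster_tilting C T'" and dsum2: "is_dsum C {1..n} Ts' T'"
    and ind2: "i \<in> {1..n} \<Longrightarrow> indecomposable C (Ts' i)"
    and k: "k \<in> {1..n}" and agree: "i \<noteq> k \<Longrightarrow> Ts' i = Ts i"
    and noniso_k: "\<not> isomorphic C (Ts' k) (Ts k)"
    and loops1: "no_loops C n T Ts" and loops2: "no_loops C n T' Ts'"

sublocale mutation_pair \<subseteq> old: cluster_sum C n T Ts
  by unfold_locales (use ct1 dsum1 ind1 in auto)

sublocale mutation_pair \<subseteq> new: cluster_sum C n T' Ts'
  by unfold_locales (use ct2 dsum2 ind2 in auto)

context mutation_pair
begin

lemma mutation_pair_swap: "mutation_pair C n k T' T Ts' Ts"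
proof -
  have "\<not> isomorphic C (Ts k) (Ts' k)" using noniso_k isomorphic_sym by blast
  then show ?thesis
    by unfold_locales (use ct1 dsum1 ind1 ct2 dsum2 ind2 k agree loops1 loops2 in auto)
qed

lemma loop1: "i \<in> {1..n} \<Longrightarrow> arrows C T Ts i i = 0"
  using loops1 unfolding no_loops_def by blast

lemma loop2: "i \<in> {1..n} \<Longrightarrow> arrows C T' Ts' i i = 0"
  using loops2 unfolding no_loops_def by blast

lemma in_add_common: "k \<notin> I \<Longrightarrow> in_add C Ts' I X = in_add C Ts I X"
  by (rule in_add_cong, rule agree) blast

section \<open>Extensions between the two exchanged summands\<close>

lemma rigid_mixed:
  assumes "i \<in> {1..n}" "j \<in> {1..n}" "i \<noteq> k \<or> j \<noteq> k"
  shows "Hom C (Ts i) (susp C (Ts' j)) = {0}" "Hom C (Ts' i) (susp C (Ts j)) = {0}"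
proof -
  show "Hom C (Ts i) (susp C (Ts' j)) = {0}"
  proof (cases "i = k")
    case True
    then show ?thesis using old.rigid assms agree[of j] by simp
  next
    case False
    then show ?thesis using new.rigid assms agree[of i] by metis
  qed
  show "Hom C (Ts' i) (susp C (Ts j)) = {0}"
  proof (cases "i = k")
    case True
    then show ?thesis using new.rigid assms agree[of j] by metis
  next
    case False
    then show ?thesis using old.rigid assms agree[of i] by simp
  qed
qed

text \<open>Otherwise \<open>Ts' k\<close> would lie in \<open>add T\<close>; but all maps to it
  from the \<open>Ts i\<close> are radical, so its identity would be radical.\<close>

lemma Ext_k_nonzero: "Hom C (Ts k) (susp C (Ts' k)) \<noteq> {0}"
proof
  assume 0: "Hom C (Ts k) (susp C (Ts' k)) = {0}"
  have "Hom C (Ts i) (susp C (Ts' k)) = {0}" if "i \<in> {1..n}" for i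
    using rigid_mixed(1)[OF that k] 0 by (cases "i = k") auto
  then have T: "in_add C Ts {1..n} (Ts' k)" by (rule old.ct_mem)
  have "idm C (Ts' k) \<in> rad C (Ts' k) (Ts' k)"
  proof (rule in_add_rad_left[OF T idm_in_Hom])
    fix i a assume i: "i \<in> {1..n}" and a: "a \<in> Hom C (Ts i) (Ts' k)"
    have "\<not> isomorphic C (Ts i) (Ts' k)"
    proof (cases "i = k")
      case True
      then show ?thesis using noniso_k isomorphic_sym by blast
    next
      case False
      then show ?thesis using new.noniso[OF i k] agree[of i] by simp
    qed
    then have "a \<in> rad C (Ts i) (Ts' k)" using nonisomorphic_Hom_rad ind1 ind2 i k a by blast
    then show "idm C (Ts' k) \<cdot> a \<in> rad C (Ts i) (Ts' k)" by (rule rad_cmp_left) simp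
  qed
  then show False using indecomposable_idm_not_rad[OF ind2[OF k]] by blast
qed

text \<open>
  Let \<open>X\<close> be the exchange partner of \<open>Ts k\<close> obtained from an approximation. Any nonzero
  \<open>\<delta> : Ts k \<rightarrow> \<Sigma> Ts' k\<close> pairs nontrivially with some \<open>\<Sigma>\<beta>\<close>, \<open>\<beta> : Ts' k \<rightarrow> \<Sigma> Ts k\<close>; as \<open>\<beta>\<close> factors through
  \<open>X\<close>, the generator of \<open>Ext\<^sup>1(Ts k, X)\<close> is \<open>\<Sigma>d \<delta>\<close> for some \<open>d\<close>. Conversely all elements of
  \<open>Ext\<^sup>1(Ts k, Ts' k)\<close> come from that generator, hence they are multiples of \<open>\<delta>\<close> because the radical
  of \<open>End(Ts' k)\<close> acts by zero.
\<close>

lemma Ext_k_spans: obtains \<delta> where "spans \<delta> (Hom C (Ts k) (susp C (Ts' k)))"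
proof -
  have sub: "{k} \<subseteq> {1..n}" and arr: "\<And>b. b \<in> {k} \<Longrightarrow> arrows C T Ts b k = 0" using k loop1 by auto
  obtain E0 y where E0: "in_add C Ts ({1..n} - {k}) E0" "y \<in> Hom C E0 (Ts k)"
    "\<forall>i\<in>{1..n}. \<forall>h\<in>rad C (Ts i) (Ts k). \<exists>h'\<in>Hom C (Ts i) E0. h = y \<cdot> h'"
    by (rule old.radical_approx_avoiding[OF sub arr])
  obtain X v \<delta>X where X: "tri C X E0 (Ts k) v y \<delta>X" "spans \<delta>X (Hom C (Ts k) (susp C X))"
    "\<forall>i\<in>{1..n} - {k}. Hom C (Ts i) (susp C X) = {0}" "Hom C X (susp C X) = {0}"
    by (rule old.exchange_partner_exists[OF k E0])
  have X3: "\<And>i. i \<in> {1..n} - {k} \<Longrightarrow> Hom C (Ts i) (susp C X) = {0}" using X(3) by blast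
  obtain F p q \<eta> where F: "in_add C Ts ({1..n} - {k}) F" "tri C (Ts k) F X p q \<eta>" "\<eta> \<noteq> 0"
    by (rule old.left_exchange_triangle[OF k X3 X(4,2)])
  note p = triD[OF F(2)] and dX = triD(3)[OF X(1)]
  obtain E1 y1 where E1: "in_add C Ts' ({1..n} - {k}) E1" "y1 \<in> Hom C E1 (Ts' k)"
    "\<forall>Z h. in_add C Ts' {1..n} Z \<longrightarrow> h \<in> rad C Z (Ts' k) \<longrightarrow> (\<exists>h'\<in>Hom C Z E1. h = y1 \<cdot> h')"
    by (rule new.radical_factor[OF k loop2[OF k]])
  have Ext_E1: "Hom C (Ts k) (susp C E1) = {0}"
    using rigid_mixed(1)[OF k] by (intro in_add_Ext_zero_right[OF E1(1)]) auto
  have Ext_F: "Hom C (Ts' k) (susp C F) = {0}"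
    using rigid_mixed(2)[OF k] by (intro in_add_Ext_zero_right[OF F(1)]) auto
  have Ext_E0: "Hom C E0 (susp C (Ts' k)) = {0}"
    using rigid_mixed(1)[OF _ k] by (intro in_add_Hom_zero_left[OF E0(1)]) auto
  obtain \<delta> where \<delta>: "\<delta> \<in> Hom C (Ts k) (susp C (Ts' k))" "\<delta> \<noteq> 0" using Ext_k_nonzero zero_in_Hom by blast
  obtain b where b: "b \<in> Hom C (susp C (Ts' k)) (susp C (susp C (Ts k)))" "b \<cdot> \<delta> \<noteq> 0"
    using CY_pairing[OF \<delta>] by blast
  obtain \<beta> where \<beta>: "\<beta> \<in> Hom C (Ts' k) (susp C (Ts k))" "b = suspm C \<beta>" using b(1) by (rule suspm_surj)
  have "suspm C p \<cdot> \<beta> = 0" using cmp_in_Hom[OF \<beta>(1) suspm_Hom[OF p(1)]] Ext_F by simp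
  then obtain d where d: "d \<in> Hom C (Ts' k) X" "\<beta> = \<eta> \<cdot> d" using tri_lift3[OF F(2) \<beta>(1)] by blast
  have "b \<cdot> \<delta> = suspm C \<eta> \<cdot> (suspm C d \<cdot> \<delta>)"
    using \<beta>(2) d(2) suspm_cmp[OF d(1) p(3)] cmp_assoc[OF \<delta>(1) suspm_Hom[OF d(1)] suspm_Hom[OF p(3)]] by simp
  then have nz: "suspm C d \<cdot> \<delta> \<noteq> 0" using b(2) cmp_zero_right[OF suspm_Hom[OF p(3)]] by metis
  note d\<delta> = cmp_in_Hom[OF \<delta>(1) suspm_Hom[OF d(1)]]
  obtain c where c: "suspm C d \<cdot> \<delta> = scl C c \<delta>X" using X(2) d\<delta> unfolding spans_def by blast
  have c0: "c \<noteq> 0" using nz c by auto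
  have \<delta>X: "\<delta>X = scl C (1 / c) (suspm C d \<cdot> \<delta>)" using c c0 by simp
  have "\<exists>c. \<delta>2 = scl C c \<delta>" if \<delta>2: "\<delta>2 \<in> Hom C (Ts k) (susp C (Ts' k))" for \<delta>2
  proof -
    have "\<delta>2 \<cdot> y = 0" using cmp_in_Hom[OF E0(2) \<delta>2] Ext_E0 by simp
    then obtain h where h: "h \<in> Hom C (susp C X) (susp C (Ts' k))" "\<delta>2 = h \<cdot> \<delta>X" using tri_ext2[OF X(1) \<delta>2] by blast
    obtain e where e: "e \<in> Hom C X (Ts' k)" "h = suspm C e" using h(1) by (rule suspm_surj)
    note ed = cmp_in_Hom[OF d(1) e(1)]
    have 1: "\<delta>2 = scl C (1 / c) (suspm C (e \<cdot> d) \<cdot> \<delta>)"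
      using h(2) e(2) \<delta>X cmp_scl_right[OF d\<delta> suspm_Hom[OF e(1)]] suspm_cmp[OF d(1) e(1)]
        cmp_assoc[OF \<delta>(1) suspm_Hom[OF d(1)] suspm_Hom[OF e(1)]] by simp
    \<comment> \<open>The radical part of \<open>e \<cdot> d\<close> factors through
      \<open>E1\<close>, a sum of common summands, to whose suspension \<open>Ts k\<close> has no
      nonzero maps.\<close>
    obtain l where l: "e \<cdot> d - scl C l (idm C (Ts' k)) \<in> rad C (Ts' k) (Ts' k)"
      using end_scalar_plus_rad[OF ind2[OF k] ed] by blast
    let ?r = "e \<cdot> d - scl C l (idm C (Ts' k))"
    obtain h' where h': "h' \<in> Hom C (Ts' k) E1" "?r = y1 \<cdot> h'" using E1(3) in_add_self[OF k] l by blast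
    have "suspm C h' \<cdot> \<delta> = 0" using cmp_in_Hom[OF \<delta>(1) suspm_Hom[OF h'(1)]] Ext_E1 by simp
    then have r0: "suspm C ?r \<cdot> \<delta> = 0"
      using h'(2) suspm_cmp[OF h'(1) E1(2)] cmp_assoc[OF \<delta>(1) suspm_Hom[OF h'(1)] suspm_Hom[OF E1(2)]]
        cmp_zero_right[OF suspm_Hom[OF E1(2)]] by simp
    have "e \<cdot> d = ?r + scl C l (idm C (Ts' k))" by simp
    then have "suspm C (e \<cdot> d) = suspm C ?r + scl C l (idm C (susp C (Ts' k)))"
      using suspm_add[OF rad_Hom[OF l] Hom_scl[OF idm_in_Hom]] suspm_scl[OF idm_in_Hom] suspm_idm by metis
    then have "suspm C (e \<cdot> d) \<cdot> \<delta> = scl C l \<delta>"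
      using cmp_add_left[OF \<delta>(1) suspm_Hom[OF rad_Hom[OF l]] Hom_scl[OF idm_in_Hom]] r0
        cmp_scl_left[OF \<delta>(1) idm_in_Hom] cmp_idm_left[OF \<delta>(1)] by simp
    then have "\<delta>2 = scl C (1 / c * l) \<delta>" using 1 by simp
    then show ?thesis by blast
  qed
  then have "spans \<delta> (Hom C (Ts k) (susp C (Ts' k)))" unfolding spans_def using \<delta> by blast
  then show ?thesis by (rule that)
qed

lemma exchange_triangles_k:
  obtains E u v \<delta> F p q \<eta> where
    "in_add C Ts ({1..n} - {k}) E" "tri C (Ts' k) E (Ts k) v u \<delta>" "\<delta> \<noteq> 0"
    "in_add C Ts ({1..n} - {k}) F" "tri C (Ts k) F (Ts' k) p q \<eta>" "\<eta> \<noteq> 0"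
    "hdim C (Ext1 C (Ts k) (Ts' k)) = 1"
proof -
  obtain \<delta> where \<delta>: "spans \<delta> (Hom C (Ts k) (susp C (Ts' k)))" by (rule Ext_k_spans)
  have R: "\<And>i. i \<in> {1..n} - {k} \<Longrightarrow> Hom C (Ts i) (susp C (Ts' k)) = {0}" using rigid_mixed(1)[OF _ k] by blast
  obtain E u v where E: "in_add C Ts ({1..n} - {k}) E" "tri C (Ts' k) E (Ts k) v u \<delta>"
    by (rule old.right_exchange_triangle[OF k R new.rigid[OF k k] \<delta>])
  obtain F p q \<eta> where F: "in_add C Ts ({1..n} - {k}) F" "tri C (Ts k) F (Ts' k) p q \<eta>" "\<eta> \<noteq> 0"
    by (rule old.left_exchange_triangle[OF k R new.rigid[OF k k] \<delta>])
  have "hdim C (Ext1 C (Ts k) (Ts' k)) = 1" unfolding Ext1_def by (rule spans_hdim[OF \<delta>])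
  moreover have "\<delta> \<noteq> 0" using \<delta> unfolding spans_def by blast
  ultimately show ?thesis using that E F by blast
qed

lemma rmult_new_k: "r \<in> {1..n} \<Longrightarrow> r \<noteq> k \<Longrightarrow> rmult C (Ts r) (Ts' k) = 0"
  using new.rmult_Ts[OF _ k, of r] agree[of r] by simp

lemma rmult_old_k: "r \<in> {1..n} \<Longrightarrow> r \<noteq> k \<Longrightarrow> rmult C (Ts r) (Ts k) = 0"
  using old.rmult_Ts[OF _ k, of r] by simp

text \<open>The same two triangles are exchange triangles for \<open>T\<close> and, in the other
  order, for \<open>T'\<close>. The surplus in \<open>exchange_arrows\<close> vanishes because
  neither \<open>Ts' k\<close> nor \<open>Ts k\<close> contains \<open>Ts r\<close>.\<close>

lemma middle_terms_k:
  assumes E: "in_add C Ts ({1..n} - {k}) E" "tri C (Ts' k) E (Ts k) v u \<delta>"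
    and F: "in_add C Ts ({1..n} - {k}) F" "tri C (Ts k) F (Ts' k) p q \<eta>"
    and r: "r \<in> {1..n}" "r \<noteq> k"
  shows "arrows C T Ts r k = rmult C (Ts r) E" "arrows C T Ts k r = rmult C (Ts r) F"
    "arrows C T' Ts' r k = rmult C (Ts r) F" "arrows C T' Ts' k r = rmult C (Ts r) E"
proof -
  have R: "\<And>i. i \<in> {1..n} - {k} \<Longrightarrow> Hom C (Ts i) (susp C (Ts' k)) = {0}" using rigid_mixed(1)[OF _ k] by blast
  have R': "\<And>i. i \<in> {1..n} - {k} \<Longrightarrow> Hom C (Ts' i) (susp C (Ts k)) = {0}" using rigid_mixed(2)[OF _ k] by blast
  have E': "in_add C Ts' ({1..n} - {k}) E" and F': "in_add C Ts' ({1..n} - {k}) F"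
    using E(1) F(1) in_add_common by auto
  show "arrows C T Ts r k = rmult C (Ts r) E" "arrows C T Ts k r = rmult C (Ts r) F"
    using old.exchange_arrows[OF k loop1[OF k] r E(1) F(1) E(2) F(2) R] rmult_new_k[OF r] by simp_all
  show "arrows C T' Ts' r k = rmult C (Ts r) F" "arrows C T' Ts' k r = rmult C (Ts r) E"
    using new.exchange_arrows[OF k loop2[OF k] r F' E' F(2) E(2) R'] rmult_old_k[OF r] agree[OF r(2)] by simp_all
qed

text \<open>
  The summands \<open>Ts k\<close> of \<open>X\<close> are replaced by \<open>F\<close> one at a time.
\<close>

lemma replace_k_summands:
  assumes F: "in_add C Ts ({1..n} - {k}) F" and tF: "tri C (Ts k) F (Ts' k) p q \<eta>"
    and X: "in_add C Ts {1..n} X"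
  shows "\<exists>X2 Z c d e. tri C X X2 Z c d e \<and> in_add C Ts ({1..n} - {k}) X2 \<and> in_add C Ts' {1..n} Z \<and>
    (\<forall>r\<in>{1..n} - {k}. rmult C (Ts r) Z = 0 \<and>
      rmult C (Ts r) X2 = rmult C (Ts r) X + rmult C (Ts k) X * rmult C (Ts r) F)"
  using X
proof (induction "rmult C (Ts k) X" arbitrary: X)
  case 0
  obtain Z where Z: "zero_object C Z" using zero_object_exists by blast
  have "Hom C (Ts k) X = rad C (Ts k) X" using rmult_0_rad 0 by simp
  then have "in_add C Ts ({1..n} - {k}) X" using in_add_drop[OF 0(2), of k] by simp
  moreover have "tri C X X Z (idm C X) 0 0" by (rule tri_idm[OF Z])
  ultimately show ?case using in_add_zero_object[OF Z] rmult_zero_object[OF Z] 0(1) by fastforce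
next
  case (Suc m)
  obtain X' where X': "is_biproduct C (Ts k) X' X"
    using rmult_pos_biproduct[OF ind1[OF k], of X] Suc.hyps(2) by auto
  then obtain s i t j where b: "s \<in> Hom C (Ts k) X" "i \<in> Hom C X' X" "t \<in> Hom C X (Ts k)" "j \<in> Hom C X X'"
    "t \<cdot> s = idm C (Ts k)" "j \<cdot> i = idm C X'" "t \<cdot> i = 0" "j \<cdot> s = 0" "s \<cdot> t + i \<cdot> j = idm C X"
    by (rule is_biproductE)
  have t0: "tri C (Ts k) X X' s j 0" by (rule biproduct_split_tri[OF b(1-9)])
  have "suspm C p \<cdot> 0 = 0" using cmp_zero_right[OF suspm_Hom[OF triD(1)[OF tF]]] .
  \<comment> \<open>The triangle of \<open>Ts k\<close> is pushed along the split inclusion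
    \<open>Ts k \<rightarrow> X\<close>, which trades this summand of \<open>X\<close> for
    \<open>F\<close>.\<close>
  then obtain G m1 m2 m3 where G: "tri C X G (Ts' k) m1 m2 m3" "is_biproduct C F X' G"
    by (rule tri_push[OF tF t0])
  have G_in: "in_add C Ts {1..n} G"
    by (rule in_add_biproduct[OF in_add_mono[OF F] in_add_biproduct_right[OF Suc.prems X'] G(2)]) blast
  have mF: "rmult C (Ts k) F = 0" using old.rmult_avoiding[OF F _ k] by auto
  have mk: "rmult C (Ts k) X = Suc (rmult C (Ts k) X')"
    using rmult_biproduct[OF X', of "Ts k"] rmult_self[OF ind1[OF k]] by simp
  have mG: "rmult C (Ts k) G = rmult C (Ts k) X'" using rmult_biproduct[OF G(2), of "Ts k"] mF by simp
  then have "m = rmult C (Ts k) G" using mk Suc.hyps(2) by simp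
  then obtain X2 Z' c d e where Z': "tri C G X2 Z' c d e" "in_add C Ts ({1..n} - {k}) X2" "in_add C Ts' {1..n} Z'"
    "\<forall>r\<in>{1..n} - {k}. rmult C (Ts r) Z' = 0 \<and>
      rmult C (Ts r) X2 = rmult C (Ts r) G + rmult C (Ts k) G * rmult C (Ts r) F"
    using Suc.hyps(1)[OF _ G_in] by blast
  obtain Z d' e' where Z: "tri C X X2 Z (c \<cdot> m1) d' e'"
    using tri_exists[OF cmp_in_Hom[OF triD(1)[OF G(1)] triD(1)[OF Z'(1)]]] by blast
  obtain f g where fg: "tri C (Ts' k) Z Z' f g (suspm C m2 \<cdot> e)"
    using tri_octahedral[OF G(1) Z'(1) Z] by blast
  \<comment> \<open>\<open>Z\<close> is an extension of \<open>Z'\<close> by \<open>Ts' k\<close>;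
    it splits because \<open>T'\<close> is rigid.\<close>
  have "Hom C Z' (susp C (Ts' k)) = {0}" by (rule in_add_Hom_zero_left[OF Z'(3) new.rigid[OF _ k]])
  then have "suspm C m2 \<cdot> e = 0" using triD(3)[OF fg] by simp
  then have bZ: "is_biproduct C (Ts' k) Z' Z" using split_tri_biproduct fg by simp
  have Zin: "in_add C Ts' {1..n} Z" by (rule in_add_biproduct[OF in_add_self[OF k] Z'(3) bZ])
  have "rmult C (Ts r) Z = 0 \<and> rmult C (Ts r) X2 = rmult C (Ts r) X + rmult C (Ts k) X * rmult C (Ts r) F"
    if r: "r \<in> {1..n} - {k}" for r
  proof -
    have r': "r \<in> {1..n}" "r \<noteq> k" using r by auto
    have "rmult C (Ts r) Z = 0" using rmult_biproduct[OF bZ, of "Ts r"] Z'(4) r rmult_new_k[OF r'] by simp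
    moreover have "rmult C (Ts r) X2 = rmult C (Ts r) F + rmult C (Ts r) X' + rmult C (Ts k) X' * rmult C (Ts r) F"
      using Z'(4) r rmult_biproduct[OF G(2), of "Ts r"] mG by simp
    moreover have "rmult C (Ts r) X = rmult C (Ts r) X'"
      using rmult_biproduct[OF X', of "Ts r"] rmult_old_k[OF r'] by simp
    ultimately show ?thesis using mk by simp
  qed
  then show ?case using Z Z'(2) Zin by blast
qed

text \<open>
  From the exchange triangles \<open>X \<rightarrow> Ej \<rightarrow> Ts j\<close> and \<open>Ts j \<rightarrow> Fj \<rightarrow> X\<close> for \<open>T\<close>, where \<open>Ej\<close> has no
  summand \<open>Ts k\<close>, one obtains possibly non-minimal exchange triangles \<open>X2 \<rightarrow> E2 \<rightarrow> Ts j\<close> and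
  \<open>Ts j \<rightarrow> F2 \<rightarrow> X2\<close> for \<open>T'\<close>: \<open>F2\<close> arises from \<open>Fj\<close> by replacing the summands \<open>Ts k\<close> by the middle
  term of \<open>Ts k \<rightarrow> F \<rightarrow> Ts' k\<close>, and \<open>E2\<close> is the direct sum of \<open>Ej\<close> and copies of \<open>Ts' k\<close>.
\<close>

lemma arrows_mutation:
  assumes j: "j \<in> {1..n}" "j \<noteq> k" and kj: "arrows C T Ts k j = 0" and r: "r \<in> {1..n}" "r \<noteq> j" "r \<noteq> k"
  shows "int (arrows C T' Ts' r j) - int (arrows C T' Ts' j r) =
    int (arrows C T Ts r j) - int (arrows C T Ts j r) - int (arrows C T Ts j k) * int (arrows C T Ts k r)"
proof -
  obtain Ek uk vk \<delta>k F pk qk \<eta>k where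
    Ek: "in_add C Ts ({1..n} - {k}) Ek" "tri C (Ts' k) Ek (Ts k) vk uk \<delta>k" "\<delta>k \<noteq> 0" and
    F: "in_add C Ts ({1..n} - {k}) F" "tri C (Ts k) F (Ts' k) pk qk \<eta>k" "\<eta>k \<noteq> 0"
    and "hdim C (Ext1 C (Ts k) (Ts' k)) = 1"
    by (rule exchange_triangles_k)
  have aF: "arrows C T Ts k i = rmult C (Ts i) F" if "i \<in> {1..n}" "i \<noteq> k" for i
    using middle_terms_k(2)[OF Ek(1,2) F(1,2) that] .
  \<comment> \<open>Having neither a loop at \<open>j\<close> nor an arrow
    \<open>k \<rightarrow> j\<close>, the approximation can avoid both \<open>Ts j\<close> and
    \<open>Ts k\<close>.\<close>
  have sub: "{j, k} \<subseteq> {1..n}" and arr: "\<And>b. b \<in> {j, k} \<Longrightarrow> arrows C T Ts b j = 0" using j k kj loop1 by auto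
  obtain Ej y where Ej: "in_add C Ts ({1..n} - {j, k}) Ej" "y \<in> Hom C Ej (Ts j)"
    "\<forall>i\<in>{1..n}. \<forall>h\<in>rad C (Ts i) (Ts j). \<exists>h'\<in>Hom C (Ts i) Ej. h = y \<cdot> h'"
    by (rule old.radical_approx_avoiding[OF sub arr])
  have Ej': "in_add C Ts ({1..n} - {j}) Ej" by (rule in_add_mono[OF Ej(1)]) blast
  obtain X v \<delta> where X: "tri C X Ej (Ts j) v y \<delta>" "spans \<delta> (Hom C (Ts j) (susp C X))"
    "\<forall>i\<in>{1..n} - {j}. Hom C (Ts i) (susp C X) = {0}" "Hom C X (susp C X) = {0}"
    by (rule old.exchange_partner_exists[OF j(1) Ej' Ej(2,3)])
  have X3: "\<And>i. i \<in> {1..n} - {j} \<Longrightarrow> Hom C (Ts i) (susp C X) = {0}" using X(3) by blast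
  have X3': "\<And>i. i \<in> {1..n} - {j} \<Longrightarrow> Hom C X (susp C (Ts i)) = {0}" using Ext_zero_sym[OF X3] .
  obtain Fj p q \<eta> where Fj: "in_add C Ts ({1..n} - {j}) Fj" "tri C (Ts j) Fj X p q \<eta>" "\<eta> \<noteq> 0"
    by (rule old.left_exchange_triangle[OF j(1) X3 X(4,2)])
  have Fj': "in_add C Ts {1..n} Fj" by (rule in_add_mono[OF Fj(1)]) blast
  obtain F2 Z c d e where Z: "tri C Fj F2 Z c d e" "in_add C Ts ({1..n} - {k}) F2" "in_add C Ts' {1..n} Z"
    and mZ: "\<forall>r\<in>{1..n} - {k}. rmult C (Ts r) Z = 0 \<and>
      rmult C (Ts r) F2 = rmult C (Ts r) Fj + rmult C (Ts k) Fj * rmult C (Ts r) F"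
    using replace_k_summands[OF F(1,2) Fj'] by blast
  note p = triD[OF Fj(2)] and c = triD[OF Z(1)]
  have cp: "c \<cdot> p \<in> Hom C (Ts j) F2" by (rule cmp_in_Hom[OF p(1) c(1)])
  \<comment> \<open>The new partner of \<open>Ts j\<close> is the third object over the composite
    \<open>Ts j \<rightarrow> Fj \<rightarrow> F2\<close>; by the octahedral axiom it is an
    extension of \<open>Z\<close> by \<open>X\<close>.\<close>
  obtain X2 p2 q2 where X2: "tri C (Ts j) F2 X2 (c \<cdot> p) p2 q2" using tri_exists[OF cp] by blast
  note p2 = triD[OF X2]
  obtain f g where fg: "tri C X X2 Z f g (suspm C q \<cdot> e)"
    using tri_octahedral[OF Fj(2) Z(1) X2] by blast
  have Z_common: "Hom C Z (susp C Y) = {0}" if Y: "in_add C Ts ({1..n} - {k}) Y" for Y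
    using rigid_mixed(2) by (intro in_add_Ext_zero[OF Z(3) Y]) auto
  have Ejk: "in_add C Ts ({1..n} - {k}) Ej" by (rule in_add_mono[OF Ej(1)]) blast
  \<comment> \<open>Vanishes since \<open>Z\<close> lies in \<open>add T'\<close> and
    \<open>Ej\<close> consists of common summands; this lets the triangle over \<open>Ts j\<close>
    be pushed from \<open>X\<close> to \<open>X2\<close>.\<close>
  have "suspm C v \<cdot> (suspm C q \<cdot> e) = 0"
    using cmp_in_Hom[OF triD(3)[OF fg] suspm_Hom[OF triD(1)[OF X(1)]]] Z_common[OF Ejk] by simp
  then obtain E2 v2 u2 \<delta>2 where E2: "tri C X2 E2 (Ts j) v2 u2 \<delta>2" "is_biproduct C Ej Z E2"
    by (rule tri_push[OF X(1) fg])
  \<comment> \<open>The multiplicity of \<open>Ts j\<close> in \<open>F\<close> is the number of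
    arrows \<open>k \<rightarrow> j\<close>, which is zero.\<close>
  have Fkj: "in_add C Ts ({1..n} - {k} - {j}) F"
    using in_add_drop[OF F(1), of j] rmult_0_rad[of "Ts j" F] aF[OF j] kj by simp
  have Fj_j: "in_add C Ts ({1..n} - {j}) F" by (rule in_add_mono[OF Fkj]) blast
  have "Hom C (Ts' i) (susp C X2) = {0}" if i: "i \<in> {1..n} - {j}" for i
  proof (cases "i = k")
    case False
    have "Hom C (Ts i) (susp C Z) = {0}"
      using i False rigid_mixed(1)[of i] by (intro in_add_Ext_zero_right[OF Z(3)]) auto
    then have "Hom C (Ts i) (susp C X2) = {0}" using tri_Hom_susp_zero[OF fg X3[OF i]] by blast
    then show ?thesis using agree[OF False] by simp
  next
    case True
    have F2_k: "Hom C F2 (susp C (Ts' k)) = {0}"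
      using rigid_mixed(1)[OF _ k] by (intro in_add_Hom_zero_left[OF Z(2)]) auto
    \<comment> \<open>\<open>h\<close> comes from a map \<open>l : Ts j \<rightarrow> Ts' k\<close>.
      It lifts to \<open>F\<close>, and the lift extends over \<open>Fj\<close> and then over
      \<open>F2\<close>; so \<open>l\<close> factors through \<open>c \<cdot> p\<close>, whose
      suspension annihilates \<open>q2\<close>.\<close>
    have "h = 0" if h: "h \<in> Hom C X2 (susp C (Ts' k))" for h
    proof -
      have "h \<cdot> p2 = 0" using cmp_in_Hom[OF p2(2) h] F2_k by simp
      then obtain l' where l': "l' \<in> Hom C (susp C (Ts j)) (susp C (Ts' k))" "h = l' \<cdot> q2" using tri_ext2[OF X2 h] by blast
      obtain l where l: "l \<in> Hom C (Ts j) (Ts' k)" "l' = suspm C l" using l'(1) by (rule suspm_surj)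
      have "\<eta>k \<cdot> l = 0" using cmp_in_Hom[OF l(1) triD(3)[OF F(2)]] old.rigid[OF j(1) k] by simp
      then obtain l1 where l1: "l1 \<in> Hom C (Ts j) F" "l = qk \<cdot> l1" using tri_lift2[OF F(2) l(1)] by blast
      have "Hom C X (susp C F) = {0}" by (rule in_add_Ext_zero_right[OF Fj_j X3'])
      then have "suspm C l1 \<cdot> \<eta> = 0" using cmp_in_Hom[OF p(3) suspm_Hom[OF l1(1)]] by simp
      then obtain l2 where l2: "l2 \<in> Hom C Fj F" "l1 = l2 \<cdot> p" using tri_ext0[OF Fj(2) l1(1)] by blast
      have "suspm C l2 \<cdot> e = 0" using cmp_in_Hom[OF c(3) suspm_Hom[OF l2(1)]] Z_common[OF F(1)] by simp
      then obtain l3 where l3: "l3 \<in> Hom C F2 F" "l2 = l3 \<cdot> c" using tri_ext0[OF Z(1) l2(1)] by blast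
      note qk = triD(2)[OF F(2)]
      have ql3: "qk \<cdot> l3 \<in> Hom C F2 (Ts' k)" by (rule cmp_in_Hom[OF l3(1) qk])
      have "l = (qk \<cdot> l3) \<cdot> (c \<cdot> p)"
        using l1(2) l2(2) l3(2) cmp_assoc[OF p(1) c(1) l3(1)] cmp_assoc[OF cp l3(1) qk] by simp
      then have "l' \<cdot> q2 = suspm C (qk \<cdot> l3) \<cdot> (suspm C (c \<cdot> p) \<cdot> q2)"
        using l(2) suspm_cmp[OF cp ql3] cmp_assoc[OF p2(3) suspm_Hom[OF cp] suspm_Hom[OF ql3]] by simp
      then show "h = 0" using l'(2) tri_cmp_zero''[OF X2] cmp_zero_right[OF suspm_Hom[OF ql3]] by simp
    qed
    then have "Hom C X2 (susp C (Ts' k)) = {0}" by auto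
    then show ?thesis using Ext_zero_sym True by blast
  qed
  note X2_zero = this
  have mZ0: "rmult C (Ts i) Z = 0" if "i \<in> {1..n}" "i \<noteq> k" for i using mZ that by blast
  have Zj: "in_add C Ts' ({1..n} - {j}) Z"
    using in_add_drop[OF Z(3), of j] rmult_0_rad[OF mZ0[OF j]] agree[OF j(2)] by simp
  have "in_add C Ts' ({1..n} - {j, k}) Ej" using Ej(1) in_add_common[of "{1..n} - {j, k}" Ej] by blast
  then have "in_add C Ts' ({1..n} - {j}) Ej" by (rule in_add_mono) blast
  then have E2in: "in_add C Ts' ({1..n} - {j}) E2" using in_add_biproduct[OF _ Zj E2(2)] by blast
  have "rmult C (Ts j) Fj = 0" using old.rmult_avoiding[OF Fj(1) _ j(1)] by blast
  moreover have "rmult C (Ts j) F = 0" using aF[OF j] kj by simp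
  ultimately have "rmult C (Ts j) F2 = 0" using mZ j by simp
  then have "in_add C Ts ({1..n} - {k} - {j}) F2" using in_add_drop[OF Z(2), of j] rmult_0_rad by blast
  then have "in_add C Ts' ({1..n} - {k} - {j}) F2" using in_add_common[of "{1..n} - {k} - {j}" F2] by blast
  then have F2in: "in_add C Ts' ({1..n} - {j}) F2" by (rule in_add_mono) blast
  have "tri C X2 E2 (Ts' j) v2 u2 \<delta>2" "tri C (Ts' j) F2 X2 (c \<cdot> p) p2 q2"
    using E2(1) X2 agree[OF j(2)] by simp_all
  note new = new.exchange_arrows[OF j(1) loop2[OF j(1)] r(1,2) E2in F2in this X2_zero]
  note old = old.exchange_arrows[OF j(1) loop1[OF j(1)] _ _ Ej' Fj(1) X(1) Fj(2) X3]
  \<comment> \<open>As \<open>Ej\<close> avoids \<open>Ts k\<close>, so does \<open>X\<close>; hence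
    the multiplicity of \<open>Ts k\<close> in \<open>Fj\<close> is exactly the number of arrows
    \<open>j \<rightarrow> k\<close>.\<close>
  have "rmult C (Ts k) Ej = 0" using old.rmult_avoiding[OF Ej(1) _ k] by blast
  then have mk: "rmult C (Ts k) Fj = arrows C T Ts j k" using old[of k] k j(2) by simp
  have "rmult C (Ts r) E2 = rmult C (Ts r) Ej"
    using rmult_biproduct[OF E2(2), of "Ts r"] mZ0[OF r(1,3)] by simp
  moreover have "rmult C (Ts r) F2 = rmult C (Ts r) Fj + arrows C T Ts j k * arrows C T Ts k r"
    using mZ r mk aF[OF r(1,3)] by simp
  moreover have "Ts' r = Ts r" by (rule agree[OF r(3)])
  ultimately have 1: "arrows C T' Ts' r j + rmult C (Ts r) X2 = rmult C (Ts r) Ej"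
    "arrows C T' Ts' j r + rmult C (Ts r) X2 = rmult C (Ts r) Fj + arrows C T Ts j k * arrows C T Ts k r"
    using new by simp_all
  have 2: "arrows C T Ts r j + rmult C (Ts r) X = rmult C (Ts r) Ej"
    "arrows C T Ts j r + rmult C (Ts r) X = rmult C (Ts r) Fj"
    using old[OF r(1,2)] by simp_all
  \<comment> \<open>Over the integers the unknown multiplicities in \<open>X\<close> and
    \<open>X2\<close> cancel.\<close>
  have "int (arrows C T' Ts' r j) + int (rmult C (Ts r) X2) = int (rmult C (Ts r) Ej)"
    using 1(1) by (metis of_nat_add)
  moreover have "int (arrows C T' Ts' j r) + int (rmult C (Ts r) X2) =
      int (rmult C (Ts r) Fj) + int (arrows C T Ts j k) * int (arrows C T Ts k r)"
    using 1(2) by (metis of_nat_add of_nat_mult)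
  moreover have "int (arrows C T Ts r j) + int (rmult C (Ts r) X) = int (rmult C (Ts r) Ej)"
    using 2(1) by (metis of_nat_add)
  moreover have "int (arrows C T Ts j r) + int (rmult C (Ts r) X) = int (rmult C (Ts r) Fj)"
    using 2(2) by (metis of_nat_add)
  ultimately show ?thesis by linarith
qed

end


section \<open>The split Grothendieck group\<close>

lemma hom_finprod:
  assumes "comm_group G" "comm_group H" and h: "h \<in> hom G H" and f: "f \<in> I \<rightarrow> carrier G"
  shows "h (finprod G f I) = finprod H (\<lambda>i. h (f i)) I"
proof -
  interpret G: comm_group G by fact
  interpret H: comm_group H by fact
  show ?thesis using f
  proof (induction I rule: infinite_finite_induct)
    case (insert i I)
    have "h (finprod G f (insert i I)) = h (f i \<otimes>\<^bsub>G\<^esub> finprod G f I)" using insert by simp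
    also have "\<dots> = h (f i) \<otimes>\<^bsub>H\<^esub> h (finprod G f I)" using insert.prems by (intro hom_mult[OF h]) auto
    also have "\<dots> = finprod H (\<lambda>i. h (f i)) (insert i I)"
      using insert hom_in_carrier[OF h] by (subst H.finprod_insert) auto
    finally show ?case .
  qed (use hom_one[OF h G.is_group H.is_group] in simp_all)
qed

lemma (in comm_group) finprod_int_pow:
  assumes "f \<in> I \<rightarrow> carrier G"
  shows "finprod G f I [^] (m::int) = finprod G (\<lambda>i. f i [^] m) I"
  using assms
proof (induction I rule: infinite_finite_induct)
  case (insert i I)
  have "finprod G f (insert i I) [^] m = (f i \<otimes> finprod G f I) [^] m" using insert by simp
  also have "\<dots> = f i [^] m \<otimes> finprod G f I [^] m" using insert.prems by (intro int_pow_distrib) auto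
  also have "\<dots> = finprod G (\<lambda>i. f i [^] m) (insert i I)"
    using insert by (subst finprod_insert) auto
  finally show ?case .
qed simp_all

text \<open>The coordinates, in multiplicative notation, of the linear map that sends the
  \<open>k\<close>-th basis element to its negative plus the combination with coefficients
  \<open>c\<close> and fixes the others.\<close>

lemma (in comm_group) finprod_transvection:
  fixes c g :: "'i \<Rightarrow> int"
  assumes I: "finite I" "k \<in> I" and x: "\<And>i. i \<in> I \<Longrightarrow> x i \<in> carrier G"
  shows "finprod G (\<lambda>i. (if i = k then inv (x k) \<otimes> finprod G (\<lambda>r. x r [^] c r) (I - {k}) else x i) [^] g i) I =
    finprod G (\<lambda>i. x i [^] (if i = k then - g k else g i + c i * g k)) I"
proof -
  let ?J = "I - {k}"
  let ?P = "finprod G (\<lambda>r. x r [^] c r) ?J"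
  have IJ: "I = insert k ?J" "finite ?J" "k \<notin> ?J" using I by auto
  have xk: "x k \<in> carrier G" and xJ: "\<And>i. i \<in> ?J \<Longrightarrow> x i \<in> carrier G" using I x by auto
  have P: "?P \<in> carrier G" using xJ by (intro finprod_closed) auto
  have "finprod G (\<lambda>i. (if i = k then inv (x k) \<otimes> ?P else x i) [^] g i) I =
      (inv (x k) \<otimes> ?P) [^] g k \<otimes> finprod G (\<lambda>i. (if i = k then inv (x k) \<otimes> ?P else x i) [^] g i) ?J"
    by (subst IJ(1), subst finprod_insert) (use IJ xk xJ P in auto)
  also have "finprod G (\<lambda>i. (if i = k then inv (x k) \<otimes> ?P else x i) [^] g i) ?J = finprod G (\<lambda>i. x i [^] g i) ?J"
    by (rule finprod_cong') (use xJ in auto)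
  also have "(inv (x k) \<otimes> ?P) [^] g k = x k [^] (- g k) \<otimes> finprod G (\<lambda>r. x r [^] (c r * g k)) ?J"
  proof -
    have "?P [^] g k = finprod G (\<lambda>r. (x r [^] c r) [^] g k) ?J" using xJ by (intro finprod_int_pow) auto
    also have "\<dots> = finprod G (\<lambda>r. x r [^] (c r * g k)) ?J"
      by (rule finprod_cong') (use xJ in \<open>auto simp: int_pow_pow\<close>)
    finally show ?thesis using xk P by (simp add: int_pow_distrib int_pow_inv int_pow_neg)
  qed
  also have "x k [^] (- g k) \<otimes> finprod G (\<lambda>r. x r [^] (c r * g k)) ?J \<otimes> finprod G (\<lambda>i. x i [^] g i) ?J =
      x k [^] (- g k) \<otimes> finprod G (\<lambda>i. x i [^] (c i * g k) \<otimes> x i [^] g i) ?J"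
    using xk xJ by (subst finprod_multf) (auto simp: m_assoc)
  also have "finprod G (\<lambda>i. x i [^] (c i * g k) \<otimes> x i [^] g i) ?J =
      finprod G (\<lambda>i. x i [^] (if i = k then - g k else g i + c i * g k)) ?J"
    by (rule finprod_cong') (use xJ in \<open>auto simp: int_pow_mult[symmetric] add.commute\<close>)
  also have "x k [^] (- g k) \<otimes> \<dots> = finprod G (\<lambda>i. x i [^] (if i = k then - g k else g i + c i * g k)) I"
    by (subst (2) IJ(1), subst finprod_insert) (use IJ xk xJ in auto)
  finally show ?thesis .
qed

context basic_sum
begin

abbreviation frag_T :: "('o \<Rightarrow>\<^sub>0 int) monoid" where
  "frag_T \<equiv> free_Abelian_group (add_closure C T)"

lemma frag_T_comm_group: "comm_group frag_T"
  by (rule abelian_free_Abelian_group)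

definition K0_relators :: "('o \<Rightarrow>\<^sub>0 int) set" where
  "K0_relators =
     {frag_of X - frag_of Y | X Y.
         X \<in> add_closure C T \<and> Y \<in> add_closure C T \<and> isomorphic C X Y} \<union>
      {frag_of P - frag_of X - frag_of Y | X Y P.
         X \<in> add_closure C T \<and> Y \<in> add_closure C T \<and> P \<in> add_closure C T \<and>
         is_biproduct C X Y P}"

lemma K0_relations_generate: "K0_relations C T = generate frag_T K0_relators"
  unfolding K0_relations_def K0_relators_def ..

lemma frag_diff_closed: "x \<in> carrier frag_T \<Longrightarrow> y \<in> carrier frag_T \<Longrightarrow> x - y \<in> carrier frag_T"
  using keys_diff[of x y] by auto

lemma K0_relators_subset: "K0_relators \<subseteq> carrier frag_T"
proof
  fix x assume "x \<in> K0_relators"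
  then consider X Y where "X \<in> add_closure C T" "Y \<in> add_closure C T" "x = frag_of X - frag_of Y"
    | X Y P where "X \<in> add_closure C T" "Y \<in> add_closure C T" "P \<in> add_closure C T"
      "x = frag_of P - frag_of X - frag_of Y"
    unfolding K0_relators_def by blast
  then show "x \<in> carrier frag_T"
  proof cases
    case 1
    then show ?thesis using frag_diff_closed frag_of_in_free_Abelian_group by metis
  next
    case 2
    then show ?thesis using frag_diff_closed frag_of_in_free_Abelian_group by metis
  qed
qed

lemma K0_relations_subgroup: "subgroup (K0_relations C T) frag_T"
  unfolding K0_relations_generate
  by (rule group.generate_is_subgroup[OF group_free_Abelian_group K0_relators_subset])

lemma K0_relations_normal: "K0_relations C T \<lhd> frag_T"
  by (rule comm_group.subgroup_imp_normal[OF frag_T_comm_group K0_relations_subgroup])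

lemma K0_comm_group: "comm_group (K0 C T)"
  unfolding K0_def by (rule comm_group.abelian_FactGroup[OF frag_T_comm_group K0_relations_subgroup])

abbreviation K0_proj :: "('o \<Rightarrow>\<^sub>0 int) \<Rightarrow> ('o \<Rightarrow>\<^sub>0 int) set" where
  "K0_proj x \<equiv> K0_relations C T #>\<^bsub>frag_T\<^esub> x"

lemma K0_proj_hom: "K0_proj \<in> hom frag_T (K0 C T)"
  unfolding K0_def by (rule normal.r_coset_hom_Mod[OF K0_relations_normal])

text \<open>Relators are differences, whereas \<open>K0\<close> is written multiplicatively; the
  product form avoids inverses.\<close>

lemma K0_proj_diff:
  assumes "x \<in> carrier frag_T" "y \<in> carrier frag_T"
  shows "K0_proj (x - y) \<otimes>\<^bsub>K0 C T\<^esub> K0_proj y = K0_proj x"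
  using hom_mult[OF K0_proj_hom frag_diff_closed[OF assms] assms(2)] by simp

lemma K0_proj_relator:
  assumes "x \<in> K0_relators"
  shows "K0_proj x = \<one>\<^bsub>K0 C T\<^esub>"
proof -
  have "x \<in> K0_relations C T" unfolding K0_relations_generate using assms by (rule generate.incl)
  moreover have "x \<in> carrier frag_T" using K0_relators_subset assms by blast
  ultimately have "K0_proj x = K0_relations C T"
    using group.coset_join2[OF group_free_Abelian_group _ K0_relations_subgroup] by blast
  then show ?thesis by (simp add: K0_def)
qed

lemma K0_class_closed: "X \<in> add_closure C T \<Longrightarrow> K0_class C T X \<in> carrier (K0 C T)"
  unfolding K0_class_def using hom_in_carrier[OF K0_proj_hom] frag_of_in_free_Abelian_group by metis

lemma K0_class_biproduct:
  assumes XYP: "X \<in> add_closure C T" "Y \<in> add_closure C T" "P \<in> add_closure C T" and b: "is_biproduct C X Y P"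
  shows "K0_class C T P = K0_class C T X \<otimes>\<^bsub>K0 C T\<^esub> K0_class C T Y"
proof -
  interpret K: comm_group "K0 C T" by (rule K0_comm_group)
  have f: "frag_of X \<in> carrier frag_T" "frag_of Y \<in> carrier frag_T" "frag_of P \<in> carrier frag_T"
    using XYP by simp_all
  have "frag_of P - frag_of X - frag_of Y \<in> K0_relators" unfolding K0_relators_def using XYP b by blast
  then have "K0_proj (frag_of P - frag_of X - frag_of Y) = \<one>\<^bsub>K0 C T\<^esub>" by (rule K0_proj_relator)
  then have "\<one>\<^bsub>K0 C T\<^esub> \<otimes>\<^bsub>K0 C T\<^esub> K0_proj (frag_of Y) = K0_proj (frag_of P - frag_of X)"
    using K0_proj_diff[OF frag_diff_closed[OF f(3,1)] f(2)] by simp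
  then have "K0_proj (frag_of Y) \<otimes>\<^bsub>K0 C T\<^esub> K0_proj (frag_of X) = K0_proj (frag_of P)"
    using K0_proj_diff[OF f(3,1)] K0_class_closed[OF XYP(2)] unfolding K0_class_def by simp
  then show ?thesis
    using K.m_comm K0_class_closed[OF XYP(1)] K0_class_closed[OF XYP(2)] unfolding K0_class_def by metis
qed

lemma zero_object_biproduct: "zero_object C Z \<Longrightarrow> is_biproduct C Z Z Z"
  by (rule is_biproduct_iso_zero[OF isomorphic_refl])

lemma K0_class_zero_object:
  assumes Z: "zero_object C Z"
  shows "K0_class C T Z = \<one>\<^bsub>K0 C T\<^esub>"
proof -
  interpret K: comm_group "K0 C T" by (rule K0_comm_group)
  have "Z \<in> add_closure C T" using in_add_zero_object[OF Z] add_closure_T by blast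
  then show ?thesis using K0_class_biproduct zero_object_biproduct[OF Z] K0_class_closed K.l_cancel_one by metis
qed

text \<open>The universal property: extend \<open>g\<close> to the free abelian group, observe that
  the relators lie in the kernel, and pass to the quotient.\<close>

lemma K0_hom_exists:
  assumes K: "comm_group K" and g: "\<And>X. X \<in> add_closure C T \<Longrightarrow> g X \<in> carrier K"
    and iso: "\<And>X Y. \<lbrakk>X \<in> add_closure C T; Y \<in> add_closure C T; isomorphic C X Y\<rbrakk> \<Longrightarrow> g X = g Y"
    and sum: "\<And>X Y P. \<lbrakk>X \<in> add_closure C T; Y \<in> add_closure C T; P \<in> add_closure C T; is_biproduct C X Y P\<rbrakk>
      \<Longrightarrow> g P = g X \<otimes>\<^bsub>K\<^esub> g Y"
  obtains \<phi> where "\<phi> \<in> hom (K0 C T) K" "\<forall>X\<in>add_closure C T. \<phi> (K0_class C T X) = g X"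
proof -
  interpret K: comm_group K by (rule K)
  have "g ` add_closure C T \<subseteq> carrier K" using g by blast
  then obtain h where h: "h \<in> hom frag_T K" "\<And>x. x \<in> add_closure C T \<Longrightarrow> h (frag_of x) = g x"
    by (rule K.free_Abelian_group_universal) blast
  interpret h: group_hom frag_T K h
    using h(1) group_free_Abelian_group K.is_group by (simp add: group_hom_def group_hom_axioms_def)
  have diff: "h (x - y) \<otimes>\<^bsub>K\<^esub> h y = h x" if "x \<in> carrier frag_T" "y \<in> carrier frag_T" for x y
    using hom_mult[OF h(1) frag_diff_closed[OF that] that(2)] by simp
  have one: "h (x - y) = \<one>\<^bsub>K\<^esub>" if "x \<in> carrier frag_T" "y \<in> carrier frag_T" "h x = h y" for x y
    using diff[OF that(1,2)] that(3) K.r_cancel_one[of "h y" "h (x - y)"]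
      hom_in_carrier[OF h(1) that(2)] hom_in_carrier[OF h(1) frag_diff_closed[OF that(1,2)]] by simp
  have "K0_relators \<subseteq> kernel frag_T K h"
  proof
    fix x assume x: "x \<in> K0_relators"
    then consider X Y where "X \<in> add_closure C T" "Y \<in> add_closure C T" "isomorphic C X Y" "x = frag_of X - frag_of Y"
      | X Y P where "X \<in> add_closure C T" "Y \<in> add_closure C T" "P \<in> add_closure C T" "is_biproduct C X Y P"
        "x = frag_of P - frag_of X - frag_of Y"
      unfolding K0_relators_def by blast
    then have "h x = \<one>\<^bsub>K\<^esub>"
    proof cases
      case 1
      have "frag_of X \<in> carrier frag_T" "frag_of Y \<in> carrier frag_T" using 1 by simp_all
      moreover have "h (frag_of X) = h (frag_of Y)" using 1 h(2) iso by simp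
      ultimately show ?thesis using one 1(4) by simp
    next
      case 2
      have f: "frag_of X \<in> carrier frag_T" "frag_of Y \<in> carrier frag_T" "frag_of P \<in> carrier frag_T"
        using 2 by simp_all
      have "h (frag_of P - frag_of X) \<otimes>\<^bsub>K\<^esub> g X = g P" using diff[OF f(3,1)] h(2) 2 by simp
      also have "g P = g Y \<otimes>\<^bsub>K\<^esub> g X" using sum[OF 2(1-4)] K.m_comm g 2 by simp
      finally have "h (frag_of P - frag_of X) = g Y"
        using K.right_cancel[of "g X" "h (frag_of P - frag_of X)" "g Y"] g 2
          hom_in_carrier[OF h(1) frag_diff_closed[OF f(3,1)]] by simp
      then show ?thesis using one[OF frag_diff_closed[OF f(3,1)] f(2)] h(2) 2 by simp
    qed
    then show "x \<in> kernel frag_T K h" unfolding kernel_def using x K0_relators_subset by blast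
  qed
  then have "K0_relations C T \<subseteq> kernel frag_T K h"
    unfolding K0_relations_generate
    by (rule group.generate_subgroup_incl[OF group_free_Abelian_group _ h.subgroup_kernel])
  then obtain \<phi> where \<phi>: "\<phi> \<in> hom (K0 C T) K" "\<And>x. x \<in> carrier frag_T \<Longrightarrow> \<phi> (K0_proj x) = h x"
    unfolding K0_def by (rule h.FactGroup_universal_kernel[OF K0_relations_normal]) blast
  have "\<forall>X\<in>add_closure C T. \<phi> (K0_class C T X) = g X"
    unfolding K0_class_def using \<phi>(2) h(2) by simp
  then show ?thesis using that \<phi>(1) by blast
qed

text \<open>Splitting off summands shows that the classes of the \<open>Ts i\<close> determine a
  homomorphism on all classes of objects, and these generate.\<close>

lemma K0_hom_unique:
  assumes K: "comm_group K" and h1: "h1 \<in> hom (K0 C T) K" and h2: "h2 \<in> hom (K0 C T) K"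
    and eq: "\<And>i. i \<in> {1..n} \<Longrightarrow> h1 (K0_class C T (Ts i)) = h2 (K0_class C T (Ts i))"
    and x: "x \<in> carrier (K0 C T)"
  shows "h1 x = h2 x"
proof -
  interpret K: comm_group K by (rule K)
  interpret G: comm_group "K0 C T" by (rule K0_comm_group)
  have cl: "h1 (K0_class C T X) = h2 (K0_class C T X)" if "in_add C Ts {1..n} X" for X
  proof (rule in_add_induct[where P = "\<lambda>X. h1 (K0_class C T X) = h2 (K0_class C T X)", OF that finite_atLeastAtMost ind])
    fix Z assume "zero_object C Z"
    then show "h1 (K0_class C T Z) = h2 (K0_class C T Z)"
      using K0_class_zero_object hom_one[OF h1 G.is_group K.is_group] hom_one[OF h2 G.is_group K.is_group] by simp
  next
    fix i X' X
    assume step: "i \<in> {1..n}" "in_add C Ts {1..n} X'" "h1 (K0_class C T X') = h2 (K0_class C T X')"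
      "is_biproduct C (Ts i) X' X"
    have m: "Ts i \<in> add_closure C T" "X' \<in> add_closure C T" "X \<in> add_closure C T"
      using in_add_self[OF step(1)] step(2) in_add_biproduct[OF in_add_self[OF step(1)] step(2,4)]
      by (simp_all add: add_closure_T)
    have "K0_class C T X = K0_class C T (Ts i) \<otimes>\<^bsub>K0 C T\<^esub> K0_class C T X'"
      by (rule K0_class_biproduct[OF m step(4)])
    then show "h1 (K0_class C T X) = h2 (K0_class C T X)"
      using hom_mult[OF h1] hom_mult[OF h2] K0_class_closed m eq[OF step(1)] step(3) by simp
  qed
  have "h1 (K0_proj y) = h2 (K0_proj y)" if "Poly_Mapping.keys y \<subseteq> add_closure C T" for y
  proof (rule free_Abelian_group_induct[where P = "\<lambda>y. h1 (K0_proj y) = h2 (K0_proj y)", OF that])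
    have "K0_proj 0 = \<one>\<^bsub>K0 C T\<^esub>"
      using hom_one[OF K0_proj_hom group_free_Abelian_group G.is_group] by simp
    then show "h1 (K0_proj 0) = h2 (K0_proj 0)"
      using hom_one[OF h1 G.is_group K.is_group] hom_one[OF h2 G.is_group K.is_group] by simp
  next
    fix a b assume ab: "Poly_Mapping.keys a \<subseteq> add_closure C T" "Poly_Mapping.keys b \<subseteq> add_closure C T"
      "h1 (K0_proj a) = h2 (K0_proj a)" "h1 (K0_proj b) = h2 (K0_proj b)"
    have c: "a \<in> carrier frag_T" "b \<in> carrier frag_T" using ab by simp_all
    note pr = hom_in_carrier[OF K0_proj_hom]
    note d = pr[OF frag_diff_closed[OF c]] and b = pr[OF c(2)]
    have "h1 (K0_proj (a - b)) \<otimes>\<^bsub>K\<^esub> h1 (K0_proj b) = h1 (K0_proj a)"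
      using hom_mult[OF h1 d b] K0_proj_diff[OF c] by simp
    moreover have "h2 (K0_proj (a - b)) \<otimes>\<^bsub>K\<^esub> h2 (K0_proj b) = h2 (K0_proj a)"
      using hom_mult[OF h2 d b] K0_proj_diff[OF c] by simp
    ultimately have "h1 (K0_proj (a - b)) \<otimes>\<^bsub>K\<^esub> h1 (K0_proj b) = h2 (K0_proj (a - b)) \<otimes>\<^bsub>K\<^esub> h1 (K0_proj b)"
      using ab(3,4) by simp
    then show "h1 (K0_proj (a - b)) = h2 (K0_proj (a - b))"
      using K.right_cancel[OF hom_in_carrier[OF h1 b] hom_in_carrier[OF h1 d] hom_in_carrier[OF h2 d]] by blast
  next
    fix a assume "a \<in> add_closure C T"
    then show "h1 (K0_proj (frag_of a)) = h2 (K0_proj (frag_of a))"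
      using cl[of a] add_closure_T unfolding K0_class_def by blast
  qed
  moreover obtain y where "y \<in> carrier frag_T" "x = K0_proj y"
    using x unfolding K0_def carrier_FactGroup by blast
  ultimately show ?thesis by simp
qed

text \<open>Shows that the description in \<open>K0_linear_map\<close> is meaningful. Existence: the
  product of the \<open>v i\<close> with exponents \<open>rmult C (Ts i) X\<close> respects
  isomorphisms and direct sums of objects \<open>X\<close>. In this way independence of the classes
  of the \<open>Ts i\<close> is read off from multiplicities.\<close>

lemma K0_linear_map:
  assumes K: "comm_group (K0 C T')" and v: "\<And>i. i \<in> {1..n} \<Longrightarrow> v i \<in> carrier (K0 C T')"
  shows "K0_linear_map C n T Ts T' v \<in> hom (K0 C T) (K0 C T')"
    and "i \<in> {1..n} \<Longrightarrow> K0_linear_map C n T Ts T' v (K0_class C T (Ts i)) = v i"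
proof -
  interpret K: comm_group "K0 C T'" by (rule K)
  interpret G: comm_group "K0 C T" by (rule K0_comm_group)
  define g where "g X = finprod (K0 C T') (\<lambda>i. v i [^]\<^bsub>K0 C T'\<^esub> int (rmult C (Ts i) X)) {1..n}" for X
  have vpow: "(\<lambda>i. v i [^]\<^bsub>K0 C T'\<^esub> (m i :: int)) \<in> {1..n} \<rightarrow> carrier (K0 C T')" for m
    using v by auto
  obtain \<psi> where \<psi>: "\<psi> \<in> hom (K0 C T) (K0 C T')" "\<forall>X\<in>add_closure C T. \<psi> (K0_class C T X) = g X"
  proof (rule K0_hom_exists[OF K, of g])
    show "g X \<in> carrier (K0 C T')" for X unfolding g_def by (rule K.finprod_closed[OF vpow])
    show "g X = g Y" if "isomorphic C X Y" for X Y unfolding g_def using rmult_iso[OF that] by simp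
    show "g P = g X \<otimes>\<^bsub>K0 C T'\<^esub> g Y" if "is_biproduct C X Y P" for X Y P
    proof -
      have "g P = finprod (K0 C T') (\<lambda>i. v i [^]\<^bsub>K0 C T'\<^esub> int (rmult C (Ts i) X) \<otimes>\<^bsub>K0 C T'\<^esub>
          v i [^]\<^bsub>K0 C T'\<^esub> int (rmult C (Ts i) Y)) {1..n}"
        unfolding g_def rmult_biproduct[OF that]
        by (rule K.finprod_cong') (use v in \<open>auto simp: K.int_pow_mult\<close>)
      then show ?thesis unfolding g_def using K.finprod_multf[OF vpow vpow] by simp
    qed
  qed
  have g_Ts: "g (Ts i) = v i" if i: "i \<in> {1..n}" for i
  proof -
    have "g (Ts i) = finprod (K0 C T') (\<lambda>l. if l = i then v l else \<one>\<^bsub>K0 C T'\<^esub>) {1..n}"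
      unfolding g_def by (rule K.finprod_cong') (use v i rmult_Ts in \<open>auto simp: K.int_pow_1\<close>)
    also have "\<dots> = v i" using v by (intro K.finprod_singleton_swap[OF i]) auto
    finally show ?thesis .
  qed
  \<comment> \<open>Restriction makes the map extensional, as uniqueness of the described function
    requires.\<close>
  define \<phi> where "\<phi> = restrict \<psi> (carrier (K0 C T))"
  have \<phi>1: "\<phi> \<in> hom (K0 C T) (K0 C T')"
    using \<psi>(1) G.m_closed unfolding \<phi>_def hom_def by (auto simp: Pi_iff)
  have cl: "K0_class C T (Ts i) \<in> carrier (K0 C T)" "Ts i \<in> add_closure C T" if "i \<in> {1..n}" for i
    using K0_class_closed in_add_self[OF that] by (simp_all add: add_closure_T)
  have \<phi>3: "\<forall>i\<in>{1..n}. \<phi> (K0_class C T (Ts i)) = v i"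
    using \<psi>(2) g_Ts cl unfolding \<phi>_def by simp
  let ?Q = "\<lambda>\<phi>. \<phi> \<in> hom (K0 C T) (K0 C T') \<and> \<phi> \<in> extensional (carrier (K0 C T)) \<and>
    (\<forall>i\<in>{1..n}. \<phi> (K0_class C T (Ts i)) = v i)"
  have Q\<phi>: "?Q \<phi>" using \<phi>1 \<phi>3 unfolding \<phi>_def by simp
  moreover have "\<phi>' = \<phi>" if "?Q \<phi>'" for \<phi>'
  proof (rule extensionalityI[of _ "carrier (K0 C T)"])
    show "\<phi>' \<in> extensional (carrier (K0 C T))" using that by blast
    show "\<phi> \<in> extensional (carrier (K0 C T))" using Q\<phi> by blast
    fix x assume x: "x \<in> carrier (K0 C T)"
    have "\<phi>' \<in> hom (K0 C T) (K0 C T')" "\<forall>i\<in>{1..n}. \<phi>' (K0_class C T (Ts i)) = v i" using that by blast+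
    then show "\<phi>' x = \<phi> x" using \<phi>3 by (intro K0_hom_unique[OF K _ \<phi>1 _ x]) simp_all
  qed
  ultimately have "?Q (K0_linear_map C n T Ts T' v)" unfolding K0_linear_map_def by (rule theI)
  then show "K0_linear_map C n T Ts T' v \<in> hom (K0 C T) (K0 C T')"
    and "i \<in> {1..n} \<Longrightarrow> K0_linear_map C n T Ts T' v (K0_class C T (Ts i)) = v i" by blast+
qed

end


section \<open>Tropical friezes and mutation\<close>

lemma pos_part_diff: "[b]\<^sub>+ - [- b]\<^sub>+ = b"
  unfolding pos_part_def by simp

context basic_sum
begin

lemma bmat_neg: "bmat C T Ts i j = - bmat C T Ts j i"
  unfolding bmat_def by simp

text \<open>Positive and negative parts recombine by antisymmetry of the matrix; the coefficient
  becomes linear in the matrix entries.\<close>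

lemma gcoeff_sum: "gcoeff C f n T Ts i = (\<Sum>r=1..n. bmat C T Ts r i * f (Ts r))"
proof -
  have "[bmat C T Ts r i]\<^sub>+ * f (Ts r) - [bmat C T Ts i r]\<^sub>+ * f (Ts r) = bmat C T Ts r i * f (Ts r)" for r
    using pos_part_diff[of "bmat C T Ts r i"] bmat_neg[of i r] by (metis left_diff_distrib)
  then show ?thesis unfolding gcoeff_def sum_subtractf[symmetric] by simp
qed

text \<open>Turns the value at the middle term of an exchange triangle into a sum over
  arrows.\<close>

lemma frieze_additive:
  assumes f: "tropical_frieze C f" and I: "I \<subseteq> {1..n}" and X: "in_add C Ts I X"
  shows "f X = (\<Sum>i\<in>I. int (rmult C (Ts i) X) * f (Ts i))"
proof -
  have fin: "finite I" using I finite_subset by blast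
  have sum: "f P = f X + f Y" if "is_biproduct C X Y P" for X Y P
    using f that unfolding tropical_frieze_def by blast
  have ind': "\<And>i. i \<in> I \<Longrightarrow> indecomposable C (Ts i)" using ind I by blast
  show ?thesis
  proof (rule in_add_induct[where P = "\<lambda>X. f X = (\<Sum>i\<in>I. int (rmult C (Ts i) X) * f (Ts i))", OF X fin ind'])
    fix Z assume zero: "zero_object C Z"
    have "f Z = 0" using sum[OF zero_object_biproduct[OF zero]] by simp
    then show "f Z = (\<Sum>i\<in>I. int (rmult C (Ts i) Z) * f (Ts i))" using rmult_zero_object[OF zero] by simp
  next
    fix i X' X
    assume step: "i \<in> I" "in_add C Ts I X'" "f X' = (\<Sum>i\<in>I. int (rmult C (Ts i) X') * f (Ts i))"
      "is_biproduct C (Ts i) X' X"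
    have "int (rmult C (Ts l) X) * f (Ts l) =
        (if l = i then f (Ts l) else 0) + int (rmult C (Ts l) X') * f (Ts l)" if "l \<in> I" for l
    proof -
      have li: "l \<in> {1..n}" "i \<in> {1..n}" using that step(1) I by auto
      show ?thesis using rmult_biproduct[OF step(4), of "Ts l"] rmult_Ts[OF li] by (simp add: algebra_simps)
    qed
    then have "(\<Sum>l\<in>I. int (rmult C (Ts l) X) * f (Ts l)) = f (Ts i) + (\<Sum>l\<in>I. int (rmult C (Ts l) X') * f (Ts l))"
      using fin step(1) by (simp add: sum.distrib)
    then show "f X = (\<Sum>i\<in>I. int (rmult C (Ts i) X) * f (Ts i))" using sum[OF step(4)] step(3) by simp
  qed
qed

end

lemma pos_part_arrows:
  assumes "\<not> (0 < arrows C T Ts i j \<and> 0 < arrows C T Ts j i)"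
  shows "[bmat C T Ts i j]\<^sub>+ = int (arrows C T Ts i j)"
  using assms unfolding pos_part_def bmat_def by auto

locale frieze_mutation = mutation_pair C n k T T' Ts Ts'
  for C :: "('o, 'm::ab_group_add, 'k::alg_closed_field) tricat" (structure)
    and n k T T' Ts Ts' +
  fixes f :: "'o \<Rightarrow> int"
  assumes frieze: "tropical_frieze C f"
    and no2_1: "no_2cycles C n T Ts" and no2_2: "no_2cycles C n T' Ts'"
begin

lemma no2cycle: "\<lbrakk>i \<in> {1..n}; j \<in> {1..n}\<rbrakk> \<Longrightarrow> \<not> (0 < arrows C T Ts i j \<and> 0 < arrows C T Ts j i)"
  using no2_1 loop1 unfolding no_2cycles_def by (cases "i = j") auto

text \<open>\<open>e\<close> and \<open>e'\<close> are the values of \<open>f\<close> at the two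
  middle terms, written in terms of arrows so that the triangles can be forgotten.\<close>

lemma frieze_exchange:
  obtains e e' where "f (Ts k) + f (Ts' k) = max e e'"
    "e = (\<Sum>r\<in>{1..n} - {k}. int (arrows C T Ts r k) * f (Ts r))"
    "e' = (\<Sum>r\<in>{1..n} - {k}. int (arrows C T Ts k r) * f (Ts r))"
proof -
  obtain E u v \<delta> F p q \<eta> where
    E: "in_add C Ts ({1..n} - {k}) E" "tri C (Ts' k) E (Ts k) v u \<delta>" "\<delta> \<noteq> 0" and
    F: "in_add C Ts ({1..n} - {k}) F" "tri C (Ts k) F (Ts' k) p q \<eta>" "\<eta> \<noteq> 0"
    and dim: "hdim C (Ext1 C (Ts k) (Ts' k)) = 1"
    by (rule exchange_triangles_k)
  have "nonsplit_tri C (Ts k) F (Ts' k)" "nonsplit_tri C (Ts' k) E (Ts k)"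
    unfolding nonsplit_tri_def using E(2,3) F(2,3) by blast+
  then have "f (Ts k) + f (Ts' k) = max (f F) (f E)"
    using frieze dim unfolding tropical_frieze_def by blast
  then have 1: "f (Ts k) + f (Ts' k) = max (f E) (f F)" by (simp add: max.commute)
  have 2: "f E = (\<Sum>r\<in>{1..n} - {k}. int (arrows C T Ts r k) * f (Ts r))"
    using old.frieze_additive[OF frieze _ E(1)] middle_terms_k(1)[OF E(1,2) F(1,2)]
    by (auto intro!: sum.cong)
  have 3: "f F = (\<Sum>r\<in>{1..n} - {k}. int (arrows C T Ts k r) * f (Ts r))"
    using old.frieze_additive[OF frieze _ F(1)] middle_terms_k(2)[OF E(1,2) F(1,2)]
    by (auto intro!: sum.cong)
  show ?thesis by (rule that[OF 1 2 3])
qed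

lemma arrows_swap_k:
  assumes "r \<in> {1..n}" "r \<noteq> k"
  shows "arrows C T' Ts' r k = arrows C T Ts k r" "arrows C T' Ts' k r = arrows C T Ts r k"
proof -
  obtain E u v \<delta> F p q \<eta> where
    E: "in_add C Ts ({1..n} - {k}) E" "tri C (Ts' k) E (Ts k) v u \<delta>" "\<delta> \<noteq> 0" and
    F: "in_add C Ts ({1..n} - {k}) F" "tri C (Ts k) F (Ts' k) p q \<eta>" "\<eta> \<noteq> 0"
    and "hdim C (Ext1 C (Ts k) (Ts' k)) = 1"
    by (rule exchange_triangles_k)
  show "arrows C T' Ts' r k = arrows C T Ts k r" "arrows C T' Ts' k r = arrows C T Ts r k"
    using middle_terms_k[OF E(1,2) F(1,2) assms] by simp_all
qed

lemma sum_split_k: "(\<Sum>r=1..n. h r) = h k + (\<Sum>r\<in>{1..n} - {k}. h r :: int)"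
  using k by (intro sum.remove) auto

lemma gcoeff_split_k:
  "gcoeff C f n T Ts j = bmat C T Ts k j * f (Ts k) + (\<Sum>r\<in>{1..n} - {k}. bmat C T Ts r j * f (Ts r))"
  "gcoeff C f n T' Ts' j = bmat C T' Ts' k j * f (Ts' k) + (\<Sum>r\<in>{1..n} - {k}. bmat C T' Ts' r j * f (Ts r))"
proof -
  show "gcoeff C f n T Ts j = bmat C T Ts k j * f (Ts k) + (\<Sum>r\<in>{1..n} - {k}. bmat C T Ts r j * f (Ts r))"
    unfolding old.gcoeff_sum by (rule sum_split_k)
  have "(\<Sum>r\<in>{1..n} - {k}. bmat C T' Ts' r j * f (Ts' r)) = (\<Sum>r\<in>{1..n} - {k}. bmat C T' Ts' r j * f (Ts r))"
    using agree by (intro sum.cong) auto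
  then show "gcoeff C f n T' Ts' j = bmat C T' Ts' k j * f (Ts' k) + (\<Sum>r\<in>{1..n} - {k}. bmat C T' Ts' r j * f (Ts r))"
    unfolding new.gcoeff_sum using sum_split_k[of "\<lambda>r. bmat C T' Ts' r j * f (Ts' r)"] by simp
qed

text \<open>All arrows at \<open>k\<close> are reversed, and \<open>f (Ts' k)\<close> does not occur
  because the diagonal entry is zero.\<close>

lemma gcoeff_new_k: "gcoeff C f n T' Ts' k = - gcoeff C f n T Ts k"
proof -
  have "bmat C T' Ts' r k * f (Ts r) = - (bmat C T Ts r k * f (Ts r))" if "r \<in> {1..n} - {k}" for r
    using arrows_swap_k[of r] that by (simp add: bmat_def algebra_simps)
  then have "(\<Sum>r\<in>{1..n} - {k}. bmat C T' Ts' r k * f (Ts r)) = - (\<Sum>r\<in>{1..n} - {k}. bmat C T Ts r k * f (Ts r))"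
    by (simp add: sum_negf[symmetric])
  then show ?thesis unfolding gcoeff_split_k by (simp add: bmat_def)
qed

text \<open>
  The two cases of matrix mutation; the second one is the first one read backwards, with \<open>T\<close> and
  \<open>T'\<close> exchanged.
\<close>

lemma gcoeff_new_out:
  assumes j: "j \<in> {1..n}" "j \<noteq> k" and kj: "arrows C T Ts k j = 0"
    and e': "e' = (\<Sum>r\<in>{1..n} - {k}. int (arrows C T Ts k r) * f (Ts r))"
  shows "gcoeff C f n T' Ts' j = gcoeff C f n T Ts j + int (arrows C T Ts j k) * (f (Ts k) + f (Ts' k) - e')"
proof -
  let ?m = "int (arrows C T Ts j k)"
  have "bmat C T' Ts' r j * f (Ts r) = bmat C T Ts r j * f (Ts r) - ?m * (int (arrows C T Ts k r) * f (Ts r))"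
    if r: "r \<in> {1..n} - {k}" for r
  proof (cases "r = j")
    \<comment> \<open>Both diagonal entries vanish, and so does the correction by
      \<open>kj\<close>.\<close>
    case True
    then show ?thesis using kj by (simp add: bmat_def)
  next
    case False
    then have "bmat C T' Ts' r j = bmat C T Ts r j - ?m * int (arrows C T Ts k r)"
      using arrows_mutation[OF j kj _ False] r by (simp add: bmat_def)
    then show ?thesis by (simp only:) (simp add: left_diff_distrib)
  qed
  then have "(\<Sum>r\<in>{1..n} - {k}. bmat C T' Ts' r j * f (Ts r)) = (\<Sum>r\<in>{1..n} - {k}. bmat C T Ts r j * f (Ts r)) - ?m * e'"
    unfolding e' by (simp add: sum_subtractf sum_distrib_left)
  moreover have "bmat C T' Ts' k j = ?m" using arrows_swap_k[OF j] kj by (simp add: bmat_def)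
  moreover have "bmat C T Ts k j = - ?m" using kj by (simp add: bmat_def)
  ultimately show ?thesis unfolding gcoeff_split_k by (simp add: algebra_simps)
qed

lemma gcoeff_new_in:
  assumes j: "j \<in> {1..n}" "j \<noteq> k" and jk: "arrows C T Ts j k = 0"
    and e: "e = (\<Sum>r\<in>{1..n} - {k}. int (arrows C T Ts r k) * f (Ts r))"
  shows "gcoeff C f n T' Ts' j = gcoeff C f n T Ts j - int (arrows C T Ts k j) * (f (Ts k) + f (Ts' k) - e)"
proof -
  interpret swap: mutation_pair C n k T' T Ts' Ts by (rule mutation_pair_swap)
  let ?m = "int (arrows C T Ts k j)"
  \<comment> \<open>Arrows \<open>k \<rightarrow> j\<close> for \<open>T'\<close> are arrows
    \<open>j \<rightarrow> k\<close> for \<open>T\<close>, so the hypothesis is the one that the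
    exchanged pair requires.\<close>
  have kj: "arrows C T' Ts' k j = 0" using arrows_swap_k[OF j] jk by simp
  have "bmat C T' Ts' r j * f (Ts r) = bmat C T Ts r j * f (Ts r) + ?m * (int (arrows C T Ts r k) * f (Ts r))"
    if r: "r \<in> {1..n} - {k}" for r
  proof (cases "r = j")
    case True
    then show ?thesis using jk by (simp add: bmat_def)
  next
    case False
    then have "bmat C T' Ts' r j = bmat C T Ts r j + ?m * int (arrows C T Ts r k)"
      using swap.arrows_mutation[OF j kj _ False] r arrows_swap_k[OF j] arrows_swap_k[of r]
      by (simp add: bmat_def)
    then show ?thesis by (simp only:) (simp add: distrib_right)
  qed
  then have "(\<Sum>r\<in>{1..n} - {k}. bmat C T' Ts' r j * f (Ts r)) = (\<Sum>r\<in>{1..n} - {k}. bmat C T Ts r j * f (Ts r)) + ?m * e"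
    unfolding e by (simp add: sum.distrib sum_distrib_left)
  moreover have "bmat C T' Ts' k j = - ?m" using arrows_swap_k[OF j] jk by (simp add: bmat_def)
  moreover have "bmat C T Ts k j = ?m" using jk by (simp add: bmat_def)
  ultimately show ?thesis unfolding gcoeff_split_k by (simp add: algebra_simps)
qed

text \<open>The \<open>k\<close>-th coefficient is \<open>e - e'\<close>. Its sign tells which of
  \<open>e\<close>, \<open>e'\<close> is the maximum, so one of the two mutation corrections
  vanishes and the other is a multiple of this coefficient.\<close>

lemma gcoeff_mutation:
  assumes j: "j \<in> {1..n}" "j \<noteq> k"
  shows "gcoeff C f n T Ts k \<ge> 0 \<Longrightarrow>
      gcoeff C f n T' Ts' j = gcoeff C f n T Ts j + [bmat C T Ts j k]\<^sub>+ * gcoeff C f n T Ts k"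
    and "gcoeff C f n T Ts k \<le> 0 \<Longrightarrow>
      gcoeff C f n T' Ts' j = gcoeff C f n T Ts j + [bmat C T Ts k j]\<^sub>+ * gcoeff C f n T Ts k"
proof -
  obtain e e' where ee: "f (Ts k) + f (Ts' k) = max e e'"
    "e = (\<Sum>r\<in>{1..n} - {k}. int (arrows C T Ts r k) * f (Ts r))"
    "e' = (\<Sum>r\<in>{1..n} - {k}. int (arrows C T Ts k r) * f (Ts r))"
    by (rule frieze_exchange)
  have gk: "gcoeff C f n T Ts k = e - e'"
    unfolding gcoeff_split_k ee(2,3) by (simp add: bmat_def left_diff_distrib sum_subtractf)
  have pos: "[bmat C T Ts j k]\<^sub>+ = int (arrows C T Ts j k)" "[bmat C T Ts k j]\<^sub>+ = int (arrows C T Ts k j)"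
    using pos_part_arrows no2cycle j(1) k by metis+
  have cases: "arrows C T Ts k j = 0 \<or> arrows C T Ts j k = 0" using no2cycle[OF j(1) k] by auto
  show "gcoeff C f n T' Ts' j = gcoeff C f n T Ts j + [bmat C T Ts j k]\<^sub>+ * gcoeff C f n T Ts k"
    if "gcoeff C f n T Ts k \<ge> 0"
  proof -
    have "f (Ts k) + f (Ts' k) - e' = gcoeff C f n T Ts k" "f (Ts k) + f (Ts' k) - e = 0"
      using ee(1) gk that by simp_all
    then show ?thesis using cases gcoeff_new_out[OF j _ ee(3)] gcoeff_new_in[OF j _ ee(2)] pos by auto
  qed
  show "gcoeff C f n T' Ts' j = gcoeff C f n T Ts j + [bmat C T Ts k j]\<^sub>+ * gcoeff C f n T Ts k"
    if "gcoeff C f n T Ts k \<le> 0"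
  proof -
    have "f (Ts k) + f (Ts' k) - e' = 0" "f (Ts k) + f (Ts' k) - e = - gcoeff C f n T Ts k"
      using ee(1) gk that by simp_all
    then show ?thesis using cases gcoeff_new_out[OF j _ ee(3)] gcoeff_new_in[OF j _ ee(2)] pos by auto
  qed
qed

text \<open>Treats both linear maps at once: they differ only in the coefficients \<open>c\<close>
  of the image of the \<open>k\<close>-th basis element.\<close>

lemma gvec_mutation:
  assumes g': "\<And>i. i \<in> {1..n} \<Longrightarrow> i \<noteq> k \<Longrightarrow>
      gcoeff C f n T' Ts' i = gcoeff C f n T Ts i + c i * gcoeff C f n T Ts k"
  shows "gvec C f n T' Ts' = K0_linear_map C n T Ts T' (\<lambda>i.
     if i = k
     then inv\<^bsub>K0 C T'\<^esub> (K0_class C T' (Ts' k)) \<otimes>\<^bsub>K0 C T'\<^esub> K0_comb C T' Ts ({1..n} - {k}) c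
     else K0_class C T' (Ts i)) (gvec C f n T Ts)" (is "_ = K0_linear_map C n T Ts T' ?v _")
proof -
  interpret G: comm_group "K0 C T" by (rule old.K0_comm_group)
  interpret K: comm_group "K0 C T'" by (rule new.K0_comm_group)
  let ?x = "\<lambda>i. K0_class C T' (Ts' i)"
  let ?g = "gcoeff C f n T Ts"
  have x: "?x i \<in> carrier (K0 C T')" if "i \<in> {1..n}" for i
    using new.K0_class_closed in_add_self[OF that] by (simp add: new.add_closure_T)
  have y: "K0_class C T (Ts i) \<in> carrier (K0 C T)" if "i \<in> {1..n}" for i
    using old.K0_class_closed in_add_self[OF that] by (simp add: old.add_closure_T)
  have comb: "K0_comb C T' Ts ({1..n} - {k}) c =
      finprod (K0 C T') (\<lambda>r. ?x r [^]\<^bsub>K0 C T'\<^esub> c r) ({1..n} - {k})"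
    unfolding K0_comb_def by (rule K.finprod_cong') (use x agree in auto)
  have comb_in: "K0_comb C T' Ts ({1..n} - {k}) c \<in> carrier (K0 C T')"
    unfolding comb using x by (intro K.finprod_closed) auto
  have v: "?v i \<in> carrier (K0 C T')" if "i \<in> {1..n}" for i
    using x[OF that] x[OF k] comb_in agree[of i] by auto
  let ?\<phi> = "K0_linear_map C n T Ts T' ?v"
  have L1: "?\<phi> \<in> hom (K0 C T) (K0 C T')"
    by (rule old.K0_linear_map(1)[OF K.comm_group_axioms]) (rule v)
  have L2: "?\<phi> (K0_class C T (Ts i)) = ?v i" if "i \<in> {1..n}" for i
    by (rule old.K0_linear_map(2)[OF K.comm_group_axioms _ that]) (rule v)
  have "gvec C f n T Ts = finprod (K0 C T) (\<lambda>i. K0_class C T (Ts i) [^]\<^bsub>K0 C T\<^esub> ?g i) {1..n}"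
    unfolding gvec_def K0_comb_def ..
  then have "?\<phi> (gvec C f n T Ts) = finprod (K0 C T') (\<lambda>i. ?\<phi> (K0_class C T (Ts i) [^]\<^bsub>K0 C T\<^esub> ?g i)) {1..n}"
    using hom_finprod[OF G.comm_group_axioms K.comm_group_axioms L1, of "\<lambda>i. K0_class C T (Ts i) [^]\<^bsub>K0 C T\<^esub> ?g i" "{1..n}"]
      y by (simp only:) auto
  also have "\<dots> = finprod (K0 C T') (\<lambda>i. (if i = k then inv\<^bsub>K0 C T'\<^esub> ?x k \<otimes>\<^bsub>K0 C T'\<^esub>
      finprod (K0 C T') (\<lambda>r. ?x r [^]\<^bsub>K0 C T'\<^esub> c r) ({1..n} - {k}) else ?x i) [^]\<^bsub>K0 C T'\<^esub> ?g i) {1..n}"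
  proof (rule K.finprod_cong')
    fix i assume i: "i \<in> {1..n}"
    have "?\<phi> (K0_class C T (Ts i) [^]\<^bsub>K0 C T\<^esub> ?g i) = ?v i [^]\<^bsub>K0 C T'\<^esub> ?g i"
      using hom_int_pow[OF L1 y[OF i] G.is_group K.is_group, of "?g i"] L2[OF i] by simp
    then show "?\<phi> (K0_class C T (Ts i) [^]\<^bsub>K0 C T\<^esub> ?g i) = (if i = k then inv\<^bsub>K0 C T'\<^esub> ?x k \<otimes>\<^bsub>K0 C T'\<^esub>
      finprod (K0 C T') (\<lambda>r. ?x r [^]\<^bsub>K0 C T'\<^esub> c r) ({1..n} - {k}) else ?x i) [^]\<^bsub>K0 C T'\<^esub> ?g i"
      using comb agree[of i] by simp
  qed (use x x[OF k] comb_in[unfolded comb] in auto)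
  also have "\<dots> = finprod (K0 C T') (\<lambda>i. ?x i [^]\<^bsub>K0 C T'\<^esub> (if i = k then - ?g k else ?g i + c i * ?g k)) {1..n}"
    by (rule K.finprod_transvection[OF finite_atLeastAtMost k x])
  also have "\<dots> = gvec C f n T' Ts'"
    unfolding gvec_def K0_comb_def
    by (rule K.finprod_cong') (use x g' gcoeff_new_k in auto)
  finally show ?thesis by simp
qed

end

theorem proposition5p2:
  fixes C :: "('o, 'm::ab_group_add, 'k::alg_closed_field) tricat"
    and f :: "'o \<Rightarrow> int"
    and n k :: nat
    and T T' Tk' :: 'o
    and Ts Ts' :: "nat \<Rightarrow> 'o"
  assumes "two_CY_category_with_cto C"
    and "tropical_frieze C f"
    and "cluster_tilting C T"
    and "is_dsum C {1..n} Ts T"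
    and "\<And>i. i \<in> {1..n} \<Longrightarrow> indecomposable C (Ts i)"
    and "1 \<le> k" and "k \<le> n"
    and "indecomposable C Tk'"
    and "\<not> isomorphic C Tk' (Ts k)"
    and "Ts' = Ts(k := Tk')"
    and "is_dsum C {1..n} Ts' T'"
    and "cluster_tilting C T'"
    and "no_loops C n T Ts" and "no_2cycles C n T Ts"
    and "no_loops C n T' Ts'" and "no_2cycles C n T' Ts'"
  shows "(gcoeff C f n T Ts k \<ge> 0 \<longrightarrow>
            gvec C f n T' Ts' = phi_plus C n k T Ts T' Tk' (gvec C f n T Ts)) \<and>
         (gcoeff C f n T Ts k \<le> 0 \<longrightarrow>
            gvec C f n T' Ts' = phi_minus C n k T Ts T' Tk' (gvec C f n T Ts))"
proof -
  interpret two_CY_category_with_cto C by fact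
  interpret frieze_mutation C n k T T' Ts Ts' f
    by unfold_locales (use assms in auto)
  have Tk': "Ts' k = Tk'" using assms(10) by simp
  show ?thesis unfolding phi_plus_def phi_minus_def Tk'[symmetric]
  \<comment> \<open>Unification reads the coefficients \<open>c\<close> off the two linear
    maps.\<close>
  proof (intro conjI impI; rule gvec_mutation)
    show "gcoeff C f n T' Ts' i = gcoeff C f n T Ts i + [bmat C T Ts i k]\<^sub>+ * gcoeff C f n T Ts k"
      if "gcoeff C f n T Ts k \<ge> 0" "i \<in> {1..n}" "i \<noteq> k" for i
      using gcoeff_mutation(1) that by blast
    show "gcoeff C f n T' Ts' i = gcoeff C f n T Ts i + [bmat C T Ts k i]\<^sub>+ * gcoeff C f n T Ts k"
      if "gcoeff C f n T Ts k \<le> 0" "i \<in> {1..n}" "i \<noteq> k" for i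
      using gcoeff_mutation(2) that by blast
  qed
qed

end
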